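(* There exists a connected open set $\Omega\subset\mathbb{R}^3$ with $\mathcal{H}^2(\partial\Omega)<\infty$ such that, for $p=9$, the approximative trace in $W^{1,p}(\Omega)$ is not unique, but every $u\in W^{1,p}(\Omega)$ has an approximative trace in $L^p(\partial\Omega)$.
   Context: For a nonempty open set $\Omega\subset\mathbb{R}^3$ with $\mathcal{H}^2(\partial\Omega)<\infty$ ($\mathcal{H}^2$ the two-dimensional Hausdorff measure; spaces $L^q(\partial\Omega)$ are with respect to $\mathcal{H}^2$; functions are real-valued), $W^{1,p}(\Omega)\cap C(\overline\Omega)$ is the set of continuous functions on $\overline\Omega$ whose restriction to $\Omega$ is in $W^{1,p}(\Omega)$. Let $Y$ be $L^1_{\mathrm{loc}}(\partial\Omega)$ (functions integrable over every compact subset of $\partial\Omega$, with the topology of the seminorms $\varphi\mapsto\int_K|\varphi|\,d\mathcal{H}^2$, $K\subset\partial\Omega$ compact) or $L^q(\partial\Omega)$. A function $\varphi\in Y$ is an approximative trace in $Y$ of $u\in W^{1,p}(\Omega)$ if there is a sequence $(u_n)$ in $W^{1,p}(\Omega)\cap C(\overline\Omega)$ with $u_n|_{\partial\Omega}\in Y$ for all $n$, $u_n\to u$ in $W^{1,p}(\Omega)$ and $u_n|_{\partial\Omega}\to\varphi$ in $Y$. The approximative trace in $W^{1,p}(\Omega)$ is not unique if the zero function in $W^{1,p}(\Omega)$ has a nonzero approximative trace in $Y=L^1_{\mathrm{loc}}(\partial\Omega)$. *)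

theory Defs
  imports "HOL-Analysis.Analysis"
begin

section \<open>Hausdorff measure\<close>

text \<open>The normalisation is the one for which the \<open>n\<close>-dimensional Hausdorff measure on an
  \<open>n\<close>-dimensional Euclidean space is Lebesgue measure.\<close>

definition hausdorff_gauge :: "nat \<Rightarrow> 'a::metric_space set \<Rightarrow> ennreal" where
  "hausdorff_gauge s U =
    (if U = {} then 0 else ennreal (unit_ball_vol (real s) * (diameter U / 2) ^ s))"

text \<open>\<open>diameter\<close> is meaningless for unbounded sets, so boundedness is demanded separately.\<close>

definition hausdorff_cover :: "real \<Rightarrow> 'a::metric_space set \<Rightarrow> (nat \<Rightarrow> 'a set) \<Rightarrow> bool" where
  "hausdorff_cover \<delta> A U \<longleftrightarrow>
    (\<forall>n. bounded (U n) \<and> diameter (U n) \<le> \<delta>) \<and> A \<subseteq> (\<Union>n. U n)"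

definition hausdorff_pre :: "nat \<Rightarrow> real \<Rightarrow> 'a::metric_space set \<Rightarrow> ennreal" where
  "hausdorff_pre s \<delta> A = (INF U \<in> {U. hausdorff_cover \<delta> A U}. \<Sum>n. hausdorff_gauge s (U n))"

definition hausdorff_outer :: "nat \<Rightarrow> 'a::metric_space set \<Rightarrow> ennreal" where
  "hausdorff_outer s A = (SUP \<delta> \<in> {0<..}. hausdorff_pre s \<delta> A)"

definition hausdorff_measure :: "nat \<Rightarrow> 'a::metric_space measure" where
  "hausdorff_measure s = measure_of UNIV (sets borel) (hausdorff_outer s)"

text \<open>\<open>measure_of\<close> yields the zero measure unless the set function is countably additive. The
  following lemmas show that it is, ending with \<open>emeasure_hausdorff_measure\<close>.\<close>

lemma sets_hausdorff_measure [simp, measurable_cong]: "sets (hausdorff_measure s) = sets borel"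
  unfolding hausdorff_measure_def using sets.sigma_sets_eq[of borel] by simp

lemma space_hausdorff_measure [simp]: "space (hausdorff_measure s) = UNIV"
  unfolding hausdorff_measure_def by (simp add: space_measure_of_conv)

lemma hausdorff_pre_mono: "A \<subseteq> B \<Longrightarrow> hausdorff_pre s \<delta> A \<le> hausdorff_pre s \<delta> B"
  unfolding hausdorff_pre_def hausdorff_cover_def by (rule INF_superset_mono) blast+

lemma hausdorff_pre_antimono: "\<delta> \<le> \<delta>' \<Longrightarrow> hausdorff_pre s \<delta>' A \<le> hausdorff_pre s \<delta> A"
  unfolding hausdorff_pre_def hausdorff_cover_def
  by (rule INF_superset_mono) (use order_trans in blast)+

lemma hausdorff_pre_empty: "0 < \<delta> \<Longrightarrow> hausdorff_pre s \<delta> {} = 0"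
proof -
  assume "0 < \<delta>"
  then have "hausdorff_pre s \<delta> ({} :: 'a set) \<le> (\<Sum>n::nat. hausdorff_gauge s ({} :: 'a set))"
    unfolding hausdorff_pre_def by (intro INF_lower) (auto simp: hausdorff_cover_def)
  also have "\<dots> = 0" by (simp add: hausdorff_gauge_def)
  finally show ?thesis by simp
qed

lemma hausdorff_outer_empty: "hausdorff_outer s {} = 0"
  unfolding hausdorff_outer_def
  by (rule antisym) (auto intro!: SUP_least simp: hausdorff_pre_empty)

lemma hausdorff_outer_mono: "A \<subseteq> B \<Longrightarrow> hausdorff_outer s A \<le> hausdorff_outer s B"
  unfolding hausdorff_outer_def by (intro SUP_mono) (auto intro: hausdorff_pre_mono)

lemma hausdorff_pre_le_outer: "0 < \<delta> \<Longrightarrow> hausdorff_pre s \<delta> A \<le> hausdorff_outer s A"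
  unfolding hausdorff_outer_def by (intro SUP_upper) auto

lemma hausdorff_pre_subadditive:
  "hausdorff_pre s \<delta> (\<Union>i. A i) \<le> (\<Sum>i::nat. hausdorff_pre s \<delta> (A i))"
proof (rule ennreal_le_epsilon)
  fix e :: real assume e: "0 < e" and fin: "(\<Sum>i. hausdorff_pre s \<delta> (A i)) < top"
  have "\<exists>U. hausdorff_cover \<delta> (A i) U \<and>
      (\<Sum>n. hausdorff_gauge s (U n)) \<le> hausdorff_pre s \<delta> (A i) + e * (1/2)^Suc i" for i
  proof -
    have "hausdorff_pre s \<delta> (A i) < hausdorff_pre s \<delta> (A i) + e * (1/2)^Suc i"
      using e fin by (auto simp add: less_top dest!: ennreal_suminf_lessD)
    then have "(INF U \<in> {U. hausdorff_cover \<delta> (A i) U}. \<Sum>n. hausdorff_gauge s (U n))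
        < hausdorff_pre s \<delta> (A i) + e * (1/2)^Suc i"
      by (simp add: hausdorff_pre_def)
    then show ?thesis unfolding INF_less_iff by (auto intro: less_imp_le)
  qed
  then obtain U where U: "\<And>i. hausdorff_cover \<delta> (A i) (U i)"
    and le: "\<And>i. (\<Sum>n. hausdorff_gauge s (U i n)) \<le> hausdorff_pre s \<delta> (A i) + e * (1/2)^Suc i"
    by metis
  define V where "V = case_prod U o prod_decode"
  have "hausdorff_cover \<delta> (\<Union>i. A i) V"
  proof -
    have "x \<in> (\<Union>n. V n)" if xA: "x \<in> A i" for x i
    proof -
      obtain n where "x \<in> U i n" using U[of i] xA unfolding hausdorff_cover_def by blast
      then have "x \<in> V (prod_encode (i, n))" by (simp add: V_def)
      then show ?thesis by blast
    qed
    then show ?thesis using U by (auto simp: hausdorff_cover_def V_def split: prod.split)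
  qed
  then have "hausdorff_pre s \<delta> (\<Union>i. A i) \<le> (\<Sum>n. hausdorff_gauge s (V n))"
    unfolding hausdorff_pre_def by (intro INF_lower) auto
  also have "\<dots> = (\<Sum>n. (\<lambda>(i, m). hausdorff_gauge s (U i m)) (prod_decode n))"
    by (simp add: V_def split_beta)
  also have "\<dots> = (\<Sum>i. \<Sum>m. hausdorff_gauge s (U i m))"
    by (rule suminf_ennreal_2dimen) simp
  also have "\<dots> \<le> (\<Sum>i. hausdorff_pre s \<delta> (A i) + e * (1/2) ^ Suc i)"
    using le by (intro suminf_le) auto
  also have "\<dots> = (\<Sum>i. hausdorff_pre s \<delta> (A i)) + (\<Sum>i. ennreal e * ennreal ((1/2) ^ Suc i))"
    using e by (subst suminf_add[symmetric])
      (auto simp del: ennreal_suminf_cmult simp add: ennreal_mult[symmetric])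
  also have "\<dots> = (\<Sum>i. hausdorff_pre s \<delta> (A i)) + e"
    unfolding ennreal_suminf_cmult
    by (subst suminf_ennreal_eq[OF zero_le_power power_half_series]) auto
  finally show "hausdorff_pre s \<delta> (\<Union>i. A i) \<le> (\<Sum>i. hausdorff_pre s \<delta> (A i)) + e" .
qed

lemma hausdorff_outer_subadditive:
  "hausdorff_outer s (\<Union>i. A i) \<le> (\<Sum>i::nat. hausdorff_outer s (A i))"
  unfolding hausdorff_outer_def[of s "\<Union>i. A i"]
proof (rule SUP_least)
  fix \<delta> :: real assume "\<delta> \<in> {0<..}"
  then have "(\<Sum>i. hausdorff_pre s \<delta> (A i)) \<le> (\<Sum>i. hausdorff_outer s (A i))"
    by (intro suminf_le) (auto intro: hausdorff_pre_le_outer)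
  then show "hausdorff_pre s \<delta> (\<Union>i. A i) \<le> (\<Sum>i. hausdorff_outer s (A i))"
    using hausdorff_pre_subadditive order_trans by blast
qed

lemma hausdorff_outer_Un: "hausdorff_outer s (A \<union> B) \<le> hausdorff_outer s A + hausdorff_outer s B"
proof -
  define F where "F = (\<lambda>i::nat. if i = 0 then A else if i = 1 then B else {})"
  have "A \<union> B = (\<Union>i. F i)"
    by (auto simp: F_def split: if_splits)
  then have "hausdorff_outer s (A \<union> B) \<le> (\<Sum>i. hausdorff_outer s (F i))"
    using hausdorff_outer_subadditive[of s F] by simp
  also have "\<dots> = (\<Sum>i\<in>{0,1}. hausdorff_outer s (F i))"
    by (rule suminf_finite) (auto simp: F_def hausdorff_outer_empty)
  also have "\<dots> = hausdorff_outer s A + hausdorff_outer s B"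
    by (simp add: F_def)
  finally show ?thesis .
qed

lemma outer_measure_space_hausdorff: "outer_measure_space UNIV (hausdorff_outer s)"
  unfolding outer_measure_space_def positive_def increasing_def countably_subadditive_def
  by (auto simp: hausdorff_outer_empty intro: hausdorff_outer_mono hausdorff_outer_subadditive)

lemma hausdorff_outer_separated:
  assumes e: "0 < e" and sep: "\<And>x y. x \<in> A \<Longrightarrow> y \<in> B \<Longrightarrow> e \<le> dist x y"
  shows "hausdorff_outer s A + hausdorff_outer s B \<le> hausdorff_outer s (A \<union> B)"
proof -
  have small: "hausdorff_pre s \<delta> A + hausdorff_pre s \<delta> B \<le> hausdorff_pre s \<delta> (A \<union> B)"
    if \<delta>: "0 < \<delta>" "\<delta> < e" for \<delta>
    unfolding hausdorff_pre_def[of s \<delta> "A \<union> B"]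
  proof (rule INF_greatest)
    fix U assume "U \<in> {U. hausdorff_cover \<delta> (A \<union> B) U}"
    then have bd: "\<And>n. bounded (U n)" and dm: "\<And>n. diameter (U n) \<le> \<delta>"
      and cov: "A \<union> B \<subseteq> (\<Union>n. U n)"
      by (auto simp: hausdorff_cover_def)
    define V W where "V = (\<lambda>n. if U n \<inter> A = {} then {} else U n)"
      and "W = (\<lambda>n. if U n \<inter> A = {} then U n else {})"
    have disj: "U n \<inter> B = {}" if ne: "U n \<inter> A \<noteq> {}" for n
    proof (rule ccontr)
      assume "U n \<inter> B \<noteq> {}"
      then obtain x y where xy: "x \<in> U n" "x \<in> A" "y \<in> U n" "y \<in> B" using ne by blast
      then have "e \<le> dist x y" using sep by blast
      also have "\<dots> \<le> \<delta>" using diameter_bounded_bound[OF bd] xy dm order_trans by blast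
      finally show False using \<delta> by simp
    qed
    have "hausdorff_cover \<delta> A V"
      using bd dm cov \<delta> unfolding hausdorff_cover_def V_def by (auto split: if_splits) blast
    moreover have "hausdorff_cover \<delta> B W"
      using bd dm cov \<delta> disj unfolding hausdorff_cover_def W_def by (auto split: if_splits) blast
    ultimately have "hausdorff_pre s \<delta> A + hausdorff_pre s \<delta> B
        \<le> (\<Sum>n. hausdorff_gauge s (V n)) + (\<Sum>n. hausdorff_gauge s (W n))"
      unfolding hausdorff_pre_def by (intro add_mono INF_lower) auto
    also have "\<dots> = (\<Sum>n. hausdorff_gauge s (V n) + hausdorff_gauge s (W n))"
      by (rule suminf_add) auto
    also have "(\<lambda>n. hausdorff_gauge s (V n) + hausdorff_gauge s (W n))
        = (\<lambda>n. hausdorff_gauge s (U n))"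
      by (auto simp: V_def W_def hausdorff_gauge_def)
    finally show "hausdorff_pre s \<delta> A + hausdorff_pre s \<delta> B \<le> (\<Sum>n. hausdorff_gauge s (U n))" .
  qed
  have "hausdorff_pre s \<delta> A + hausdorff_pre s \<delta>' B \<le> hausdorff_outer s (A \<union> B)"
    if "0 < \<delta>" "0 < \<delta>'" for \<delta> \<delta>'
  proof -
    define \<eta> where "\<eta> = min (min \<delta> \<delta>') (e / 2)"
    have \<eta>: "0 < \<eta>" "\<eta> < e" "\<eta> \<le> \<delta>" "\<eta> \<le> \<delta>'" using that e by (auto simp: \<eta>_def min_def)
    have "hausdorff_pre s \<delta> A + hausdorff_pre s \<delta>' B \<le> hausdorff_pre s \<eta> A + hausdorff_pre s \<eta> B"
      using \<eta> by (intro add_mono hausdorff_pre_antimono)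
    also have "\<dots> \<le> hausdorff_pre s \<eta> (A \<union> B)" using small \<eta> by blast
    also have "\<dots> \<le> hausdorff_outer s (A \<union> B)" using \<eta> by (intro hausdorff_pre_le_outer)
    finally show ?thesis .
  qed
  then have "(SUP \<delta>\<in>{0<..}. SUP \<delta>'\<in>{0<..}. hausdorff_pre s \<delta> A + hausdorff_pre s \<delta>' B)
      \<le> hausdorff_outer s (A \<union> B)"
    by (intro SUP_least) auto
  also have "(SUP \<delta>\<in>{0<..}. SUP \<delta>'\<in>{0<..}. hausdorff_pre s \<delta> A + hausdorff_pre s \<delta>' B)
      = (SUP \<delta>\<in>{0<..}. hausdorff_pre s \<delta> A + hausdorff_outer s B)"
    unfolding hausdorff_outer_def by (intro SUP_cong refl ennreal_SUP_add_right[symmetric]) simp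
  also have "\<dots> = hausdorff_outer s A + hausdorff_outer s B"
    unfolding hausdorff_outer_def[of s A] by (rule ennreal_SUP_add_left) simp
  finally show ?thesis .
qed

lemma closed_in_hausdorff_lambda_system:
  fixes C :: "'a::metric_space set"
  assumes "closed C"
  shows "C \<in> lambda_system UNIV UNIV (hausdorff_outer s)"
proof -
  let ?H = "hausdorff_outer s :: 'a set \<Rightarrow> ennreal"
  have main: "?H (X \<inter> C) + ?H (X - C) \<le> ?H X" if ne: "C \<noteq> {}" and fin: "?H X < top" for X
  proof -
    define A where "A n = {x \<in> X. 1 / real (Suc n) \<le> infdist x C}" for n
    define R where "R n = A (Suc n) - A n" for n
    have A_sub: "A n \<subseteq> X - C" for n
    proof
      fix x assume x: "x \<in> A n"
      have "0 < 1 / real (Suc n)" by simp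
      also have "\<dots> \<le> infdist x C" using x by (simp add: A_def)
      finally have "0 < infdist x C" .
      with x show "x \<in> X - C" unfolding A_def by auto
    qed
    have A_Suc: "A n \<subseteq> A (Suc n)" for n
    proof -
      have "1 / real (Suc (Suc n)) \<le> 1 / real (Suc n)" by (simp add: frac_le)
      then show ?thesis unfolding A_def by auto
    qed
    have A_mono: "A m \<subseteq> A n" if "m \<le> n" for m n
      using that by (rule lift_Suc_mono_le[of A, OF A_Suc])
    have "X - C = (\<Union>n. A n)"
    proof
      show "X - C \<subseteq> (\<Union>n. A n)"
      proof
        fix x assume x: "x \<in> X - C"
        then have "0 < infdist x C" using infdist_pos_not_in_closed[OF assms ne] by auto
        then obtain n where "1 / real (Suc n) < infdist x C" using nat_approx_posE by blast
        then show "x \<in> (\<Union>n. A n)" using x by (auto simp: A_def intro!: exI[of _ n])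
      qed
    qed (use A_sub in blast)
    have tail: "X - C \<subseteq> A n \<union> (\<Union>i. R (i + n))" for n
    proof
      fix x assume "x \<in> X - C"
      then obtain m where m: "x \<in> A m" using \<open>X - C = (\<Union>n. A n)\<close> by blast
      show "x \<in> A n \<union> (\<Union>i. R (i + n))"
      proof (cases "x \<in> A n")
        case False
        define k where "k = (LEAST k. x \<in> A k)"
        have k: "x \<in> A k" unfolding k_def using m by (rule LeastI)
        then have "\<not> k \<le> n" using False A_mono by blast
        then obtain j where j: "k = Suc (j + n)"
          by (metis add.commute less_imp_Suc_add not_le_imp_less)
        have "x \<notin> A (j + n)" using not_less_Least[of "j + n" "\<lambda>k. x \<in> A k"] j k_def by auto
        then have "x \<in> R (j + n)" using k j by (simp add: R_def)
        then show ?thesis by blast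
      qed simp
    qed
    have sep: "?H S + ?H T \<le> ?H (S \<union> T)" if S: "S \<subseteq> A n" and T: "T \<subseteq> X - A (Suc n)" for S T n
    proof (rule hausdorff_outer_separated[of "1 / real (Suc n) - 1 / real (Suc (Suc n))"])
      show "0 < 1 / real (Suc n) - 1 / real (Suc (Suc n))" by (simp add: frac_less2)
      fix x y assume "x \<in> S" "y \<in> T"
      then have "1 / real (Suc n) \<le> infdist x C" "infdist y C < 1 / real (Suc (Suc n))"
        using S T by (auto simp: A_def)
      moreover have "infdist x C \<le> infdist y C + dist x y" by (rule infdist_triangle)
      ultimately show "1 / real (Suc n) - 1 / real (Suc (Suc n)) \<le> dist x y" by linarith
    qed
    have half: "(\<Sum>k<N. ?H (R (2 * k + j))) \<le> ?H (\<Union>k<N. R (2 * k + j))" for N j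
    proof (induction N)
      case (Suc N)
      let ?S = "\<Union>k<N. R (2 * k + j)"
      show ?case
      proof (cases N)
        case 0
        then show ?thesis by (simp add: lessThan_Suc)
      next
        case (Suc M)
        have "?H ?S + ?H (R (2 * N + j)) \<le> ?H (?S \<union> R (2 * N + j))"
        proof (rule sep[of _ "2 * M + j + 1"])
          have "R (2 * k + j) \<subseteq> A (2 * M + j + 1)" if "k < N" for k
          proof -
            have "R (2 * k + j) \<subseteq> A (Suc (2 * k + j))" by (auto simp: R_def)
            also have "\<dots> \<subseteq> A (2 * M + j + 1)" using that Suc by (intro A_mono) auto
            finally show ?thesis .
          qed
          then show "?S \<subseteq> A (2 * M + j + 1)" by blast
          have *: "Suc (2 * M + j + 1) = 2 * N + j" using Suc by simp
          show "R (2 * N + j) \<subseteq> X - A (Suc (2 * M + j + 1))"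
            unfolding * using A_sub unfolding R_def by blast
        qed
        also have "?S \<union> R (2 * N + j) = (\<Union>k<Suc N. R (2 * k + j))" by (auto simp: lessThan_Suc)
        finally have "?H ?S + ?H (R (2 * N + j)) \<le> ?H (\<Union>k<Suc N. R (2 * k + j))" .
        moreover have "(\<Sum>k<Suc N. ?H (R (2 * k + j))) \<le> ?H ?S + ?H (R (2 * N + j))"
          using Suc.IH by (simp add: add_right_mono)
        ultimately show ?thesis by (rule order_trans[rotated])
      qed
    qed simp
    have half': "(\<Sum>k<N. ?H (R (2 * k + j))) \<le> ?H X" for N j
      using A_sub by (intro order_trans[OF half] hausdorff_outer_mono) (auto simp: R_def)
    have "(\<Sum>k. ?H (R k)) \<le> ?H X + ?H X"
    proof (rule suminf_le_const)
      fix N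
      have "(\<Sum>k<N. ?H (R k)) \<le> (\<Sum>k<2 * N. ?H (R k))"
        by (intro sum_mono2) auto
      also have "\<dots> = (\<Sum>k<N. ?H (R (2 * k + 0))) + (\<Sum>k<N. ?H (R (2 * k + 1)))"
        by (induction N) (auto simp: algebra_simps)
      also have "\<dots> \<le> ?H X + ?H X" by (intro add_mono half')
      finally show "(\<Sum>k<N. ?H (R k)) \<le> ?H X + ?H X" .
    qed simp
    also have "\<dots> < top" using fin by simp
    finally have sum_fin: "(\<Sum>k. ?H (R k)) < top" .
    have tail0: "(\<lambda>n. \<Sum>i. ?H (R (i + n))) \<longlonglongrightarrow> 0"
    proof -
      define r where "r k = enn2real (?H (R k))" for k
      have Rr: "?H (R k) = ennreal (r k)" for k
        using ennreal_suminf_lessD[OF sum_fin, of k] by (simp add: r_def)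
      have r0: "0 \<le> r k" for k by (simp add: r_def)
      have sm: "summable r"
        using sum_fin r0 by (intro summable_suminf_not_top) (auto simp: Rr)
      have eq: "(\<Sum>i. ?H (R (i + n))) = ennreal (\<Sum>i. r (i + n))" for n
        unfolding Rr using sm r0 by (intro suminf_ennreal2) (auto simp: summable_iff_shift)
      have "(\<lambda>n. \<Sum>i. r (i + n)) \<longlonglongrightarrow> 0" using sm by (rule suminf_exist_split2)
      then have "(\<lambda>n. ennreal (\<Sum>i. r (i + n))) \<longlonglongrightarrow> ennreal 0" by (rule tendsto_ennrealI)
      then show ?thesis unfolding eq by simp
    qed
    have bound: "?H (X \<inter> C) + ?H (X - C) \<le> ?H X + (\<Sum>i. ?H (R (i + n)))" for n
    proof -
      have "?H (X - C) \<le> ?H (A n) + ?H (\<Union>i. R (i + n))"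
        using hausdorff_outer_mono[OF tail] hausdorff_outer_Un order_trans by blast
      also have "\<dots> \<le> ?H (A n) + (\<Sum>i. ?H (R (i + n)))"
        by (intro add_left_mono hausdorff_outer_subadditive)
      finally have "?H (X \<inter> C) + ?H (X - C)
          \<le> ?H (X \<inter> C) + (?H (A n) + (\<Sum>i. ?H (R (i + n))))"
        by (rule add_left_mono)
      also have "\<dots> = (?H (A n) + ?H (X \<inter> C)) + (\<Sum>i. ?H (R (i + n)))"
        by (simp add: ac_simps)
      also have "\<dots> \<le> ?H X + (\<Sum>i. ?H (R (i + n)))"
      proof (rule add_right_mono)
        have "?H (A n) + ?H (X \<inter> C) \<le> ?H (A n \<union> (X \<inter> C))"
          using A_sub by (intro sep) auto
        also have "\<dots> \<le> ?H X" using A_sub by (intro hausdorff_outer_mono) auto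
        finally show "?H (A n) + ?H (X \<inter> C) \<le> ?H X" .
      qed
      finally show ?thesis .
    qed
    have "(\<lambda>n. ?H X + (\<Sum>i. ?H (R (i + n)))) \<longlonglongrightarrow> ?H X + 0"
      using tail0 by (intro tendsto_add tendsto_const)
    then have "?H (X \<inter> C) + ?H (X - C) \<le> ?H X + 0"
      by (rule LIMSEQ_le_const) (use bound in auto)
    then show ?thesis by simp
  qed
  have le: "?H (X \<inter> C) + ?H (X - C) \<le> ?H X" for X
  proof (cases "C = {} \<or> ?H X = top")
    case True
    then show ?thesis by (auto simp: hausdorff_outer_empty)
  next
    case False
    then show ?thesis using main by (simp add: less_top)
  qed
  have ge: "?H X \<le> ?H (X \<inter> C) + ?H (X - C)" for X
    using hausdorff_outer_Un[of s "X \<inter> C" "X - C"] by (simp add: Int_Diff_Un)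
  have "algebra UNIV (UNIV :: 'a set set)" using algebra_Pow[of "UNIV :: 'a set"] by simp
  then show ?thesis
    by (simp add: algebra.lambda_system_eq antisym[OF le ge])
qed

lemma emeasure_hausdorff_measure:
  assumes "A \<in> sets borel"
  shows "emeasure (hausdorff_measure s) A = hausdorff_outer s A"
proof -
  let ?L = "lambda_system UNIV UNIV (hausdorff_outer s) :: 'a set set"
  have "sigma_algebra UNIV (UNIV :: 'a set set)"
    using sigma_algebra_Pow[of "UNIV :: 'a set"] by simp
  then have ms: "measure_space UNIV ?L (hausdorff_outer s)"
    by (rule sigma_algebra.caratheodory_lemma[OF _ outer_measure_space_hausdorff])
  have "sigma_sets UNIV (Collect closed) \<subseteq> ?L"
    using ms closed_in_hausdorff_lambda_system
    by (intro sigma_algebra.sigma_sets_subset) (auto simp: measure_space_def)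
  then have sub: "sets (borel :: 'a measure) \<subseteq> ?L"
    by (simp add: borel_eq_closed)
  show ?thesis
    unfolding hausdorff_measure_def
  proof (rule emeasure_measure_of_sigma)
    show "sigma_algebra UNIV (sets (borel :: 'a measure))"
      using sets.sigma_algebra_axioms[of "borel :: 'a measure"] by simp
    show "positive (sets borel) (hausdorff_outer s :: 'a set \<Rightarrow> ennreal)"
      by (simp add: positive_def hausdorff_outer_empty)
    show "countably_additive (sets borel) (hausdorff_outer s :: 'a set \<Rightarrow> ennreal)"
      using ms sub unfolding measure_space_def countably_additive_def by (meson subset_trans subsetD)
  qed (fact assms)
qed


section \<open>Lebesgue and Sobolev spaces\<close>

text \<open>Elements of function spaces are represented by total functions. Only their values on
  the relevant set matter, and functions agreeing almost everywhere represent the same element.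
  The exponents range over \<open>1 \<le> p < \<infinity>\<close>.\<close>

definition Lp_space :: "'a measure \<Rightarrow> real \<Rightarrow> ('a \<Rightarrow> 'b::euclidean_space) set" where
  "Lp_space M p = {f \<in> borel_measurable M. integrable M (\<lambda>x. norm (f x) powr p)}"

definition Lp_norm :: "'a measure \<Rightarrow> real \<Rightarrow> ('a \<Rightarrow> 'b::euclidean_space) \<Rightarrow> real" where
  "Lp_norm M p f = (\<integral>x. norm (f x) powr p \<partial>M) powr (1 / p)"

fun times_continuously_differentiable :: "nat \<Rightarrow> ('a::euclidean_space \<Rightarrow> real) \<Rightarrow> bool" where
  "times_continuously_differentiable 0 f \<longleftrightarrow> continuous_on UNIV f"
| "times_continuously_differentiable (Suc k) f \<longleftrightarrow>
    (\<forall>x. f differentiable (at x)) \<and>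
    (\<forall>v. times_continuously_differentiable k (\<lambda>x. frechet_derivative f (at x) v))"

definition test_function :: "'a::euclidean_space set \<Rightarrow> ('a \<Rightarrow> real) \<Rightarrow> bool" where
  "test_function \<Omega> \<psi> \<longleftrightarrow>
    (\<forall>k. times_continuously_differentiable k \<psi>) \<and>
    compact (closure {x. \<psi> x \<noteq> 0}) \<and> closure {x. \<psi> x \<noteq> 0} \<subseteq> \<Omega>"

definition locally_integrable ::
  "'a::euclidean_space set \<Rightarrow> ('a \<Rightarrow> 'b::euclidean_space) \<Rightarrow> bool" where
  "locally_integrable \<Omega> f \<longleftrightarrow> (\<forall>K. compact K \<and> K \<subseteq> \<Omega> \<longrightarrow> set_integrable lebesgue K f)"

definition weak_gradient ::
  "'a::euclidean_space set \<Rightarrow> ('a \<Rightarrow> real) \<Rightarrow> ('a \<Rightarrow> 'a) \<Rightarrow> bool" where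
  "weak_gradient \<Omega> u G \<longleftrightarrow>
    locally_integrable \<Omega> u \<and> locally_integrable \<Omega> G \<and>
    (\<forall>\<psi>. test_function \<Omega> \<psi> \<longrightarrow> (\<forall>b\<in>Basis.
      (LINT x:\<Omega>|lebesgue. u x * frechet_derivative \<psi> (at x) b) =
      - (LINT x:\<Omega>|lebesgue. (G x \<bullet> b) * \<psi> x)))"

definition sobolev :: "'a::euclidean_space set \<Rightarrow> real \<Rightarrow> ('a \<Rightarrow> real) set" where
  "sobolev \<Omega> p = {u \<in> Lp_space (lebesgue_on \<Omega>) p.
    \<exists>G. weak_gradient \<Omega> u G \<and> G \<in> Lp_space (lebesgue_on \<Omega>) p}"

text \<open>Weak gradients are unique up to null sets, so the choice of \<open>H\<close> and \<open>G\<close> in the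
  following definition of convergence in the norm of \<open>W\<^sup>1\<^sup>,\<^sup>p\<close> is immaterial.\<close>

definition sobolev_tendsto ::
  "'a::euclidean_space set \<Rightarrow> real \<Rightarrow> (nat \<Rightarrow> 'a \<Rightarrow> real) \<Rightarrow> ('a \<Rightarrow> real) \<Rightarrow> bool" where
  "sobolev_tendsto \<Omega> p v u \<longleftrightarrow>
    (\<forall>n. v n \<in> sobolev \<Omega> p) \<and> u \<in> sobolev \<Omega> p \<and>
    (\<exists>H G. (\<forall>n. weak_gradient \<Omega> (v n) (H n) \<and> H n \<in> Lp_space (lebesgue_on \<Omega>) p) \<and>
      weak_gradient \<Omega> u G \<and> G \<in> Lp_space (lebesgue_on \<Omega>) p \<and>
      (\<lambda>n. Lp_norm (lebesgue_on \<Omega>) p (\<lambda>x. v n x - u x)) \<longlonglongrightarrow> 0 \<and>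
      (\<lambda>n. Lp_norm (lebesgue_on \<Omega>) p (\<lambda>x. H n x - G x)) \<longlonglongrightarrow> 0)"


section \<open>Approximative traces\<close>

definition boundary_measure :: "(real^3) set \<Rightarrow> (real^3) measure" where
  "boundary_measure \<Omega> = restrict_space (hausdorff_measure 2) (frontier \<Omega>)"

datatype trace_space = L1_loc | L_q real

fun boundary_space :: "(real^3) set \<Rightarrow> trace_space \<Rightarrow> (real^3 \<Rightarrow> real) set" where
  "boundary_space \<Omega> L1_loc = {\<phi> \<in> borel_measurable (boundary_measure \<Omega>).
    \<forall>K. compact K \<and> K \<subseteq> frontier \<Omega> \<longrightarrow> set_integrable (boundary_measure \<Omega>) K \<phi>}"
| "boundary_space \<Omega> (L_q q) = Lp_space (boundary_measure \<Omega>) q"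

fun boundary_tendsto ::
  "(real^3) set \<Rightarrow> trace_space \<Rightarrow> (nat \<Rightarrow> real^3 \<Rightarrow> real) \<Rightarrow> (real^3 \<Rightarrow> real) \<Rightarrow> bool" where
  "boundary_tendsto \<Omega> L1_loc f \<phi> \<longleftrightarrow>
    (\<forall>K. compact K \<and> K \<subseteq> frontier \<Omega> \<longrightarrow>
      (\<lambda>n. LINT x:K|boundary_measure \<Omega>. \<bar>f n x - \<phi> x\<bar>) \<longlonglongrightarrow> 0)"
| "boundary_tendsto \<Omega> (L_q q) f \<phi> \<longleftrightarrow>
    (\<lambda>n. Lp_norm (boundary_measure \<Omega>) q (\<lambda>x. f n x - \<phi> x)) \<longlonglongrightarrow> 0"

definition approximative_trace ::
  "(real^3) set \<Rightarrow> real \<Rightarrow> trace_space \<Rightarrow> (real^3 \<Rightarrow> real) \<Rightarrow> (real^3 \<Rightarrow> real) \<Rightarrow> bool" where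
  "approximative_trace \<Omega> p Y u \<phi> \<longleftrightarrow>
    u \<in> sobolev \<Omega> p \<and> \<phi> \<in> boundary_space \<Omega> Y \<and>
    (\<exists>v. (\<forall>n. v n \<in> sobolev \<Omega> p \<and> continuous_on (closure \<Omega>) (v n) \<and> v n \<in> boundary_space \<Omega> Y) \<and>
      sobolev_tendsto \<Omega> p v u \<and> boundary_tendsto \<Omega> Y v \<phi>)"

definition approximative_trace_not_unique :: "(real^3) set \<Rightarrow> real \<Rightarrow> bool" where
  "approximative_trace_not_unique \<Omega> p \<longleftrightarrow>
    (\<exists>\<phi>. approximative_trace \<Omega> p L1_loc (\<lambda>_. 0) \<phi> \<and>
      \<not> (AE x in boundary_measure \<Omega>. \<phi> x = 0))"

end

theory Submission
  imports Defs
begin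

text \<open>\<open>\<Omega>\<close> is an infinite tree of thin slanted tubes: the \<open>4^k\<close> tubes of level \<open>k\<close> have length about
  \<open>h = 2^-k\<close> and width about \<open>r = h^8\<close>, each tube branches into four at its lower end, and the tubes
  accumulate on the square \<open>[0, 1]\<^sup>2 \<times> {0}\<close>, which has positive area and lies in the boundary.

  Cutting off between heights \<open>h\<close> and \<open>2 h\<close> costs \<open>4^k (h r\<^sup>2) h^-9 \<longrightarrow> 0\<close> in the Dirichlet energy, so the
  constant 1 is a limit of continuous functions vanishing near the square; this gives
  non-uniqueness. On the other hand Morrey's inequality (\<open>9 > 3\<close>) bounds the oscillation of a Sobolev
  function on a tube \<open>T\<close>, to the ninth power, by \<open>h^8 r^-2 \<integral>\<^sub>T |\<nabla>u|^9\<close>. Summing along the branches, the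
  suprema \<open>S\<close> of \<open>|u|\<close> over the tubes satisfy \<open>\<Sum> h^8 S^9 < \<infinity>\<close>. Up to constants this sum dominates
  both \<open>\<integral> |u/z|^9\<close>, so that the same cut-offs approximate \<open>u\<close> in the Sobolev space, and
  \<open>\<integral> |u|^9\<close> over the walls of the tubes, whose area is about \<open>h r \<le> h^8\<close>; hence the boundary values of
  the cut-off functions converge in \<open>L^9\<close>. Any width \<open>h^a\<close> with \<open>5 < a < 9\<close> has these properties.\<close>


section \<open>Smooth functions\<close>

text \<open>The tubes get ever thinner relative to their length, so the oscillation bound must not
  hide a dependence on their shape. Morrey's inequality is therefore proved on convex open sets with
  a constant depending only on a diameter bound \<open>D\<close> and an upper bound \<open>M\<close>
  of a smooth probability density supported inside. On a tube \<open>D\<close> is about h and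
  \<open>M\<close> about 1 / (h r^2) = h^-17, so the factor is h^9 h^-17 = h^-8; its inverse is the
  weight in all level sums. For a general width h^a the weight is h^(2a-8). Then a > 5 makes the
  cut-off energy vanish and lets the weight outrun the branching into four, while a < 9 keeps the
  wall area h^(1+a) below the weight. The slant carries an axis from the centre of a dyadic square
  to the centres of its quarters, so the lower ends become dense in the limit square. A second
  obstacle is that the approximants must be continuous on the whole closure. Representatives on
  single tubes extend to the closed tubes; they fit together there because closed tubes touch only
  if the open tubes overlap.\<close>

abbreviation "tcd \<equiv> times_continuously_differentiable"

lemma tcd_SucI:
  assumes "\<And>x. (f has_derivative f' x) (at x)" and "\<And>v. tcd k (\<lambda>x. f' x v)"
  shows "tcd (Suc k) f"
proof -
  have "frechet_derivative f (at x) = f' x" for x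
    using frechet_derivative_at[OF assms(1)[of x]] by simp
  then show ?thesis
    using assms by (auto simp: differentiable_def)
qed

lemma tcd_has_derivative:
  "tcd (Suc k) f \<Longrightarrow> (f has_derivative frechet_derivative f (at x)) (at x)"
  by (simp add: frechet_derivative_works)

lemma tcd_SucD: "tcd (Suc k) f \<Longrightarrow> tcd k f"
proof (induction k arbitrary: f)
  case 0
  then show ?case
    by (auto intro!: continuous_at_imp_continuous_on differentiable_imp_continuous_within)
next
  case (Suc k)
  then show ?case by simp
qed

lemma tcd_const: "tcd k (\<lambda>_. c)"
proof (induction k arbitrary: c)
  case (Suc k)
  show ?case by (rule tcd_SucI[where f' = "\<lambda>_ _. 0"]) (auto intro: Suc)
qed simp

lemma tcd_linear: "bounded_linear f \<Longrightarrow> tcd k f"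
proof (cases k)
  case 0
  then show "bounded_linear f \<Longrightarrow> ?thesis"
    by (auto intro: linear_continuous_on)
next
  case (Suc n)
  show "bounded_linear f \<Longrightarrow> ?thesis" unfolding Suc
    by (rule tcd_SucI[where f' = "\<lambda>_. f"])
      (auto intro: bounded_linear_imp_has_derivative tcd_const)
qed

lemma tcd_add: "tcd k f \<Longrightarrow> tcd k g \<Longrightarrow> tcd k (\<lambda>x. f x + g x)"
proof (induction k arbitrary: f g)
  case 0
  then show ?case by (auto intro: continuous_intros)
next
  case (Suc k)
  show ?case
    by (rule tcd_SucI[OF has_derivative_add[OF tcd_has_derivative[OF Suc.prems(1)]
            tcd_has_derivative[OF Suc.prems(2)]]])
      (use Suc in auto)
qed

lemma tcd_mult: "tcd k f \<Longrightarrow> tcd k g \<Longrightarrow> tcd k (\<lambda>x. f x * g x)"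
proof (induction k arbitrary: f g)
  case 0
  then show ?case by (auto intro: continuous_intros)
next
  case (Suc k)
  show ?case
    by (rule tcd_SucI[OF has_derivative_mult[OF tcd_has_derivative[OF Suc.prems(1)]
            tcd_has_derivative[OF Suc.prems(2)]]])
      (use Suc.IH Suc.prems tcd_SucD[OF Suc.prems(1)] tcd_SucD[OF Suc.prems(2)]
        in \<open>auto intro!: tcd_add\<close>)
qed

lemma tcd_compose_affine:
  assumes L: "bounded_linear L"
  shows "tcd k f \<Longrightarrow> tcd k (\<lambda>x. f (c + L x))"
proof (induction k arbitrary: f)
  case 0
  have "continuous_on UNIV (\<lambda>x. c + L x)"
    using L by (intro continuous_intros linear_continuous_on)
  with 0 show ?case
    by (auto intro: continuous_on_compose2)
next
  case (Suc k)
  have L': "((\<lambda>x. c + L x) has_derivative L) (at x)" for x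
    by (rule derivative_eq_intros refl bounded_linear_imp_has_derivative L | simp)+
  show ?case
    by (rule tcd_SucI[OF has_derivative_compose[OF L' tcd_has_derivative[OF Suc.prems]]])
      (use Suc in auto)
qed

text \<open>A sequence in which each function is the derivative of the preceding one is closed under
  differentiation, so the induction on \<open>k\<close> treats all \<open>n\<close>
  simultaneously.\<close>

lemma tcd_of_derivative_sequence:
  fixes f :: "nat \<Rightarrow> real \<Rightarrow> real"
  assumes "\<And>n x. (f n has_field_derivative f (Suc n) x) (at x)"
  shows "tcd k (f n)"
proof (induction k arbitrary: n)
  case 0
  show ?case
    using assms by (auto intro!: continuous_at_imp_continuous_on DERIV_isCont)
next
  case (Suc k)
  show ?case
    by (rule tcd_SucI[where f' = "\<lambda>x h. f (Suc n) x * h"])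
      (use assms Suc in \<open>auto simp: has_field_derivative_def intro!: tcd_mult tcd_const\<close>)
qed

section \<open>The smooth function exp(-1/x) and its relatives\<close>

definition flat :: "real poly \<Rightarrow> real \<Rightarrow> real" where
  "flat P x = (if 0 < x then poly P (1 / x) * exp (- 1 / x) else 0)"

lemma tendsto_poly_exp_neg: "((\<lambda>s. poly P s * exp (- s)) \<longlongrightarrow> 0) at_top" for P :: "real poly"
proof -
  have "((\<lambda>s. \<Sum>i\<le>degree P. coeff P i * (s ^ i / exp s)) \<longlongrightarrow> (\<Sum>i\<le>degree P. coeff P i * 0)) at_top"
    by (intro tendsto_sum tendsto_mult tendsto_const tendsto_power_div_exp_0)
  then show ?thesis
    by (simp add: poly_altdef sum_distrib_right sum_divide_distrib exp_minus field_simps)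
qed

text \<open>With s = 1/x, the x-derivative of P(s) exp(-s) is s^2 (P(s) - P'(s)) exp(-s), and
  \<open>[:0, 0, 1:]\<close> is s^2. The functions \<open>flat P\<close> are thus closed under
  differentiation. At 0 the right difference quotient is s P(s) exp(-s) with s = 1/h, which tends to
  0.\<close>

lemma flat_has_derivative:
  "(flat P has_field_derivative flat ([:0, 0, 1:] * (P - pderiv P)) x) (at x)"
proof -
  consider "x < 0" | "x = 0" | "0 < x" by linarith
  then show ?thesis
  proof cases
    case 1
    have "(flat P has_field_derivative 0) (at x) \<longleftrightarrow> ((\<lambda>_. 0) has_field_derivative 0) (at x)"
      by (rule DERIV_cong_ev)
        (use 1 in \<open>auto simp: flat_def eventually_nhds intro!: exI[of _ "{..<0}"]\<close>)
    then show ?thesis using 1 by (simp add: flat_def)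
  next
    case 2
    have "((\<lambda>h. flat P h / h) \<longlongrightarrow> 0) (at_right 0)"
    proof -
      have "((\<lambda>h::real. poly ([:0, 1:] * P) (inverse h) * exp (- inverse h)) \<longlongrightarrow> 0) (at_right 0)"
        by (rule filterlim_compose[OF tendsto_poly_exp_neg filterlim_inverse_at_top_right])
      moreover have "eventually (\<lambda>h::real. poly ([:0, 1:] * P) (inverse h) * exp (- inverse h)
          = flat P h / h) (at_right 0)"
        by (auto simp: flat_def eventually_at_right_field field_simps intro!: exI[of _ 1])
      ultimately show ?thesis by (rule Lim_transform_eventually)
    qed
    moreover have "((\<lambda>h. flat P h / h) \<longlongrightarrow> 0) (at_left 0)"
      by (rule tendsto_eventually)
        (auto simp: flat_def eventually_at_left_field intro!: exI[of _ "-1"])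
    ultimately have "((\<lambda>h. flat P h / h) \<longlongrightarrow> 0) (at 0)"
      by (simp add: filterlim_split_at)
    then show ?thesis using 2 by (simp add: DERIV_def flat_def)
  next
    case 3
    have "((\<lambda>x. poly P (1 / x) * exp (- 1 / x)) has_field_derivative
        poly ([:0, 0, 1:] * (P - pderiv P)) (1 / x) * exp (- 1 / x)) (at x)"
      using 3 by (auto intro!: derivative_eq_intros DERIV_chain'[OF _ poly_DERIV] simp: field_simps power2_eq_square)
    moreover have "(flat P has_field_derivative D) (at x) \<longleftrightarrow>
        ((\<lambda>x. poly P (1 / x) * exp (- 1 / x)) has_field_derivative D) (at x)" for D
      by (rule DERIV_cong_ev)
        (use 3 in \<open>auto simp: flat_def eventually_nhds intro!: exI[of _ "{0<..}"]\<close>)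
    ultimately show ?thesis using 3 by (simp add: flat_def)
  qed
qed

lemma tcd_flat: "tcd k (flat P)"
proof -
  define Q where "Q n = ((\<lambda>P. [:0, 0, 1:] * (P - pderiv P)) ^^ n) P" for n
  have "tcd k (flat (Q 0))"
    by (rule tcd_of_derivative_sequence[where f = "\<lambda>n. flat (Q n)"])
      (unfold Q_def funpow.simps o_apply, rule flat_has_derivative)
  then show ?thesis by (simp add: Q_def)
qed

text \<open>Flat to the left of 0 and tending to 1 at infinity, this one function serves for the
  cut-offs and, in products of two reflected copies, for bumps.\<close>

definition rise :: "real \<Rightarrow> real" where "rise = flat 1"
definition rise' :: "real \<Rightarrow> real" where "rise' = flat [:0, 0, 1:]"

lemma rise_eq: "rise x = (if 0 < x then exp (- 1 / x) else 0)"
  by (simp add: rise_def flat_def)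

lemma rise'_eq: "rise' x = (if 0 < x then exp (- 1 / x) / x\<^sup>2 else 0)"
  by (simp add: rise'_def flat_def power2_eq_square)

lemma tcd_rise: "tcd k rise"
  unfolding rise_def by (rule tcd_flat)

lemma tcd_rise': "tcd k rise'"
  unfolding rise'_def by (rule tcd_flat)

lemma rise_has_derivative: "(rise has_field_derivative rise' x) (at x)"
  using flat_has_derivative[of 1 x] by (simp add: rise_def rise'_def)

lemma rise_bounds: "0 \<le> rise x" "rise x \<le> 1" "rise x > 0 \<longleftrightarrow> x > 0" "x \<le> 0 \<Longrightarrow> rise x = 0"
  by (auto simp: rise_eq)

lemma rise'_nonneg: "0 \<le> rise' x"
  by (simp add: rise'_eq)

lemma rise_mono: "x \<le> y \<Longrightarrow> rise x \<le> rise y"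
  by (auto simp: rise_eq frac_le)

text \<open>For x = n z - 1 the left side is z times the z-derivative of rise (n z - 1). The
  cut-offs therefore have slope at most 3/z, uniformly in n, which the integrability of |u| / z can
  absorb.\<close>

lemma rise'_bound: "(x + 1) * rise' x \<le> 3"
proof (cases "0 < x")
  case True
  \<comment> \<open>In s = 1/x the product equals (s + s^2) exp(-s), and the quadratic Taylor
    polynomial bounds s + s^2 by 3 exp s.\<close>
  define s where "s = 1 / x"
  have s: "0 < s" using True by (simp add: s_def)
  have "1 + s + s\<^sup>2 / 2 \<le> exp s"
    using exp_lower_Taylor_quadratic s by simp
  then have "s + s\<^sup>2 \<le> 3 * exp s"
    using s zero_le_power2[of s] by linarith
  then have "(s + s\<^sup>2) * exp (- s) \<le> 3"
    by (simp add: exp_minus divide_simps)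
  then show ?thesis
    using True by (simp add: rise'_eq s_def field_simps power2_eq_square)
qed (auto simp: rise'_eq)

lemma tendsto_rise: "(rise \<longlongrightarrow> 1) at_top"
proof -
  have "((\<lambda>x::real. exp (- (1 / x))) \<longlongrightarrow> exp (- 0)) at_top"
    by (intro tendsto_intros tendsto_divide_0[OF tendsto_const] filterlim_at_top_imp_at_infinity filterlim_ident)
  moreover have "eventually (\<lambda>x::real. exp (- (1 / x)) = rise x) at_top"
    by (auto simp: rise_eq intro: eventually_at_top_linorderI[of 1])
  ultimately show ?thesis by (auto intro: Lim_transform_eventually)
qed

text \<open>The same scale-free product as in \<open>rise'_bound\<close>; its limit makes the
  gradients of the cut-offs vanish pointwise at positive height.\<close>

lemma tendsto_rise': "((\<lambda>x. (x + 1) * rise' x) \<longlongrightarrow> 0) at_top"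
proof (rule tendsto_sandwich[OF _ _ tendsto_const])
  have "((\<lambda>x::real. 2 * (1 / x)) \<longlongrightarrow> 2 * 0) at_top"
    by (intro tendsto_intros tendsto_divide_0[OF tendsto_const] filterlim_at_top_imp_at_infinity filterlim_ident)
  then show "((\<lambda>x::real. 2 * (1 / x)) \<longlongrightarrow> 0) at_top" by simp
  show "\<forall>\<^sub>F x in at_top. 0 \<le> (x + 1) * rise' x"
    by (rule eventually_at_top_linorderI[of 1]) (auto simp: rise'_eq)
  show "\<forall>\<^sub>F x in at_top. (x + 1) * rise' x \<le> 2 * (1 / x)"
  proof (rule eventually_at_top_linorderI[of 1])
    fix x :: real assume x: "1 \<le> x"
    have "(x + 1) * exp (- 1 / x) \<le> (2 * x) * 1"
      using x by (intro mult_mono) auto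
    then have "(x + 1) * exp (- 1 / x) / x\<^sup>2 \<le> 2 * x / x\<^sup>2"
      using x by (intro divide_right_mono) auto
    then show "(x + 1) * rise' x \<le> 2 * (1 / x)"
      using x by (simp add: rise'_eq power2_eq_square)
  qed
qed

section \<open>Calculus of weak gradients\<close>

text \<open>Dominated convergence for difference quotients along an arbitrary null sequence; the
  mean value inequality turns the bound on \<open>f'\<close> into the bound \<open>g\<close> on the
  quotients.\<close>

lemma has_derivative_lebesgue_integral:
  fixes f :: "real \<Rightarrow> 'a \<Rightarrow> real"
  assumes t: "a < t" "t < b"
    and int: "\<And>s. a < s \<Longrightarrow> s < b \<Longrightarrow> integrable M (f s)"
    and der: "\<And>x s. a < s \<Longrightarrow> s < b \<Longrightarrow> ((\<lambda>s. f s x) has_field_derivative f' s x) (at s)"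
    and bound: "\<And>x s. a < s \<Longrightarrow> s < b \<Longrightarrow> \<bar>f' s x\<bar> \<le> g x"
    and g: "integrable M g"
    and meas: "f' t \<in> borel_measurable M"
  shows "((\<lambda>s. \<integral>x. f s x \<partial>M) has_field_derivative (\<integral>x. f' t x \<partial>M)) (at t)"
  unfolding DERIV_def tendsto_at_iff_sequentially comp_def
proof (intro allI impI)
  fix X :: "nat \<Rightarrow> real" assume X: "\<forall>i. X i \<in> UNIV - {0}" and lim: "X \<longlonglongrightarrow> 0"
  define e where "e = min (t - a) (b - t)"
  have e: "0 < e" using t by (simp add: e_def)
  \<comment> \<open>The null sequence stays within the interval only from some index on; the shift
    by \<open>N\<close> is undone at the end by \<open>LIMSEQ_offset\<close>.\<close>
  obtain N where N: "\<And>n. n \<ge> N \<Longrightarrow> \<bar>X n\<bar> < e"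
    using lim e unfolding LIMSEQ_iff by (metis diff_zero real_norm_def)
  have dom: "a < t + X (n + N) \<and> t + X (n + N) < b" for n
    using N[of "n + N"] by (auto simp: e_def abs_less_iff)
  have nz: "X n \<noteq> 0" for n using X by simp
  define q where "q n x = (f (t + X (n + N)) x - f t x) / X (n + N)" for n x
  have qint: "integrable M (q n)" for n
    unfolding q_def using int dom[of n] t by (intro integrable_divide integrable_diff) auto
  have "(\<lambda>n. \<integral>x. q n x \<partial>M) \<longlonglongrightarrow> (\<integral>x. f' t x \<partial>M)"
  proof (rule integral_dominated_convergence[where w = g])
    show "q n \<in> borel_measurable M" for n using qint by auto
    show "AE x in M. (\<lambda>n. q n x) \<longlonglongrightarrow> f' t x"
    proof (intro always_eventually allI)
      fix x
      have "(\<lambda>h. (f (t + h) x - f t x) / h) \<midarrow>0\<rightarrow> f' t x"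
        using der[OF t] by (simp add: DERIV_def)
      moreover have "(\<lambda>n. X (n + N)) \<longlonglongrightarrow> 0" using lim by (rule LIMSEQ_ignore_initial_segment)
      ultimately have "((\<lambda>h. (f (t + h) x - f t x) / h) \<circ> (\<lambda>n. X (n + N))) \<longlonglongrightarrow> f' t x"
        unfolding tendsto_at_iff_sequentially using nz by auto
      then show "(\<lambda>n. q n x) \<longlonglongrightarrow> f' t x" by (simp add: q_def comp_def)
    qed
    show "AE x in M. norm (q n x) \<le> g x" for n
    proof (intro always_eventually allI)
      fix x
      have "norm (f (t + X (n + N)) x - f t x) \<le> g x * norm (t + X (n + N) - t)"
      proof (rule field_differentiable_bound[where S = "{a<..<b}" and f' = "\<lambda>s. f' s x"])
        show "((\<lambda>s. f s x) has_field_derivative f' s x) (at s within {a<..<b})" if "s \<in> {a<..<b}" for s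
          using der that by (auto intro: has_field_derivative_at_within)
      qed (use bound dom t in auto)
      then show "norm (q n x) \<le> g x"
        using nz[of "n + N"] by (simp add: q_def abs_divide field_simps)
    qed
  qed (use meas g in auto)
  moreover have "(\<integral>x. q n x \<partial>M) = ((\<integral>x. f (t + X (n + N)) x \<partial>M) - (\<integral>x. f t x \<partial>M)) / X (n + N)" for n
    unfolding q_def using int[of "t + X (n + N)"] int[OF t] dom[of n] by simp
  ultimately have "(\<lambda>n. ((\<integral>x. f (t + X (n + N)) x \<partial>M) - (\<integral>x. f t x \<partial>M)) / X (n + N)) \<longlonglongrightarrow> (\<integral>x. f' t x \<partial>M)"
    by simp
  then show "(\<lambda>n. ((\<integral>x. f (t + X n) x \<partial>M) - (\<integral>x. f t x \<partial>M)) / X n) \<longlonglongrightarrow> (\<integral>x. f' t x \<partial>M)"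
    by (rule LIMSEQ_offset)
qed

lemma lborel_integral_affine:
  fixes f :: "'a::euclidean_space \<Rightarrow> real"
  assumes c: "c \<noteq> 0" and f: "f \<in> borel_measurable borel"
  shows "(\<integral>x. f x \<partial>lborel) = \<bar>c\<bar> ^ DIM('a) * (\<integral>x. f (a + c *\<^sub>R x) \<partial>lborel)"
  by (subst lborel_affine[OF c, of a])
    (use f in \<open>simp add: integral_density integral_distr\<close>)

section \<open>Test functions and their integrals\<close>

lemma continuous_zero_off_compact_bounded:
  fixes g :: "'a::euclidean_space \<Rightarrow> 'b::real_normed_vector"
  assumes "continuous_on UNIV g" "compact K" "\<And>x. x \<notin> K \<Longrightarrow> g x = 0"
  obtains B where "0 < B" "\<And>x. norm (g x) \<le> B"
proof -
  have "bounded (g ` K)"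
    using assms by (intro compact_imp_bounded compact_continuous_image continuous_on_subset[OF assms(1)]) auto
  then obtain B where "0 < B" "\<And>x. x \<in> K \<Longrightarrow> norm (g x) \<le> B"
    by (auto simp: bounded_pos)
  then have "norm (g x) \<le> B" for x
    using assms(3)[of x] by (cases "x \<in> K") auto
  with \<open>0 < B\<close> show ?thesis using that by blast
qed

lemma integrable_indicator_compact:
  fixes K :: "'a::euclidean_space set" and B :: real
  assumes "compact K"
  shows "integrable lborel (\<lambda>x. indicator K x *\<^sub>R B)"
  using assms
  by (intro integrable_scaleR_left integrable_real_indicator)
    (use emeasure_compact_finite[OF assms] in \<open>auto simp: borel_compact\<close>)

lemma continuous_zero_off_compact_integrable:
  fixes g :: "'a::euclidean_space \<Rightarrow> real"
  assumes "continuous_on UNIV g" "compact K" "\<And>x. x \<notin> K \<Longrightarrow> g x = 0"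
  shows "integrable lborel g"
proof -
  obtain B where B: "0 < B" "\<And>x. norm (g x) \<le> B"
    using continuous_zero_off_compact_bounded[OF assms] by metis
  have "integrable lborel (\<lambda>x. indicator K x *\<^sub>R B)"
    using assms(2) by (rule integrable_indicator_compact)
  then show ?thesis
  proof (rule Bochner_Integration.integrable_bound)
    show "g \<in> borel_measurable lborel"
      using assms(1) by (simp add: borel_measurable_continuous_onI)
    show "AE x in lborel. norm (g x) \<le> norm (indicator K x *\<^sub>R B)"
      using B assms(3) by (auto simp: indicator_def)
  qed
qed

lemma tcd_continuous: "tcd k f \<Longrightarrow> continuous_on S f"
proof (induction k)
  case 0
  then show ?case by (auto intro: continuous_on_subset)
qed (use tcd_SucD in blast)

lemma test_functionI:
  assumes "\<And>k. tcd k \<psi>" "compact K" "K \<subseteq> \<Omega>" "\<And>x. x \<notin> K \<Longrightarrow> \<psi> x = 0"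
  shows "test_function \<Omega> \<psi>"
proof -
  have "closure {x. \<psi> x \<noteq> 0} \<subseteq> K"
    using assms by (intro closure_minimal) (auto simp: compact_imp_closed)
  then show ?thesis
    using assms compact_closure unfolding test_function_def
    by (meson bounded_subset closure_subset compact_imp_bounded compact_eq_bounded_closed closed_closure subset_trans)
qed

lemma test_function_tcd: "test_function \<Omega> \<psi> \<Longrightarrow> tcd k \<psi>"
  by (simp add: test_function_def)

lemma test_function_has_derivative:
  "test_function \<Omega> \<psi> \<Longrightarrow> (\<psi> has_derivative frechet_derivative \<psi> (at x)) (at x)"
  using tcd_has_derivative test_function_tcd by blast

lemma test_function_tcd_derivative:
  "test_function \<Omega> \<psi> \<Longrightarrow> tcd k (\<lambda>x. frechet_derivative \<psi> (at x) v)"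
  using test_function_tcd[of \<Omega> \<psi> "Suc k"] by simp

lemma test_function_support:
  assumes "test_function \<Omega> \<psi>"
  obtains K where "compact K" "K \<subseteq> \<Omega>" "\<And>x. x \<notin> K \<Longrightarrow> \<psi> x = 0"
    "\<And>x v. x \<notin> K \<Longrightarrow> frechet_derivative \<psi> (at x) v = 0"
proof
  let ?K = "closure {x. \<psi> x \<noteq> 0}"
  show "compact ?K" "?K \<subseteq> \<Omega>" using assms by (auto simp: test_function_def)
  show "\<psi> x = 0" if "x \<notin> ?K" for x
    using that closure_subset[of "{x. \<psi> x \<noteq> 0}"] by blast
  fix x v assume x: "x \<notin> ?K"
  have "(\<psi> has_derivative (\<lambda>_. 0)) (at x)"
  proof (rule has_derivative_transform_within_open[where s = "- ?K" and f = "\<lambda>_. 0"])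
    show "0 = \<psi> y" if "y \<in> - ?K" for y
      using that closure_subset[of "{x. \<psi> x \<noteq> 0}"] by auto
  qed (use x in auto)
  then show "frechet_derivative \<psi> (at x) v = 0"
    by (metis frechet_derivative_at)
qed

lemma test_function_mono: "test_function Q \<psi> \<Longrightarrow> Q \<subseteq> \<Omega> \<Longrightarrow> test_function \<Omega> \<psi>"
  by (auto simp: test_function_def)

lemma test_function_mult:
  assumes "test_function \<Omega> \<psi>" "\<And>k. tcd k f"
  shows "test_function \<Omega> (\<lambda>x. f x * \<psi> x)"
proof -
  obtain K where K: "compact K" "K \<subseteq> \<Omega>" "\<And>x. x \<notin> K \<Longrightarrow> \<psi> x = 0"
    using test_function_support[OF assms(1)] by metis
  then show ?thesis
    using assms by (intro test_functionI[OF _ K(1,2)] tcd_mult) (auto simp: test_function_tcd)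
qed

lemma integrable_times_continuous:
  fixes u :: "'a::euclidean_space \<Rightarrow> 'b::euclidean_space"
  assumes "locally_integrable \<Omega> u" and g: "continuous_on UNIV g" and K: "compact K" "K \<subseteq> \<Omega>"
    and gK: "\<And>x. x \<notin> K \<Longrightarrow> g x = 0"
  shows "integrable lebesgue (\<lambda>x. g x *\<^sub>R u x)"
proof -
  obtain B where B: "0 < B" "\<And>x. norm (g x) \<le> B"
    using continuous_zero_off_compact_bounded[OF g K(1) gK] by metis
  have uK: "integrable lebesgue (\<lambda>x. indicator K x *\<^sub>R u x)"
    using assms by (auto simp: locally_integrable_def set_integrable_def)
  then have "integrable lebesgue (\<lambda>x. B *\<^sub>R (indicator K x *\<^sub>R u x))"
    by (rule integrable_scaleR_right)
  moreover have "g \<in> borel_measurable lebesgue"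
    using g by (intro measurable_completion) (simp add: borel_measurable_continuous_onI)
  ultimately have "integrable lebesgue (\<lambda>x. g x *\<^sub>R (indicator K x *\<^sub>R u x))" (is ?I)
  proof (rule Bochner_Integration.integrable_bound[OF _ borel_measurable_scaleR])
    show "(\<lambda>x. indicator K x *\<^sub>R u x) \<in> borel_measurable lebesgue" using uK by auto
    show "AE x in lebesgue. norm (g x *\<^sub>R indicator K x *\<^sub>R u x) \<le> norm (B *\<^sub>R indicator K x *\<^sub>R u x)"
      using B by (intro always_eventually allI) (auto intro!: mult_right_mono simp: indicator_def)
  qed
  moreover have "(\<lambda>x. g x *\<^sub>R (indicator K x *\<^sub>R u x)) = (\<lambda>x. g x *\<^sub>R u x)"
    using gK by (auto simp: indicator_def fun_eq_iff)
  ultimately show ?thesis by metis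
qed

lemma set_lebesgue_integral_eq_of_zero_off:
  fixes f :: "'a \<Rightarrow> 'b::{banach, second_countable_topology}"
  assumes "\<And>x. x \<notin> A \<Longrightarrow> f x = 0"
  shows "(LINT x:A|M. f x) = (\<integral>x. f x \<partial>M)"
  unfolding set_lebesgue_integral_def
  by (rule Bochner_Integration.integral_cong) (use assms in \<open>auto simp: indicator_def\<close>)

lemma weak_gradientD:
  assumes "weak_gradient \<Omega> u G" "test_function \<Omega> \<psi>" "b \<in> Basis"
  shows "(\<integral>x. u x * frechet_derivative \<psi> (at x) b \<partial>lebesgue) = - (\<integral>x. (G x \<bullet> b) * \<psi> x \<partial>lebesgue)"
proof -
  obtain K where "K \<subseteq> \<Omega>" "\<And>x. x \<notin> K \<Longrightarrow> \<psi> x = 0"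
    "\<And>x v. x \<notin> K \<Longrightarrow> frechet_derivative \<psi> (at x) v = 0"
    using test_function_support[OF assms(2)] by metis
  then have "(LINT x:\<Omega>|lebesgue. u x * frechet_derivative \<psi> (at x) b) = (\<integral>x. u x * frechet_derivative \<psi> (at x) b \<partial>lebesgue)"
    "(LINT x:\<Omega>|lebesgue. (G x \<bullet> b) * \<psi> x) = (\<integral>x. (G x \<bullet> b) * \<psi> x \<partial>lebesgue)"
    by (intro set_lebesgue_integral_eq_of_zero_off; force)+
  then show ?thesis using assms by (simp add: weak_gradient_def)
qed

lemma weak_gradientI:
  assumes "locally_integrable \<Omega> u" "locally_integrable \<Omega> G"
    and "\<And>\<psi> b. test_function \<Omega> \<psi> \<Longrightarrow> b \<in> Basis \<Longrightarrow>
      (\<integral>x. u x * frechet_derivative \<psi> (at x) b \<partial>lebesgue) = - (\<integral>x. (G x \<bullet> b) * \<psi> x \<partial>lebesgue)"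
  shows "weak_gradient \<Omega> u G"
  unfolding weak_gradient_def
proof (intro conjI allI impI ballI)
  fix \<psi> and b :: 'a assume \<psi>: "test_function \<Omega> \<psi>" and b: "b \<in> Basis"
  obtain K where "K \<subseteq> \<Omega>" "\<And>x. x \<notin> K \<Longrightarrow> \<psi> x = 0"
    "\<And>x v. x \<notin> K \<Longrightarrow> frechet_derivative \<psi> (at x) v = 0"
    using test_function_support[OF \<psi>] by metis
  then have "(LINT x:\<Omega>|lebesgue. u x * frechet_derivative \<psi> (at x) b) = (\<integral>x. u x * frechet_derivative \<psi> (at x) b \<partial>lebesgue)"
    "(LINT x:\<Omega>|lebesgue. (G x \<bullet> b) * \<psi> x) = (\<integral>x. (G x \<bullet> b) * \<psi> x \<partial>lebesgue)"
    by (intro set_lebesgue_integral_eq_of_zero_off; force)+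
  then show "(LINT x:\<Omega>|lebesgue. u x * frechet_derivative \<psi> (at x) b) = - (LINT x:\<Omega>|lebesgue. (G x \<bullet> b) * \<psi> x)"
    using assms(3)[OF \<psi> b] by simp
qed (use assms in auto)

text \<open>Translation invariance: the integral of \<psi> (x + s b) does not depend on s, and its
  derivative at s = 0, taken under the integral, is the integral of the directional
  derivative.\<close>

lemma integral_derivative_test_function:
  assumes \<psi>: "test_function \<Omega> \<psi>"
  shows "(\<integral>x. frechet_derivative \<psi> (at x) b \<partial>lebesgue) = 0"
proof -
  obtain K where K: "compact K" "\<And>x. x \<notin> K \<Longrightarrow> \<psi> x = 0"
    "\<And>x v. x \<notin> K \<Longrightarrow> frechet_derivative \<psi> (at x) v = 0"
    using test_function_support[OF \<psi>] by metis
  let ?D = "\<lambda>x. frechet_derivative \<psi> (at x) b"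
  have cD: "continuous_on UNIV ?D" and c\<psi>: "continuous_on UNIV \<psi>"
    using tcd_continuous test_function_tcd_derivative[OF \<psi>] test_function_tcd[OF \<psi>] by blast+
  obtain B where B: "0 < B" "\<And>x. norm (?D x) \<le> B"
    using continuous_zero_off_compact_bounded[OF cD K(1,3)] by metis
  \<comment> \<open>The support swept back along \<open>b\<close>: it carries the integrands for all
    s between -1 and 1 and so gives one dominating function.\<close>
  define L where "L = (\<lambda>(x, s). x - s *\<^sub>R b) ` (K \<times> {-1..1})"
  have L: "compact L"
    unfolding L_def case_prod_beta
    by (intro compact_continuous_image compact_Times K continuous_intros) auto
  have shift: "x \<in> L" if "x + s *\<^sub>R b \<in> K" "-1 < s" "s < 1" for x s
    unfolding L_def using that by (intro image_eqI[of _ _ "(x + s *\<^sub>R b, s)"]) auto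
  have const: "(\<integral>x. \<psi> (x + s *\<^sub>R b) \<partial>lborel) = (\<integral>x. \<psi> x \<partial>lborel)" for s
    using lborel_integral_affine[of 1 \<psi> "s *\<^sub>R b"] c\<psi>
    by (simp add: borel_measurable_continuous_onI add.commute)
  have "((\<lambda>s. \<integral>x. \<psi> (x + s *\<^sub>R b) \<partial>lborel) has_field_derivative (\<integral>x. ?D (x + 0 *\<^sub>R b) \<partial>lborel)) (at 0)"
  proof (rule has_derivative_lebesgue_integral[where a = "-1" and b = 1 and g = "\<lambda>x. indicator L x *\<^sub>R B"])
    show "integrable lborel (\<lambda>x. indicator L x *\<^sub>R B)"
      using L by (rule integrable_indicator_compact)
    show "integrable lborel (\<lambda>x. \<psi> (x + s *\<^sub>R b))" if "-1 < s" "s < 1" for s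
      by (rule continuous_zero_off_compact_integrable[OF _ L])
        (use c\<psi> K(2) shift that in \<open>auto intro!: continuous_on_compose2[OF c\<psi>] continuous_intros\<close>)
    show "((\<lambda>s. \<psi> (x + s *\<^sub>R b)) has_field_derivative ?D (x + s *\<^sub>R b)) (at s)" for x s
    proof -
      have d: "((\<lambda>s. x + s *\<^sub>R b) has_derivative (\<lambda>h. h *\<^sub>R b)) (at s)"
        by (rule derivative_eq_intros refl | simp)+
      have "((\<lambda>s. \<psi> (x + s *\<^sub>R b)) has_derivative (\<lambda>h. frechet_derivative \<psi> (at (x + s *\<^sub>R b)) (h *\<^sub>R b))) (at s)"
        by (rule has_derivative_compose[OF d test_function_has_derivative[OF \<psi>]])
      moreover have "frechet_derivative \<psi> (at (x + s *\<^sub>R b)) (h *\<^sub>R b) = ?D (x + s *\<^sub>R b) * h" for h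
        using linear_cmul[OF has_derivative_linear[OF test_function_has_derivative[OF \<psi>]]] by simp
      ultimately show ?thesis by (simp add: has_field_derivative_def)
    qed
    show "\<bar>?D (x + s *\<^sub>R b)\<bar> \<le> indicator L x *\<^sub>R B" if "-1 < s" "s < 1" for x s
      using B(2)[of "x + s *\<^sub>R b"] K(3)[of "x + s *\<^sub>R b" b] shift[OF _ that, of x]
      by (cases "x \<in> L") (auto simp: indicator_def)
  qed (use cD in \<open>auto simp: borel_measurable_continuous_onI\<close>)
  then have "((\<lambda>s::real. \<integral>x. \<psi> x \<partial>lborel) has_field_derivative (\<integral>x. ?D x \<partial>lborel)) (at 0)"
    by (simp add: const)
  then have "(\<integral>x. ?D x \<partial>lborel) = 0"
    using DERIV_unique DERIV_const by blast
  moreover have "(\<integral>x. ?D x \<partial>lebesgue) = (\<integral>x. ?D x \<partial>lborel)"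
    using cD by (intro integral_completion) (simp add: borel_measurable_continuous_onI)
  ultimately show ?thesis by simp
qed

lemma locally_integrable_continuous:
  fixes f :: "'a::euclidean_space \<Rightarrow> 'b::euclidean_space"
  assumes "continuous_on UNIV f"
  shows "locally_integrable \<Omega> f"
  unfolding locally_integrable_def
proof (intro allI impI)
  fix K assume "compact K \<and> K \<subseteq> \<Omega>"
  then have "set_integrable lborel K f"
    using assms by (auto intro!: borel_integrable_compact continuous_on_subset[OF assms] simp: set_integrable_def)
  then show "set_integrable lebesgue K f"
    unfolding set_integrable_def by (rule integrable_completion[THEN iffD2, rotated]) (use \<open>set_integrable lborel K f\<close> in \<open>auto simp: set_integrable_def\<close>)
qed

lemma weak_gradient_const: "weak_gradient \<Omega> (\<lambda>_. 1) (\<lambda>_. 0)"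
  by (intro weak_gradientI locally_integrable_continuous)
    (auto simp: integral_derivative_test_function)

text \<open>Leibniz rule: \<theta> times a test function is again a test function, and expanding its
  derivative leaves the gradient of \<theta> as a factor of \<open>u\<close>.\<close>

lemma weak_gradient_mult:
  fixes u :: "'a::euclidean_space \<Rightarrow> real"
  assumes w: "weak_gradient \<Omega> u G" and \<theta>: "\<And>k. tcd k \<theta>"
    and g: "continuous_on UNIV g" and D: "\<And>x. (\<theta> has_derivative (\<lambda>h. g x \<bullet> h)) (at x)"
  shows "weak_gradient \<Omega> (\<lambda>x. \<theta> x * u x) (\<lambda>x. \<theta> x *\<^sub>R G x + u x *\<^sub>R g x)"
proof (rule weak_gradientI)
  have c\<theta>: "continuous_on UNIV \<theta>" using tcd_continuous \<theta> by blast
  have li: "locally_integrable \<Omega> u" "locally_integrable \<Omega> G"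
    using w by (auto simp: weak_gradient_def)
  have bil: "bilinear (\<lambda>(a::real) (b::'b::euclidean_space). a *\<^sub>R b)"
    by (auto simp: bilinear_def linear_iff algebra_simps)
  have bm: "set_integrable lebesgue K (\<lambda>x. f x *\<^sub>R v x)"
    if K: "compact K" and f: "continuous_on UNIV f" and v: "set_integrable lebesgue K v"
    for K and f :: "'a \<Rightarrow> real" and v :: "'a \<Rightarrow> 'b::euclidean_space"
    by (rule absolutely_integrable_bounded_measurable_product[OF bil _ _ _ v])
      (use K f in \<open>auto intro!: continuous_imp_measurable_on_sets_lebesgue compact_imp_bounded
        compact_continuous_image intro: continuous_on_subset lmeasurable_compact fmeasurableD\<close>)
  have bm2: "set_integrable lebesgue K (\<lambda>x. u x *\<^sub>R g x)"
    if K: "compact K" and v: "set_integrable lebesgue K u" for K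
  proof -
    have *: "bilinear (\<lambda>(a::'a) (b::real). b *\<^sub>R a)"
      by (auto simp: bilinear_def linear_iff algebra_simps)
    show ?thesis
      by (rule absolutely_integrable_bounded_measurable_product[OF * _ _ _ v])
        (use K g in \<open>auto intro!: continuous_imp_measurable_on_sets_lebesgue compact_imp_bounded
          compact_continuous_image intro: continuous_on_subset lmeasurable_compact fmeasurableD\<close>)
  qed
  show "locally_integrable \<Omega> (\<lambda>x. \<theta> x * u x)"
    using li bm[OF _ c\<theta>, of _ u] by (simp add: locally_integrable_def)
  show "locally_integrable \<Omega> (\<lambda>x. \<theta> x *\<^sub>R G x + u x *\<^sub>R g x)"
    using li bm[OF _ c\<theta>, of _ G] bm2 by (auto simp: locally_integrable_def intro!: set_integral_add)
  fix \<psi> and b :: 'a assume \<psi>: "test_function \<Omega> \<psi>" and b: "b \<in> Basis"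
  obtain K where K: "compact K" "K \<subseteq> \<Omega>" "\<And>x. x \<notin> K \<Longrightarrow> \<psi> x = 0"
    "\<And>x v. x \<notin> K \<Longrightarrow> frechet_derivative \<psi> (at x) v = 0"
    using test_function_support[OF \<psi>] by metis
  let ?D = "\<lambda>x. frechet_derivative \<psi> (at x) b"
  have cD: "continuous_on UNIV ?D" and c\<psi>: "continuous_on UNIV \<psi>"
    using tcd_continuous test_function_tcd_derivative[OF \<psi>] test_function_tcd[OF \<psi>] by blast+
  have "frechet_derivative (\<lambda>x. \<theta> x * \<psi> x) (at x) b = \<theta> x * ?D x + (g x \<bullet> b) * \<psi> x" for x
    using frechet_derivative_at[OF has_derivative_mult[OF D test_function_has_derivative[OF \<psi>]], symmetric]
    by simp
  then have "(\<integral>x. (\<theta> x * ?D x) *\<^sub>R u x + ((g x \<bullet> b) * \<psi> x) *\<^sub>R u x \<partial>lebesgue) = - (\<integral>x. (G x \<bullet> b) * (\<theta> x * \<psi> x) \<partial>lebesgue)"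
    using weak_gradientD[OF w test_function_mult[OF \<psi> \<theta>] b] by (simp add: algebra_simps)
  moreover have I1: "integrable lebesgue (\<lambda>x. (\<theta> x * ?D x) *\<^sub>R u x)"
    by (rule integrable_times_continuous[OF li(1) _ K(1,2)])
      (use K(4) c\<theta> cD in \<open>auto intro!: continuous_intros\<close>)
  moreover have I2: "integrable lebesgue (\<lambda>x. ((g x \<bullet> b) * \<psi> x) *\<^sub>R u x)"
    by (rule integrable_times_continuous[OF li(1) _ K(1,2)])
      (use K(3) g c\<psi> in \<open>auto intro!: continuous_intros\<close>)
  moreover have I3: "integrable lebesgue (\<lambda>x. (G x \<bullet> b) * (\<theta> x * \<psi> x))"
  proof -
    have "integrable lebesgue (\<lambda>x. (\<theta> x * \<psi> x) *\<^sub>R G x)"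
      by (rule integrable_times_continuous[OF li(2) _ K(1,2)])
        (use K(3) c\<theta> c\<psi> in \<open>auto intro!: continuous_intros\<close>)
    then have "integrable lebesgue (\<lambda>x. ((\<theta> x * \<psi> x) *\<^sub>R G x) \<bullet> b)"
      by (rule integrable_inner_left)
    then show ?thesis by (simp add: mult.commute)
  qed
  moreover have "(\<integral>x. ((\<theta> x *\<^sub>R G x + u x *\<^sub>R g x) \<bullet> b) * \<psi> x \<partial>lebesgue)
      = (\<integral>x. (G x \<bullet> b) * (\<theta> x * \<psi> x) + ((g x \<bullet> b) * \<psi> x) *\<^sub>R u x \<partial>lebesgue)"
    by (rule Bochner_Integration.integral_cong) (auto simp: inner_simps algebra_simps)
  ultimately show "(\<integral>x. (\<theta> x * u x) * ?D x \<partial>lebesgue) = - (\<integral>x. ((\<theta> x *\<^sub>R G x + u x *\<^sub>R g x) \<bullet> b) * \<psi> x \<partial>lebesgue)"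
    by (simp add: mult.assoc mult.commute mult.left_commute)
qed

text \<open>Lebesgue measure is complete, so equality almost everywhere carries measurability over
  as well. The lemma allows a Sobolev function to be exchanged for its continuous
  representative.\<close>

lemma weak_gradient_cong_AE:
  assumes w: "weak_gradient \<Omega> u G" and \<Omega>: "\<Omega> \<in> sets lebesgue"
    and ae: "AE x in lebesgue. x \<in> \<Omega> \<longrightarrow> u x = v x"
  shows "weak_gradient \<Omega> v G"
proof (rule weak_gradientI)
  show "locally_integrable \<Omega> v"
    unfolding locally_integrable_def
  proof (intro allI impI)
    fix K assume K: "compact K \<and> K \<subseteq> \<Omega>"
    then have i: "integrable lebesgue (\<lambda>x. indicator K x *\<^sub>R u x)"
      using w by (auto simp: weak_gradient_def locally_integrable_def set_integrable_def)
    have e: "AE x in lebesgue. indicator K x *\<^sub>R u x = indicator K x *\<^sub>R v x"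
      using ae K by (auto simp: indicator_def)
    show "set_integrable lebesgue K v"
      unfolding set_integrable_def
      by (rule integrable_cong_AE_imp[OF i])
        (use e borel_measurable_AE[OF _ e] i in auto)
  qed
  show "locally_integrable \<Omega> G" using w by (simp add: weak_gradient_def)
  fix \<psi> and b :: 'a assume \<psi>: "test_function \<Omega> \<psi>" and b: "b \<in> Basis"
  obtain K where K: "compact K" "K \<subseteq> \<Omega>" "\<And>x v. x \<notin> K \<Longrightarrow> frechet_derivative \<psi> (at x) v = 0"
    using test_function_support[OF \<psi>] by metis
  let ?D = "\<lambda>x. frechet_derivative \<psi> (at x) b"
  have cD: "continuous_on UNIV ?D"
    using tcd_continuous test_function_tcd_derivative[OF \<psi>] by blast
  have i: "integrable lebesgue (\<lambda>x. ?D x *\<^sub>R u x)"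
    by (rule integrable_times_continuous[OF _ cD K(1,2)])
      (use K(3) w in \<open>auto simp: weak_gradient_def\<close>)
  have e: "AE x in lebesgue. ?D x *\<^sub>R u x = ?D x *\<^sub>R v x"
    using ae by eventually_elim (use K in auto)
  have "(\<integral>x. ?D x *\<^sub>R u x \<partial>lebesgue) = (\<integral>x. ?D x *\<^sub>R v x \<partial>lebesgue)"
    by (rule integral_cong_AE) (use i e borel_measurable_AE[OF _ e] in auto)
  then show "(\<integral>x. v x * ?D x \<partial>lebesgue) = - (\<integral>x. (G x \<bullet> b) * \<psi> x \<partial>lebesgue)"
    using weak_gradientD[OF w \<psi> b] by (simp add: mult.commute)
qed

section \<open>Morrey's inequality on convex sets\<close>

lemma weak_gradient_mono:
  assumes "weak_gradient \<Omega> u G" "Q \<subseteq> \<Omega>"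
  shows "weak_gradient Q u G"
proof (rule weak_gradientI)
  show "locally_integrable Q u" "locally_integrable Q G"
    using assms unfolding weak_gradient_def locally_integrable_def by blast+
qed (use assms weak_gradientD test_function_mono in blast)

text \<open>Boxes form an intersection-stable generator of the Borel sets, so by Dynkin's argument
  the integral vanishes over every Borel set, in particular over the sets where \<open>f\<close> is
  positive or negative.\<close>

lemma AE_zero_of_box_integrals:
  fixes f :: "'a::euclidean_space \<Rightarrow> real"
  assumes f: "integrable lborel f"
    and box: "\<And>a b. (LINT x:box a b|lborel. f x) = 0"
  shows "AE x in lborel. f x = 0"
proof -
  have si: "set_integrable lborel A f" if "A \<in> sets borel" for A
    using f that integrable_mult_indicator[of A lborel f] by (simp add: set_integrable_def)
  \<comment> \<open>Complements in Dynkin's argument require the integral over the whole space; it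
    is the limit over an exhaustion by boxes.\<close>
  have univ: "(LINT x:UNIV|lborel. f x) = 0"
  proof -
    let ?B = "\<lambda>n::nat. box (- real n *\<^sub>R One) (real n *\<^sub>R One) :: 'a set"
    have U: "(\<Union>n. ?B n) = UNIV"
      using UN_box_eq_UNIV by simp
    have "(\<lambda>n. LINT x:?B n|lborel. f x) \<longlonglongrightarrow> (LINT x:(\<Union>n. ?B n)|lborel. f x)"
      by (rule set_integral_cont_up)
        (use si in \<open>auto simp: incseq_def subset_box\<close>)
    then show ?thesis unfolding box U using LIMSEQ_unique tendsto_const by blast
  qed
  have all: "(LINT x:A|lborel. f x) = 0" if "A \<in> sets borel" for A
  proof -
    let ?G = "range (\<lambda>(a, b). box a b :: 'a set)"
    have st: "Int_stable ?G"
      by (auto simp: Int_stable_def box_Int_box)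
    have "A \<in> sigma_sets UNIV ?G"
      using that by (subst (asm) borel_eq_box) simp
    from st _ this show ?thesis
    proof (rule sigma_sets_induct_disjoint)
      show "?G \<subseteq> Pow UNIV" by simp
      show "(LINT x:A|lborel. f x) = 0" if "A \<in> ?G" for A
        using that box by auto
      show "(LINT x:{}|lborel. f x) = 0" by (simp add: set_lebesgue_integral_def)
    next
      fix A assume A: "A \<in> sigma_sets UNIV ?G" and IH: "(LINT x:A|lborel. f x) = 0"
      have "A \<in> sets borel" using A by (subst borel_eq_box) simp
      then have "(LINT x:A \<union> (UNIV - A)|lborel. f x) = (LINT x:A|lborel. f x) + (LINT x:(UNIV - A)|lborel. f x)"
        by (intro set_integral_Un si) auto
      then show "(LINT x:(UNIV - A)|lborel. f x) = 0" using univ IH by (simp add: Un_absorb1)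
    next
      fix A :: "nat \<Rightarrow> 'a set"
      assume d: "disjoint_family A" and A: "range A \<subseteq> sigma_sets UNIV ?G"
        and IH: "\<And>i. (LINT x:A i|lborel. f x) = 0"
      have "A i \<in> sets borel" for i using A by (subst borel_eq_box) auto
      then have "(LINT x:(\<Union>i. A i)|lborel. f x) = (\<Sum>i. LINT x:A i|lborel. f x)"
        using d by (intro lebesgue_integral_countable_add si) (auto simp: disjoint_family_on_def)
      then show "(LINT x:(\<Union>i. A i)|lborel. f x) = 0" by (simp add: IH)
    qed
  qed
  have [measurable]: "f \<in> borel_measurable borel" using f by auto
  have part: "AE x in lborel. x \<in> A \<longrightarrow> f x = 0"
    if A: "A = {x. 0 < s * f x}" for A s
  proof -
    have [measurable]: "A \<in> sets borel" unfolding A by measurable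
    have "(\<integral>x. indicator A x * (s * f x) \<partial>lborel) = s * (LINT x:A|lborel. f x)"
      unfolding set_lebesgue_integral_def by (subst integral_mult_right_zero[symmetric]) (simp add: mult.left_commute)
    then have "(\<integral>x. indicator A x * (s * f x) \<partial>lborel) = 0" using all[of A] by simp
    moreover have "integrable lborel (\<lambda>x. indicator A x * (s * f x))"
      using si[of A] by (simp add: set_integrable_def mult.left_commute)
    ultimately have "AE x in lborel. indicator A x * (s * f x) = 0"
      by (subst (asm) integral_nonneg_eq_0_iff_AE) (auto simp: A indicator_def)
    then show ?thesis by eventually_elim (auto simp: A)
  qed
  have "AE x in lborel. (0 < 1 * f x \<longrightarrow> f x = 0) \<and> (0 < (-1) * f x \<longrightarrow> f x = 0)"
    using part[OF refl, of 1] part[OF refl, of "-1"] by auto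
  then show ?thesis by eventually_elim auto
qed

text \<open>The setting of Morrey's inequality with explicit constants. \<rho> is a probability
  density supported inside \<open>Q\<close>; averages of \<open>u\<close> against copies of \<rho>
  contracted towards x lead from a mean independent of x to the value at x. The bound
  \<open>b\<close> is strictly positive because Young's inequality is scaled by a multiple of it; a
  vanishing gradient is reached later by a limit.\<close>

locale convex_averages =
  fixes Q :: "'a::euclidean_space set" and u :: "'a \<Rightarrow> real" and G :: "'a \<Rightarrow> 'a"
    and \<rho> :: "'a \<Rightarrow> real" and M p D b :: real
  assumes Q: "open Q" "convex Q"
    and w: "weak_gradient Q u G"
    and \<rho>: "test_function Q \<rho>" and \<rho>_nonneg: "\<And>y. 0 \<le> \<rho> y" and \<rho>_le: "\<And>y. \<rho> y \<le> M"
    and \<rho>_int: "(\<integral>y. \<rho> y \<partial>lborel) = 1"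
    and D: "\<And>x y. x \<in> closure Q \<Longrightarrow> y \<in> Q \<Longrightarrow> norm (y - x) \<le> D"
    and Gp: "set_integrable lebesgue Q (\<lambda>x. norm (G x) powr p)"
    and b: "0 < b" "M * (LINT x:Q|lebesgue. norm (G x) powr p) \<le> b powr p"
    and p: "real DIM('a) < p"
begin

definition supp where "supp = closure {y. \<rho> y \<noteq> 0}"

lemma supp: "compact supp" "supp \<subseteq> Q" "y \<notin> supp \<Longrightarrow> \<rho> y = 0"
  using \<rho> closure_subset[of "{y. \<rho> y \<noteq> 0}"] by (auto simp: supp_def test_function_def)

lemma \<rho>_tcd: "tcd k \<rho>"
  using \<rho> by (rule test_function_tcd)

lemma \<rho>_continuous: "continuous_on S \<rho>"
  using tcd_continuous \<rho>_tcd by blast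

lemma \<rho>_borel: "\<rho> \<in> borel_measurable borel"
  by (intro borel_measurable_continuous_onI \<rho>_continuous)

lemma supp_nonempty: "supp \<noteq> {}"
proof
  assume "supp = {}"
  then have "\<rho> = (\<lambda>_. 0)" using supp(3) by auto
  then show False using \<rho>_int by simp
qed

lemma Q_nonempty: "Q \<noteq> {}"
  using supp_nonempty supp(2) by blast

lemma D_nonneg: "0 \<le> D"
proof -
  obtain y where "y \<in> Q" using Q_nonempty by blast
  then show ?thesis using D[of y y] closure_subset by force
qed

lemma M_nonneg: "0 \<le> M"
  using \<rho>_nonneg \<rho>_le order_trans by blast

lemma p_pos: "1 < p"
proof -
  have "1 \<le> real DIM('a)" using DIM_positive[where 'a = 'a] by linarith
  then show ?thesis using p by linarith
qed

text \<open>The pushforward of \<open>\<rho>\<close> under the homothety \<open>y \<mapsto> x + t (y - x)\<close>.\<close>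

definition kern :: "real \<Rightarrow> 'a \<Rightarrow> 'a \<Rightarrow> real" where
  "kern t x z = \<rho> (x + inverse t *\<^sub>R (z - x)) * inverse t ^ DIM('a)"

text \<open>This is the integral of u (x + t (y - x)) \<rho> y over y, after the change of variables
  z = x + t (y - x). In this form \<open>t\<close> occurs only in a smooth factor, whereas
  \<open>u\<close> has merely a weak gradient.\<close>

definition avg :: "'a \<Rightarrow> real \<Rightarrow> real" where
  "avg x t = (\<integral>z. u z * kern t x z \<partial>lebesgue)"

text \<open>Outside this set all kernels with time in \<open>T\<close> and base point in
  \<open>X\<close> vanish; for compact \<open>T\<close> and \<open>X\<close> it is one compact set
  on which to dominate.\<close>

definition reach :: "real set \<Rightarrow> 'a set \<Rightarrow> 'a set" where
  "reach T X = (\<lambda>(t, x, y). x + t *\<^sub>R (y - x)) ` (T \<times> X \<times> supp)"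

lemma compact_reach: "compact T \<Longrightarrow> compact X \<Longrightarrow> compact (reach T X)"
  unfolding reach_def case_prod_beta
  by (intro compact_continuous_image compact_Times supp continuous_intros) auto

text \<open>Contracting a point of the closure towards an interior point by a positive amount lands
  in the interior of a convex set. Hence the averages make sense at boundary points of
  \<open>Q\<close> too, and the representative is obtained up to the closure.\<close>

lemma reach_subset:
  assumes "T \<subseteq> {0<..1}" "X \<subseteq> closure Q"
  shows "reach T X \<subseteq> Q"
proof -
  have "x + t *\<^sub>R (y - x) \<in> Q" if "0 < t" "t \<le> 1" "x \<in> closure Q" "y \<in> supp" for t x y
    using mem_interior_closure_convex_shrink[OF Q(2), of y x t] that supp(2) Q(1)
    by (auto simp: interior_open algebra_simps)
  then show ?thesis using assms by (force simp: reach_def)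
qed

lemma reach_subset':
  assumes "T \<subseteq> {0..1}" "X \<subseteq> Q"
  shows "reach T X \<subseteq> Q"
proof -
  have "x + t *\<^sub>R (y - x) \<in> Q" if "0 \<le> t" "t \<le> 1" "x \<in> Q" "y \<in> supp" for t x y
    using convexD_alt[OF Q(2), of x y t] that supp(2) by (auto simp: algebra_simps)
  then show ?thesis using assms by (force simp: reach_def)
qed

lemma kern_zero:
  assumes "0 < t" "t \<in> T" "x \<in> X" "z \<notin> reach T X"
  shows "x + inverse t *\<^sub>R (z - x) \<notin> supp" "kern t x z = 0"
proof -
  show 1: "x + inverse t *\<^sub>R (z - x) \<notin> supp"
  proof
    assume "x + inverse t *\<^sub>R (z - x) \<in> supp"
    moreover have "z = x + t *\<^sub>R ((x + inverse t *\<^sub>R (z - x)) - x)"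
      using assms(1) by simp
    ultimately have "z \<in> reach T X"
      unfolding reach_def using assms(2,3) by (intro image_eqI[of _ _ "(t, x, x + inverse t *\<^sub>R (z - x))"]) auto
    then show False using assms(4) by simp
  qed
  show "kern t x z = 0"
    unfolding kern_def using supp(3)[OF 1] by simp
qed

lemma kern_nonneg: "0 < t \<Longrightarrow> 0 \<le> kern t x z"
  by (simp add: kern_def \<rho>_nonneg)

lemma kern_le: "0 < t \<Longrightarrow> kern t x z \<le> M * inverse t ^ DIM('a)"
  by (simp add: kern_def \<rho>_le mult_right_mono)

lemma kern_continuous: "continuous_on S (kern t x)"
  unfolding kern_def
  by (intro continuous_intros continuous_on_compose2[OF \<rho>_continuous[of UNIV]]) auto

lemma kern_borel: "kern t x \<in> borel_measurable borel"
  by (intro borel_measurable_continuous_onI kern_continuous)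

lemma kern_integrable:
  assumes "0 < t" "t \<le> 1" "x \<in> closure Q"
  shows "integrable lborel (kern t x)"
  by (rule continuous_zero_off_compact_integrable[OF kern_continuous, of "reach {t} {x}"])
    (use assms kern_zero(2)[of t "{t}" x "{x}"] in \<open>auto intro: compact_reach\<close>)

lemma kern_integral:
  assumes "0 < t"
  shows "(\<integral>z. kern t x z \<partial>lborel) = 1"
proof -
  have "(\<integral>y. \<rho> y \<partial>lborel) = \<bar>inverse t\<bar> ^ DIM('a) * (\<integral>z. \<rho> ((x - inverse t *\<^sub>R x) + inverse t *\<^sub>R z) \<partial>lborel)"
    using assms by (intro lborel_integral_affine \<rho>_borel) auto
  also have "\<dots> = (\<integral>z. kern t x z \<partial>lborel)"
    unfolding integral_mult_right_zero[symmetric]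
    by (rule Bochner_Integration.integral_cong) (use assms in \<open>auto simp: kern_def algebra_simps\<close>)
  finally show ?thesis using \<rho>_int by simp
qed

lemma avg_one: "avg x 1 = (\<integral>z. u z * \<rho> z \<partial>lebesgue)"
  by (simp add: avg_def kern_def)

definition kern' :: "real \<Rightarrow> 'a \<Rightarrow> 'a \<Rightarrow> real" where
  "kern' t x z = - (frechet_derivative \<rho> (at (x + inverse t *\<^sub>R (z - x))) (z - x)) * inverse t ^ (DIM('a) + 2)
    - real DIM('a) * inverse t * kern t x z"

lemma \<rho>_derivative: "(\<rho> has_derivative frechet_derivative \<rho> (at y)) (at y)"
  using test_function_has_derivative[OF \<rho>] .

lemma \<rho>_derivative_scaleR: "frechet_derivative \<rho> (at y) (c *\<^sub>R v) = c * frechet_derivative \<rho> (at y) v"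
  using linear_cmul[OF has_derivative_linear[OF \<rho>_derivative]] by simp

lemma \<rho>_derivative_zero: "y \<notin> supp \<Longrightarrow> frechet_derivative \<rho> (at y) v = 0"
proof -
  assume y: "y \<notin> supp"
  have "(\<rho> has_derivative (\<lambda>_. 0)) (at y)"
  proof (rule has_derivative_transform_within_open[where s = "- supp" and f = "\<lambda>_. 0"])
    show "open (- supp)" by (simp add: supp_def open_Compl)
  qed (use y supp(3) in auto)
  then show ?thesis by (metis frechet_derivative_at)
qed

lemma kern_has_derivative_time:
  assumes t: "0 < t"
  shows "((\<lambda>s. kern s x z) has_field_derivative kern' t x z) (at t)"
proof -
  have "((\<lambda>s. x + inverse s *\<^sub>R (z - x)) has_derivative (\<lambda>h. (- (inverse t * h * inverse t)) *\<^sub>R (z - x))) (at t)"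
    by (rule derivative_eq_intros refl | use t in simp)+
  from has_derivative_compose[OF this \<rho>_derivative]
  have 1: "((\<lambda>s. \<rho> (x + inverse s *\<^sub>R (z - x))) has_field_derivative
      - (inverse t * inverse t) * frechet_derivative \<rho> (at (x + inverse t *\<^sub>R (z - x))) (z - x)) (at t)"
    unfolding has_field_derivative_def
    by (rule has_derivative_eq_rhs) (simp add: fun_eq_iff \<rho>_derivative_scaleR del: scaleR_minus_left)
  have 2: "((\<lambda>s. inverse s ^ DIM('a)) has_field_derivative
      - (real DIM('a) * inverse t ^ (DIM('a) + 1))) (at t)"
  proof -
    obtain n where n: "DIM('a) = Suc n" using DIM_positive[where 'a = 'a] by (metis Suc_pred)
    show ?thesis unfolding n
      by (rule derivative_eq_intros refl | use t in \<open>simp add: power2_eq_square\<close>)+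
  qed
  show ?thesis
    unfolding kern_def[abs_def]
    by (rule DERIV_cong[OF DERIV_mult[OF 1 2]])
      (simp add: kern'_def kern_def power2_eq_square algebra_simps)
qed

text \<open>The kernels move by transport: the time derivative is minus the divergence of the kernel
  times the velocity field.\<close>

lemma kern_transport:
  assumes t: "0 < t" "t \<le> 1" and x: "x \<in> closure Q"
  defines "F \<equiv> \<lambda>c z. (((z - x) \<bullet> c) * inverse t) * kern t x z"
  shows "test_function Q (F c)"
    and "kern' t x z = - (\<Sum>c\<in>Basis. frechet_derivative (F c) (at z) c)"
proof -
  have kt: "tcd k (kern t x)" for k
  proof -
    have eq: "kern t x = (\<lambda>z. \<rho> ((x - inverse t *\<^sub>R x) + inverse t *\<^sub>R z) * inverse t ^ DIM('a))"
      by (simp add: kern_def fun_eq_iff algebra_simps)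
    show ?thesis unfolding eq
      by (intro tcd_mult tcd_const tcd_compose_affine \<rho>_tcd bounded_linear_scaleR_right)
  qed
  show "test_function Q (F c)"
  proof (rule test_functionI[of _ "reach {t} {x}"])
    show "tcd k (F c)" for k
    proof -
      have eq: "F c = (\<lambda>z. ((- (x \<bullet> c) + z \<bullet> c) * inverse t) * kern t x z)"
        by (simp add: F_def fun_eq_iff inner_diff_left)
      show ?thesis unfolding eq
        by (intro tcd_mult tcd_add tcd_const kt tcd_linear bounded_linear_inner_left)
    qed
    show "reach {t} {x} \<subseteq> Q" using t x by (intro reach_subset) auto
    show "F c z = 0" if "z \<notin> reach {t} {x}" for z
      using kern_zero(2)[of t "{t}" x "{x}"] t that by (simp add: F_def)
  qed (auto intro: compact_reach)
  let ?y = "x + inverse t *\<^sub>R (z - x)"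
  have "((\<lambda>z. x + inverse t *\<^sub>R (z - x)) has_derivative (\<lambda>h. inverse t *\<^sub>R h)) (at z)"
    by (rule derivative_eq_intros refl | simp)+
  from has_derivative_mult_left[OF has_derivative_compose[OF this \<rho>_derivative], of "inverse t ^ DIM('a)"]
  have k: "(kern t x has_derivative (\<lambda>h. frechet_derivative \<rho> (at ?y) h * inverse t ^ (DIM('a) + 1))) (at z)"
    unfolding kern_def[abs_def]
    by (rule has_derivative_eq_rhs) (simp add: fun_eq_iff \<rho>_derivative_scaleR)
  have l: "((\<lambda>z. ((z - x) \<bullet> c) * inverse t) has_derivative (\<lambda>h. (h \<bullet> c) * inverse t)) (at z)" for c
    by (rule derivative_eq_intros refl | simp)+
  have "frechet_derivative (F c) (at z) c = (((z - x) \<bullet> c) * inverse t) * (frechet_derivative \<rho> (at ?y) c * inverse t ^ (DIM('a) + 1))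
      + inverse t * kern t x z" if "c \<in> Basis" for c
    using frechet_derivative_at[OF has_derivative_mult[OF l[of c] k], symmetric] that
    by (simp add: F_def)
  then have "(\<Sum>c\<in>Basis. frechet_derivative (F c) (at z) c) =
      (\<Sum>c\<in>Basis. ((z - x) \<bullet> c) * frechet_derivative \<rho> (at ?y) c) * inverse t ^ (DIM('a) + 2)
      + real DIM('a) * (inverse t * kern t x z)"
    by (simp add: sum.distrib sum_distrib_left mult.assoc mult.left_commute mult.commute)
  also have "(\<Sum>c\<in>Basis. ((z - x) \<bullet> c) * frechet_derivative \<rho> (at ?y) c)
      = frechet_derivative \<rho> (at ?y) (\<Sum>c\<in>Basis. ((z - x) \<bullet> c) *\<^sub>R c)"
    by (simp add: linear_sum[OF has_derivative_linear[OF \<rho>_derivative]] \<rho>_derivative_scaleR)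
  finally show "kern' t x z = - (\<Sum>c\<in>Basis. frechet_derivative (F c) (at z) c)"
    by (simp add: kern'_def euclidean_representation)
qed

end

context convex_averages
begin

lemma li: "locally_integrable Q u" "locally_integrable Q G"
  using w by (auto simp: weak_gradient_def)

lemma \<rho>_derivative_sum:
  "frechet_derivative \<rho> (at y) v = (\<Sum>c\<in>Basis. (v \<bullet> c) * frechet_derivative \<rho> (at y) c)"
proof -
  have "frechet_derivative \<rho> (at y) v = frechet_derivative \<rho> (at y) (\<Sum>c\<in>Basis. (v \<bullet> c) *\<^sub>R c)"
    by (simp add: euclidean_representation)
  then show ?thesis
    by (simp add: linear_sum[OF has_derivative_linear[OF \<rho>_derivative]] \<rho>_derivative_scaleR)
qed

lemma kern'_continuous:
  assumes "S \<subseteq> {0<..} \<times> UNIV"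
  shows "continuous_on S (\<lambda>(t, z). kern' t x z)"
proof -
  have "continuous_on UNIV (\<lambda>y. frechet_derivative \<rho> (at y) c)" for c
    using tcd_continuous test_function_tcd_derivative[OF \<rho>] by blast
  then have c: "continuous_on S (\<lambda>y. frechet_derivative \<rho> (at (x + inverse (fst y) *\<^sub>R (snd y - x))) c)" for c
    by (rule continuous_on_compose2) (use assms in \<open>auto intro!: continuous_intros\<close>)
  have d: "continuous_on S (\<lambda>y. \<rho> (x + inverse (fst y) *\<^sub>R (snd y - x)))"
    by (rule continuous_on_compose2[OF \<rho>_continuous[of UNIV]])
      (use assms in \<open>auto intro!: continuous_intros\<close>)
  show ?thesis
    unfolding kern'_def kern_def case_prod_beta
      \<rho>_derivative_sum[of "x + inverse (fst y) *\<^sub>R (snd y - x)" "snd y - x" for y]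
    by (intro continuous_intros c d) (use assms in auto)
qed

lemma kern'_zero:
  assumes "0 < t" "t \<in> T" "x \<in> X" "z \<notin> reach T X"
  shows "kern' t x z = 0"
  using kern_zero[OF assms] by (simp add: kern'_def \<rho>_derivative_zero)

lemma avg_integrable:
  assumes "0 < t" "t \<le> 1" "x \<in> closure Q"
  shows "integrable lebesgue (\<lambda>z. u z * kern t x z)"
proof -
  have "integrable lebesgue (\<lambda>z. kern t x z *\<^sub>R u z)"
    by (rule integrable_times_continuous[OF li(1) kern_continuous, of "reach {t} {x}"])
      (use assms kern_zero(2)[of t "{t}" x "{x}"] reach_subset[of "{t}" "{x}"] in
        \<open>auto intro: compact_reach\<close>)
  then show ?thesis by (simp add: mult.commute)
qed

text \<open>The point z = x + t (y - x) moves with velocity y - x = (z - x) / t, so this is the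
  kernel average of the derivative of \<open>u\<close> along the motion.\<close>

definition flux :: "'a \<Rightarrow> real \<Rightarrow> real" where
  "flux x t = (\<integral>z. (G z \<bullet> (inverse t *\<^sub>R (z - x))) * kern t x z \<partial>lebesgue)"

text \<open>Differentiation falls on the kernel. By \<open>kern_transport\<close> its time
  derivative is minus a divergence of test functions, and the definition of the weak gradient moves
  the divergence onto \<open>u\<close>.\<close>

lemma avg_has_derivative:
  assumes t: "0 < t" "t < 1" and x: "x \<in> closure Q"
  shows "(avg x has_field_derivative flux x t) (at t)"
proof -
  \<comment> \<open>Times bounded away from 0 keep \<open>inverse t\<close> bounded, so
    \<open>kern'\<close> is bounded on a compact set.\<close>
  define T where "T = {t / 2..1}"
  define K where "K = reach T {x}"
  have "T \<subseteq> {0<..1}" using t by (auto simp: T_def)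
  then have K: "compact K" "K \<subseteq> Q"
    unfolding K_def using compact_reach[of T "{x}"] reach_subset[of T "{x}"] x
    by (auto simp: T_def)
  have "compact ((\<lambda>(t, z). kern' t x z) ` (T \<times> K))"
    using t by (intro compact_continuous_image kern'_continuous compact_Times K) (auto simp: T_def)
  from bounded_pos[THEN iffD1, OF compact_imp_bounded[OF this]]
  obtain B where "0 < B" and "\<forall>y\<in>(\<lambda>(t, z). kern' t x z) ` (T \<times> K). norm y \<le> B"
    by blast
  then have B: "0 < B" "\<And>s z. s \<in> T \<Longrightarrow> z \<in> K \<Longrightarrow> \<bar>kern' s x z\<bar> \<le> B"
    by auto
  have off: "kern' s x z = 0" if "s \<in> T" "z \<notin> K" for s z
    using that t by (intro kern'_zero[of s T x "{x}"]) (auto simp: K_def T_def)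
  have iK: "integrable lebesgue (\<lambda>z. indicator K z *\<^sub>R u z)"
    using li(1) K by (auto simp: locally_integrable_def set_integrable_def)
  have "((\<lambda>s. \<integral>z. u z * kern s x z \<partial>lebesgue) has_field_derivative
      (\<integral>z. u z * kern' t x z \<partial>lebesgue)) (at t)"
  proof (rule has_derivative_lebesgue_integral[where a = "t/2" and b = 1
        and g = "\<lambda>z. B * \<bar>indicator K z *\<^sub>R u z\<bar>"])
    show "integrable lebesgue (\<lambda>z. u z * kern s x z)" if "t/2 < s" "s < 1" for s
      using that t x by (intro avg_integrable) auto
    show "((\<lambda>s. u z * kern s x z) has_field_derivative u z * kern' s x z) (at s)" if "t/2 < s" for s z
      using that t by (intro DERIV_cmult kern_has_derivative_time) auto
    show "\<bar>u z * kern' s x z\<bar> \<le> B * \<bar>indicator K z *\<^sub>R u z\<bar>" if "t/2 < s" "s < 1" for s z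
    proof (cases "z \<in> K")
      case True
      have "s \<in> T" using that by (simp add: T_def)
      then have "\<bar>u z\<bar> * \<bar>kern' s x z\<bar> \<le> \<bar>u z\<bar> * B" using True B(2) by (intro mult_left_mono) auto
      then show ?thesis using True by (simp add: abs_mult mult.commute)
    qed (use that off[of s z] in \<open>auto simp: T_def\<close>)
    show "integrable lebesgue (\<lambda>z. B * \<bar>indicator K z *\<^sub>R u z\<bar>)"
      using iK by (intro integrable_mult_right integrable_abs)
    have c: "continuous_on UNIV (kern' t x)"
    proof -
      have "continuous_on UNIV (\<lambda>z. (\<lambda>(t, z). kern' t x z) (t, z))"
        by (rule continuous_on_compose2[OF kern'_continuous[of "{t} \<times> UNIV"]])
          (use t in \<open>auto intro!: continuous_intros\<close>)
      then show ?thesis by simp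
    qed
    have "integrable lebesgue (\<lambda>z. kern' t x z *\<^sub>R u z)"
      by (rule integrable_times_continuous[OF li(1) c K]) (use off t in \<open>auto simp: T_def\<close>)
    then show "(\<lambda>z. u z * kern' t x z) \<in> borel_measurable lebesgue"
      by (auto simp: mult.commute)
  qed (use t in auto)
  moreover have "(\<integral>z. u z * kern' t x z \<partial>lebesgue) = flux x t"
  proof -
    define F where "F c z = (((z - x) \<bullet> c) * inverse t) * kern t x z" for c z
    have F: "test_function Q (F c)" for c
      unfolding F_def[abs_def] using t x by (intro kern_transport) auto
    have k': "kern' t x z = - (\<Sum>c\<in>Basis. frechet_derivative (F c) (at z) c)" for z
      unfolding F_def[abs_def] using t x by (intro kern_transport) auto
    have i1: "integrable lebesgue (\<lambda>z. u z * frechet_derivative (F c) (at z) c)" for c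
    proof -
      obtain L where L: "compact L" "L \<subseteq> Q" "\<And>z v. z \<notin> L \<Longrightarrow> frechet_derivative (F c) (at z) v = 0"
        using test_function_support[OF F[of c]] by metis
      have "integrable lebesgue (\<lambda>z. frechet_derivative (F c) (at z) c *\<^sub>R u z)"
        by (rule integrable_times_continuous[OF li(1) _ L(1,2)])
          (use L(3) tcd_continuous[OF test_function_tcd_derivative[OF F, where k = 0]] in auto)
      then show ?thesis by (simp add: mult.commute)
    qed
    have i2: "integrable lebesgue (\<lambda>z. (G z \<bullet> c) * F c z)" for c
    proof -
      obtain L where L: "compact L" "L \<subseteq> Q" "\<And>z. z \<notin> L \<Longrightarrow> F c z = 0"
        using test_function_support[OF F[of c]] by metis
      have "integrable lebesgue (\<lambda>z. F c z *\<^sub>R G z)"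
        by (rule integrable_times_continuous[OF li(2) _ L(1,2)])
          (use L(3) tcd_continuous[OF test_function_tcd[OF F, where k = 0]] in auto)
      then have "integrable lebesgue (\<lambda>z. (F c z *\<^sub>R G z) \<bullet> c)" by (rule integrable_inner_left)
      then show ?thesis by (simp add: mult.commute)
    qed
    have "(\<integral>z. u z * kern' t x z \<partial>lebesgue) = (\<integral>z. - (\<Sum>c\<in>Basis. u z * frechet_derivative (F c) (at z) c) \<partial>lebesgue)"
      by (simp add: k' sum_distrib_left)
    also have "\<dots> = - (\<Sum>c\<in>Basis. \<integral>z. u z * frechet_derivative (F c) (at z) c \<partial>lebesgue)"
      using i1 by simp
    also have "\<dots> = (\<Sum>c\<in>Basis. \<integral>z. (G z \<bullet> c) * F c z \<partial>lebesgue)"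
      using weak_gradientD[OF w F] by (simp add: sum_negf)
    also have "\<dots> = (\<integral>z. (\<Sum>c\<in>Basis. (G z \<bullet> c) * F c z) \<partial>lebesgue)"
      using i2 by simp
    also have "\<dots> = flux x t"
    proof -
      have "G z \<bullet> (inverse t *\<^sub>R (z - x)) * kern t x z = (\<Sum>c\<in>Basis. (G z \<bullet> c) * F c z)" for z
        by (subst euclidean_inner) (simp add: F_def sum_distrib_left mult.assoc mult.left_commute mult.commute)
      then show ?thesis by (simp add: flux_def)
    qed
    finally show ?thesis .
  qed
  ultimately show ?thesis by (simp add: avg_def[abs_def])
qed

text \<open>The velocity is at most \<open>D\<close>, and the kernel is a probability density
  bounded by \<open>M\<close> times t^-d, d being the dimension. By Jensen's inequality the p-th
  power of the mean of |G| is at most t^-d times \<open>b powr p\<close>.\<close>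

lemma flux_bound:
  assumes t: "0 < t" "t \<le> 1" and x: "x \<in> closure Q"
  shows "\<bar>flux x t\<bar> \<le> D * b * t powr (- real DIM('a) / p)"
proof -
  define \<beta> where "\<beta> = b * t powr (- real DIM('a) / p)"
  have \<beta>: "0 < \<beta>" using b t by (simp add: \<beta>_def)
  have p: "1 < p" by (rule p_pos)
  have \<beta>p: "\<beta> powr p = b powr p * inverse t ^ DIM('a)"
    using b t p
    by (simp add: \<beta>_def powr_mult powr_powr powr_realpow[symmetric] power_inverse powr_minus[symmetric])
  define K where "K = reach {t} {x}"
  have K: "compact K" "K \<subseteq> Q" "\<And>z. z \<notin> K \<Longrightarrow> kern t x z = 0"
    unfolding K_def using t x kern_zero(2)[of t "{t}" x "{x}"] reach_subset[of "{t}" "{x}"]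
    by (auto intro!: compact_reach)
  let ?k = "kern t x"
  have kG: "integrable lebesgue (\<lambda>z. ?k z *\<^sub>R G z)"
    by (rule integrable_times_continuous[OF li(2) kern_continuous K])
  then have "integrable lebesgue (\<lambda>z. norm (?k z *\<^sub>R G z))" by (rule integrable_norm)
  then have i1: "integrable lebesgue (\<lambda>z. ?k z * norm (G z))"
    using kern_nonneg[OF t(1)] by simp
  have km: "?k \<in> borel_measurable lebesgue"
    by (rule measurable_completion) (simp add: kern_borel)
  have i0: "integrable lebesgue ?k" "(\<integral>z. ?k z \<partial>lebesgue) = 1"
    using kern_integrable[OF t x] kern_integral[OF t(1), of x] kern_borel[of t x]
    by (auto simp: integrable_completion integral_completion)
  have Gi: "integrable lebesgue (\<lambda>z. indicator Q z *\<^sub>R norm (G z) powr p)"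
    using Gp by (simp add: set_integrable_def)
  have le: "?k z * norm (G z) powr p \<le> (M * inverse t ^ DIM('a)) * (indicator Q z *\<^sub>R norm (G z) powr p)" for z
  proof (cases "z \<in> Q")
    case True
    then show ?thesis using kern_le[OF t(1)] by (simp add: mult_right_mono)
  next
    case False
    then have "z \<notin> K" using K(2) by blast
    then show ?thesis using False K(3) by simp
  qed
  have eq: "?k z * norm (G z) powr p = ?k z * (indicator Q z *\<^sub>R norm (G z) powr p)" for z
    using K by (cases "z \<in> Q") auto
  have ip: "integrable lebesgue (\<lambda>z. ?k z * norm (G z) powr p)"
  proof (rule Bochner_Integration.integrable_bound[OF integrable_mult_right[OF Gi]])
    show "(\<lambda>z. ?k z * norm (G z) powr p) \<in> borel_measurable lebesgue"
      unfolding eq by (intro borel_measurable_times km borel_measurable_integrable[OF Gi])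
    show "AE z in lebesgue. norm (?k z * norm (G z) powr p)
        \<le> norm ((M * inverse t ^ DIM('a)) * (indicator Q z *\<^sub>R norm (G z) powr p))"
      using le kern_nonneg[OF t(1)] by (intro always_eventually allI) (auto intro: order_trans[OF _ abs_ge_self])
  qed
  have Ip: "(\<integral>z. ?k z * norm (G z) powr p \<partial>lebesgue) \<le> \<beta> powr p"
  proof -
    have "(\<integral>z. ?k z * norm (G z) powr p \<partial>lebesgue)
        \<le> (\<integral>z. (M * inverse t ^ DIM('a)) * (indicator Q z *\<^sub>R norm (G z) powr p) \<partial>lebesgue)"
      by (intro integral_mono ip integrable_mult_right Gi le)
    also have "\<dots> = inverse t ^ DIM('a) * (M * (LINT x:Q|lebesgue. norm (G x) powr p))"
      unfolding set_lebesgue_integral_def by (subst integral_mult_right_zero) simp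
    also have "\<dots> \<le> inverse t ^ DIM('a) * b powr p"
      using b t by (intro mult_left_mono) auto
    finally show ?thesis by (simp add: \<beta>p mult.commute)
  qed
  \<comment> \<open>Tangent inequality for the p-th power at the point \<beta>; integrated against
    the kernel it yields Jensen's inequality with right-hand side exactly \<beta>.\<close>
  have young: "a \<le> a powr p * (\<beta> powr (1 - p) / p) + (1 - 1 / p) * \<beta>" if "0 \<le> a" for a
  proof -
    define q where "q = p / (p - 1)"
    have q: "1 < q" "1 / p + 1 / q = 1" "1 / q = 1 - 1 / p" using p by (auto simp: q_def field_simps)
    have "(a / \<beta>) * 1 \<le> (a / \<beta>) powr p / p + 1 powr q / q"
      using that \<beta> p q by (intro Youngs_inequality) auto
    then have "\<beta> * (a / \<beta>) \<le> \<beta> * ((a / \<beta>) powr p / p + (1 - 1 / p))"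
      using \<beta> q by (intro mult_left_mono) auto
    moreover have "\<beta> * (a / \<beta>) powr p = a powr p * \<beta> powr (1 - p)"
      using \<beta> that by (simp add: powr_divide powr_diff)
    ultimately show ?thesis using \<beta> by (simp add: algebra_simps)
  qed
  have I1: "(\<integral>z. ?k z * norm (G z) \<partial>lebesgue) \<le> \<beta>"
  proof -
    have "(\<integral>z. ?k z * norm (G z) \<partial>lebesgue)
        \<le> (\<integral>z. (?k z * norm (G z) powr p) * (\<beta> powr (1 - p) / p) + ?k z * ((1 - 1 / p) * \<beta>) \<partial>lebesgue)"
    proof (intro integral_mono i1 Bochner_Integration.integrable_add integrable_mult_left ip i0)
      fix z
      show "?k z * norm (G z) \<le> (?k z * norm (G z) powr p) * (\<beta> powr (1 - p) / p) + ?k z * ((1 - 1 / p) * \<beta>)"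
        using mult_left_mono[OF young[of "norm (G z)"] kern_nonneg[OF t(1), of x z]]
        by (simp add: algebra_simps)
    qed
    also have "\<dots> = (\<integral>z. ?k z * norm (G z) powr p \<partial>lebesgue) * (\<beta> powr (1 - p) / p) + (1 - 1 / p) * \<beta>"
      using ip i0 by simp
    also have "\<dots> \<le> \<beta> powr p * (\<beta> powr (1 - p) / p) + (1 - 1 / p) * \<beta>"
      using Ip p by (intro add_right_mono mult_right_mono) auto
    also have "\<beta> powr p * (\<beta> powr (1 - p) / p) = \<beta> / p"
      using \<beta> by (simp add: powr_add[symmetric])
    finally show ?thesis by (simp add: algebra_simps)
  qed
  have vel: "\<bar>G z \<bullet> (inverse t *\<^sub>R (z - x)) * ?k z\<bar> \<le> D * (?k z * norm (G z))" for z
  proof (cases "z \<in> K")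
    case True
    then obtain y where y: "y \<in> supp" "z = x + t *\<^sub>R (y - x)" by (auto simp: K_def reach_def)
    then have "inverse t *\<^sub>R (z - x) = y - x" using t by simp
    moreover have "\<bar>G z \<bullet> (y - x)\<bar> \<le> norm (G z) * D"
      using D[of x y] x y supp(2) by (intro order_trans[OF Cauchy_Schwarz_ineq2] mult_left_mono) auto
    ultimately have "\<bar>G z \<bullet> (inverse t *\<^sub>R (z - x))\<bar> * ?k z \<le> norm (G z) * D * ?k z"
      using kern_nonneg[OF t(1), of x z] by (simp only: mult_right_mono)
    then show ?thesis
      using kern_nonneg[OF t(1), of x z] by (simp only: abs_mult abs_of_nonneg ac_simps)
  qed (use K(3) in simp)
  have "\<bar>flux x t\<bar> \<le> (\<integral>z. D * (?k z * norm (G z)) \<partial>lebesgue)"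
    unfolding flux_def real_norm_def[symmetric]
    by (rule order_trans[OF integral_norm_bound integral_mono'])
      (use i1 vel kern_nonneg[OF t(1)] D_nonneg in \<open>auto intro!: integrable_mult_right\<close>)
  also have "\<dots> = D * (\<integral>z. ?k z * norm (G z) \<partial>lebesgue)" by simp
  also have "\<dots> \<le> D * \<beta>" using I1 D_nonneg by (rule mult_left_mono)
  finally show ?thesis by (simp add: \<beta>_def mult.assoc)
qed

text \<open>A convergent sequence together with its limit is compact, so all kernels involved live
  on one compact subset of \<open>Q\<close>, even when the base points lie on the boundary.\<close>

lemma avg_tendsto:
  assumes \<tau>: "\<And>n::nat. \<tau> n \<in> {0<..1}" "t \<in> {0<..1}" "\<tau> \<longlonglongrightarrow> t"
    and \<xi>: "\<And>n. \<xi> n \<in> closure Q" "x \<in> closure Q" "\<xi> \<longlonglongrightarrow> x"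
  shows "(\<lambda>n. avg (\<xi> n) (\<tau> n)) \<longlonglongrightarrow> avg x t"
proof -
  define T where "T = insert t (range \<tau>)"
  define X where "X = insert x (range \<xi>)"
  define K where "K = reach T X"
  have T: "compact T" "T \<subseteq> {0<..1}" and X: "compact X" "X \<subseteq> closure Q"
    using \<tau> \<xi> compact_sequence_with_limit by (auto simp: T_def X_def)
  have K: "compact K" "K \<subseteq> Q"
    unfolding K_def by (rule compact_reach[OF T(1) X(1)], rule reach_subset[OF T(2) X(2)])
  have "compact ((\<lambda>t. inverse t ^ DIM('a)) ` T)"
    using T by (intro compact_continuous_image continuous_intros) auto
  from bounded_pos[THEN iffD1, OF compact_imp_bounded[OF this]]
  obtain B where "0 < B" "\<forall>y\<in>(\<lambda>t. inverse t ^ DIM('a)) ` T. norm y \<le> B"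
    by blast
  then have B: "0 < B" "\<And>s. s \<in> T \<Longrightarrow> \<bar>inverse s ^ DIM('a)\<bar> \<le> B"
    by (auto simp del: power_inverse)
  have iK: "integrable lebesgue (\<lambda>z. indicator K z *\<^sub>R u z)"
    using li(1) K by (auto simp: locally_integrable_def set_integrable_def)
  show ?thesis
    unfolding avg_def
  proof (rule integral_dominated_convergence[where w = "\<lambda>z. (M * B) * \<bar>indicator K z *\<^sub>R u z\<bar>"])
    show "integrable lebesgue (\<lambda>z. (M * B) * \<bar>indicator K z *\<^sub>R u z\<bar>)"
      using iK by (intro integrable_mult_right integrable_abs)
    show "(\<lambda>z. u z * kern t x z) \<in> borel_measurable lebesgue"
      "(\<lambda>z. u z * kern (\<tau> n) (\<xi> n) z) \<in> borel_measurable lebesgue" for n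
      using avg_integrable \<tau> \<xi> by (auto intro!: borel_measurable_integrable)
    show "AE z in lebesgue. (\<lambda>n. u z * kern (\<tau> n) (\<xi> n) z) \<longlonglongrightarrow> u z * kern t x z"
    proof (intro always_eventually allI)
      fix z
      have "isCont \<rho> y" for y
        using \<rho>_continuous[of UNIV] by (simp add: continuous_on_eq_continuous_at)
      then have "(\<lambda>n. \<rho> (\<xi> n + inverse (\<tau> n) *\<^sub>R (z - \<xi> n))) \<longlonglongrightarrow> \<rho> (x + inverse t *\<^sub>R (z - x))"
        by (rule isCont_tendsto_compose) (use \<tau> \<xi> in \<open>auto intro!: tendsto_intros\<close>)
      then show "(\<lambda>n. u z * kern (\<tau> n) (\<xi> n) z) \<longlonglongrightarrow> u z * kern t x z"
        unfolding kern_def using \<tau> by (intro tendsto_intros) auto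
    qed
    show "AE z in lebesgue. norm (u z * kern (\<tau> n) (\<xi> n) z) \<le> (M * B) * \<bar>indicator K z *\<^sub>R u z\<bar>" for n
    proof (intro always_eventually allI)
      fix z
      have pos: "0 < \<tau> n" using \<tau>(1)[of n] by simp
      show "norm (u z * kern (\<tau> n) (\<xi> n) z) \<le> (M * B) * \<bar>indicator K z *\<^sub>R u z\<bar>"
      proof (cases "z \<in> K")
        case True
        have "kern (\<tau> n) (\<xi> n) z \<le> M * B"
          using B(2)[of "\<tau> n"] M_nonneg
          by (intro order_trans[OF kern_le[OF pos]] mult_left_mono) (auto simp: T_def)
        then have "\<bar>u z\<bar> * kern (\<tau> n) (\<xi> n) z \<le> \<bar>u z\<bar> * (M * B)"
          by (rule mult_left_mono) simp
        then show ?thesis using True kern_nonneg[OF pos, of "\<xi> n" z] by (simp add: abs_mult mult.commute)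
      next
        case False
        then show ?thesis
          using kern_zero(2)[OF pos, of T "\<xi> n" X z] by (auto simp: K_def T_def X_def)
      qed
    qed
  qed
qed

text \<open>The integral over (0, 1] of the bound in \<open>flux_bound\<close>; it is finite because
  \<open>p\<close> exceeds the dimension.\<close>

definition holder_const :: real where
  "holder_const = D * b / (1 - real DIM('a) / p)"

definition expo :: real where "expo = 1 - real DIM('a) / p"

lemma expo_pos: "0 < expo"
  using p p_pos by (simp add: expo_def field_simps)

lemma holder_const_nonneg: "0 \<le> holder_const"
  using expo_pos D_nonneg b by (simp add: holder_const_def expo_def)

text \<open>Rather than integrating \<open>flux\<close>, the proof shows that a primitive of its
  bound plus or minus \<open>avg\<close> is nondecreasing; \<sigma> is the sign.\<close>

lemma avg_holder:
  assumes "0 < s" "s \<le> t" "t \<le> 1" and x: "x \<in> closure Q"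
  shows "\<bar>avg x t - avg x s\<bar> \<le> holder_const * (t powr expo - s powr expo)"
proof -
  have con: "continuous_on {s..t} (avg x)"
    unfolding continuous_on_sequentially comp_def
  proof (intro allI ballI impI)
    fix \<tau> r assume *: "r \<in> {s..t}" "(\<forall>n. \<tau> n \<in> {s..t}) \<and> \<tau> \<longlonglongrightarrow> r"
    then have "\<tau> n \<in> {0<..1}" "r \<in> {0<..1}" for n
      using assms *(1) spec[OF conjunct1[OF *(2)], of n] unfolding atLeastAtMost_iff greaterThanAtMost_iff
      by linarith+
    then show "(\<lambda>n. avg x (\<tau> n)) \<longlonglongrightarrow> avg x r"
      using * x by (intro avg_tendsto) auto
  qed
  have der: "((\<lambda>t. holder_const * t powr expo) has_field_derivative D * b * r powr (- real DIM('a) / p)) (at r)"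
    if "0 < r" for r
  proof (rule DERIV_cong[OF DERIV_cmult[OF has_real_derivative_powr[OF that]]])
    have "holder_const * expo = D * b"
      using expo_pos unfolding holder_const_def expo_def by (intro nonzero_eq_divide_eq[THEN iffD1] refl) auto
    moreover have "expo - 1 = - real DIM('a) / p" by (simp add: expo_def)
    ultimately show "holder_const * (expo * r powr (expo - 1)) = D * b * r powr (- real DIM('a) / p)"
      by (simp only: mult.assoc[symmetric])
  qed
  have conH: "continuous_on {s..t} (\<lambda>t. holder_const * t powr expo)"
    using assms by (intro continuous_intros) auto
  have "holder_const * s powr expo + \<sigma> * avg x s \<le> holder_const * t powr expo + \<sigma> * avg x t"
    if \<sigma>: "\<bar>\<sigma>\<bar> = 1" for \<sigma>
  proof (rule DERIV_nonneg_imp_increasing_open[OF assms(2)])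
    fix r assume r: "s < r" "r < t"
    have "((\<lambda>t. holder_const * t powr expo + \<sigma> * avg x t) has_field_derivative
        D * b * r powr (- real DIM('a) / p) + \<sigma> * flux x r) (at r)"
      using r assms by (intro DERIV_add der DERIV_cmult avg_has_derivative) auto
    moreover have "\<bar>\<sigma> * flux x r\<bar> \<le> D * b * r powr (- real DIM('a) / p)"
      using flux_bound[of r x] r assms \<sigma> by (simp add: abs_mult)
    then have "0 \<le> D * b * r powr (- real DIM('a) / p) + \<sigma> * flux x r" by linarith
    ultimately show "\<exists>y. DERIV (\<lambda>t. holder_const * t powr expo + \<sigma> * avg x t) r :> y \<and> 0 \<le> y" by blast
  qed (intro continuous_intros con conH)
  note mono = this
  have "holder_const * s powr expo + avg x s \<le> holder_const * t powr expo + avg x t"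
    using mono[of 1] by simp
  moreover have "holder_const * s powr expo - avg x s \<le> holder_const * t powr expo - avg x t"
    using mono[of "-1"] by simp
  ultimately show ?thesis unfolding right_diff_distrib by linarith
qed

definition rep :: "'a \<Rightarrow> real" where
  "rep x = lim (\<lambda>n. avg x (inverse (real (Suc n))))"

text \<open>The preceding estimate makes the averages Cauchy as t tends to 0, at a rate uniform in
  x; thus the limit in \<open>rep\<close> exists even on the boundary of \<open>Q\<close>.\<close>

lemma rep_bound:
  assumes t: "0 < t" "t \<le> 1" and x: "x \<in> closure Q"
  shows "\<bar>avg x t - rep x\<bar> \<le> holder_const * t powr expo"
proof -
  let ?a = "\<lambda>n. avg x (inverse (real (Suc n)))"
  let ?h = "\<lambda>n. holder_const * inverse (real (Suc n)) powr expo"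
  have two: "\<bar>avg x r - avg x s\<bar> \<le> holder_const * max r s powr expo"
    if "0 < r" "r \<le> 1" "0 < s" "s \<le> 1" for r s
  proof -
    have *: "\<bar>avg x r - avg x s\<bar> \<le> holder_const * r powr expo" if "0 < s" "s \<le> r" "r \<le> 1" for r s
      using avg_holder[OF that x] holder_const_nonneg
      by (auto simp: right_diff_distrib intro: order_trans)
    show ?thesis
      using *[of s r] *[of r s] that by (cases "s \<le> r") (auto simp: max_def abs_minus_commute)
  qed
  have h0: "?h \<longlonglongrightarrow> 0"
  proof -
    have "(\<lambda>n. inverse (real (Suc n)) powr expo) \<longlonglongrightarrow> 0 powr expo"
      using expo_pos LIMSEQ_inverse_real_of_nat by (intro tendsto_powr') auto
    then show ?thesis using tendsto_mult_right_zero[of _ _ holder_const] by simp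
  qed
  have "Cauchy ?a"
  proof (rule metric_CauchyI)
    fix e :: real assume "0 < e"
    then obtain N where N: "\<And>n. n \<ge> N \<Longrightarrow> ?h n < e"
      using order_tendstoD(2)[OF h0] unfolding eventually_sequentially by blast
    show "\<exists>N. \<forall>m\<ge>N. \<forall>n\<ge>N. dist (?a m) (?a n) < e"
    proof (intro exI allI impI)
      fix m n assume mn: "N \<le> m" "N \<le> n"
      have "inverse (real (Suc m)) \<le> inverse (real (Suc N))" "inverse (real (Suc n)) \<le> inverse (real (Suc N))"
        using mn by (intro le_imp_inverse_le; simp)+
      then have "max (inverse (real (Suc m))) (inverse (real (Suc n))) \<le> inverse (real (Suc N))"
        by simp
      then have "holder_const * max (inverse (real (Suc m))) (inverse (real (Suc n))) powr expo \<le> ?h N"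
        using holder_const_nonneg expo_pos by (intro mult_left_mono powr_mono2) (auto simp: max_def)
      moreover have "inverse (real (Suc k)) \<le> 1" for k by (simp add: inverse_le_1_iff)
      ultimately show "dist (?a m) (?a n) < e"
        using two[of "inverse (real (Suc m))" "inverse (real (Suc n))"] N[of N]
        unfolding dist_real_def by (simp del: of_nat_Suc)
    qed
  qed
  then have lim: "?a \<longlonglongrightarrow> rep x"
    unfolding rep_def by (simp add: Cauchy_convergent_iff convergent_LIMSEQ_iff)
  have "(\<lambda>n. \<bar>avg x t - ?a n\<bar>) \<longlonglongrightarrow> \<bar>avg x t - rep x\<bar>"
    by (intro tendsto_intros lim)
  moreover have "eventually (\<lambda>n. \<bar>avg x t - ?a n\<bar> \<le> holder_const * t powr expo) sequentially"
  proof -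
    have "eventually (\<lambda>n. inverse (real (Suc n)) < t) sequentially"
      using LIMSEQ_inverse_real_of_nat t(1) by (rule order_tendstoD)
    then show ?thesis
    proof eventually_elim
      case (elim n)
      then show ?case using two[of t "inverse (real (Suc n))"] t by (simp add: max_def del: of_nat_Suc)
    qed
  qed
  ultimately show ?thesis
    by (rule tendsto_upperbound) simp
qed

text \<open>At time 1 the kernel is \<rho> for every base point, so both values are within
  \<open>holder_const\<close> of the same mean.\<close>

lemma rep_oscillation:
  assumes "x \<in> closure Q" "y \<in> closure Q"
  shows "\<bar>rep x - rep y\<bar> \<le> 2 * holder_const"
proof -
  have "avg x 1 = avg y 1" by (simp add: avg_one)
  then show ?thesis using rep_bound[of 1 x] rep_bound[of 1 y] assms by simp
qed

lemma rep_uniform_limit: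
  assumes "\<And>n::nat. t n \<in> {0<..1}" "t \<longlonglongrightarrow> 0"
  shows "uniform_limit (closure Q) (\<lambda>n x. avg x (t n)) rep sequentially"
proof (rule uniform_limitI)
  fix e :: real assume e: "0 < e"
  have "(\<lambda>n. t n powr expo) \<longlonglongrightarrow> 0 powr expo"
    using expo_pos assms by (intro tendsto_powr') (auto simp: less_imp_le)
  then have "(\<lambda>n. holder_const * t n powr expo) \<longlonglongrightarrow> 0"
    using tendsto_mult_right_zero[of _ _ holder_const] by simp
  then have "eventually (\<lambda>n. holder_const * t n powr expo < e) sequentially"
    using e by (rule order_tendstoD)
  then show "\<forall>\<^sub>F n in sequentially. \<forall>x\<in>closure Q. dist (avg x (t n)) (rep x) < e"
  proof eventually_elim
    case (elim n)
    then show ?case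
      using rep_bound[of "t n"] assms(1)[of n] by (auto simp: dist_real_def intro: order.strict_trans1)
  qed
qed

lemma avg_continuous_space: "t \<in> {0<..1} \<Longrightarrow> continuous_on (closure Q) (\<lambda>x. avg x t)"
  unfolding continuous_on_sequentially comp_def by (auto intro!: avg_tendsto)

lemma rep_continuous: "continuous_on (closure Q) rep"
proof -
  define \<tau> where "\<tau> n = inverse (real (Suc n))" for n
  have \<tau>: "\<tau> n \<in> {0<..1}" for n by (simp add: \<tau>_def inverse_le_1_iff)
  have "\<tau> \<longlonglongrightarrow> 0" unfolding \<tau>_def by (rule LIMSEQ_inverse_real_of_nat)
  then have "uniform_limit (closure Q) (\<lambda>n x. avg x (\<tau> n)) rep sequentially"
    by (rule rep_uniform_limit[OF \<tau>])
  moreover have "\<forall>\<^sub>F n in sequentially. continuous_on (closure Q) (\<lambda>x. avg x (\<tau> n))"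
    by (intro always_eventually allI avg_continuous_space \<tau>)
  ultimately show ?thesis
    by (intro uniform_limit_theorem[where F = sequentially and f = "\<lambda>n x. avg x (\<tau> n)"] trivial_limit_sequentially)
qed

end

section \<open>Identification of the limit of the averages with the given function\<close>

lemma AE_not_boundary_of_box:
  fixes a c :: "'a::euclidean_space"
  shows "AE x in lborel. x \<notin> cbox a c - box a c"
proof -
  have "cbox a c - box a c \<in> null_sets lborel"
    using negligible_frontier_interval[of a c]
    by (simp add: negligible_iff_null_sets null_sets_completion_iff)
  then show ?thesis by (rule AE_not_in)
qed

context convex_averages
begin

text \<open>Here the kernel is integrated over the base point x with z fixed, the form that arises
  from Fubini's theorem. Solving z = x + t (y - x) gives x = (z - t y) / (1 - t), which tends to z;
  the Jacobian and the normalisation of the kernel combine to the factor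
  \<open>q n ^ DIM('a)\<close>. The boundary of the box is excluded because the indicator jumps
  there.\<close>

lemma dual_average_tendsto:
  fixes a c :: 'a and z
  defines "E \<equiv> box a c"
  assumes z: "z \<notin> cbox a c - box a c"
    and \<tau>: "\<And>n::nat. 0 < \<tau> n" "\<And>n. \<tau> n \<le> 1 / 2" "\<tau> \<longlonglongrightarrow> 0"
  shows "(\<lambda>n. \<integral>x. indicator E x * kern (\<tau> n) x z \<partial>lborel) \<longlonglongrightarrow> indicator E z"
    and "\<bar>\<integral>x. indicator E x * kern (\<tau> n) x z \<partial>lborel\<bar> \<le> 2 ^ DIM('a)"
proof -
  define q where "q n = inverse (1 - \<tau> n)" for n
  have q: "0 < q n" "q n \<le> 2" for n
  proof -
    have "1 / 2 \<le> 1 - \<tau> n" using \<tau>(2)[of n] by simp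
    then have "inverse (1 - \<tau> n) \<le> inverse (1 / 2)" by (intro le_imp_inverse_le) auto
    then show "q n \<le> 2" by (simp add: q_def)
    show "0 < q n" using \<tau>(2)[of n] by (simp add: q_def)
  qed
  have qlim: "q \<longlonglongrightarrow> 1"
    unfolding q_def using \<tau>(3) by (auto intro!: tendsto_eq_intros)
  define X where "X n y = q n *\<^sub>R z + (- (\<tau> n * q n)) *\<^sub>R y" for n and y :: 'a
  have eq: "(\<integral>x. indicator E x * kern (\<tau> n) x z \<partial>lborel)
      = q n ^ DIM('a) * (\<integral>y. indicator E (X n y) * \<rho> y \<partial>lborel)" for n
  proof -
    have t: "0 < \<tau> n" "\<tau> n < 1" using \<tau>(1,2)[of n] by auto
    have qn: "(1 - \<tau> n) * q n = 1" using t by (simp add: q_def)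
    have k: "kern (\<tau> n) (X n y) z = \<rho> y * inverse (\<tau> n) ^ DIM('a)" for y
    proof -
      have c1: "1 - inverse (\<tau> n) = - (inverse (\<tau> n) * (1 - \<tau> n))" using t by (simp add: algebra_simps)
      have "X n y + inverse (\<tau> n) *\<^sub>R (z - X n y) = (1 - inverse (\<tau> n)) *\<^sub>R X n y + inverse (\<tau> n) *\<^sub>R z"
        by (simp add: algebra_simps)
      also have "(1 - inverse (\<tau> n)) *\<^sub>R X n y = y - inverse (\<tau> n) *\<^sub>R z"
      proof -
        have "(1 - inverse (\<tau> n)) * q n = - inverse (\<tau> n)"
          "(1 - inverse (\<tau> n)) * (- (\<tau> n * q n)) = 1"
          unfolding c1 using t qn by (simp_all add: mult.assoc) (simp add: mult.left_commute)
        then show ?thesis unfolding X_def scaleR_add_right scaleR_scaleR by simp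
      qed
      finally show ?thesis by (simp add: kern_def)
    qed
    have [measurable]: "(\<lambda>x. kern (\<tau> n) x z) \<in> borel_measurable borel"
      unfolding kern_def using \<rho>_borel by measurable
    have "(\<integral>x. indicator E x * kern (\<tau> n) x z \<partial>lborel)
        = \<bar>- (\<tau> n * q n)\<bar> ^ DIM('a) * (\<integral>y. indicator E (X n y) * kern (\<tau> n) (X n y) z \<partial>lborel)"
      unfolding X_def
      by (rule lborel_integral_affine) (use t q[of n] in \<open>auto simp: E_def\<close>)
    also have "(\<integral>y. indicator E (X n y) * kern (\<tau> n) (X n y) z \<partial>lborel)
        = inverse (\<tau> n) ^ DIM('a) * (\<integral>y. indicator E (X n y) * \<rho> y \<partial>lborel)"
      by (subst integral_mult_right_zero[symmetric]) (simp add: k mult.assoc mult.commute mult.left_commute)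
    finally show ?thesis
      using t q[of n] by (simp add: abs_mult power_mult_distrib power_inverse)
  qed
  have \<rho>i: "integrable lborel \<rho>"
    by (rule continuous_zero_off_compact_integrable[OF \<rho>_continuous supp(1,3)])
  have [measurable]: "\<rho> \<in> borel_measurable borel" "E \<in> sets borel" by (auto simp: \<rho>_borel E_def)
  have [measurable]: "X n \<in> borel_measurable borel" for n
    unfolding X_def[abs_def] by measurable
  have "(\<lambda>n. \<integral>y. indicator E (X n y) * \<rho> y \<partial>lborel) \<longlonglongrightarrow> (\<integral>y. indicator E z * \<rho> y \<partial>lborel)"
  proof (rule integral_dominated_convergence[where w = \<rho>])
    show "AE y in lborel. (\<lambda>n. indicator E (X n y) * \<rho> y) \<longlonglongrightarrow> indicator E z * \<rho> y"
    proof (intro always_eventually allI tendsto_mult tendsto_const)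
      fix y
      have lim: "(\<lambda>n. X n y) \<longlonglongrightarrow> z"
        unfolding X_def using \<tau>(3) qlim by (auto intro!: tendsto_eq_intros)
      show "(\<lambda>n. indicator E (X n y)) \<longlonglongrightarrow> (indicator E z :: real)"
      proof (cases "z \<in> E")
        case True
        have "eventually (\<lambda>n. X n y \<in> E) sequentially"
          by (rule topological_tendstoD[OF lim]) (use True in \<open>auto simp: E_def open_box\<close>)
        then show ?thesis
          by (intro tendsto_eventually) (use True in \<open>auto elim!: eventually_mono simp: indicator_def\<close>)
      next
        case False
        then have "z \<in> - cbox a c" using z by (auto simp: E_def)
        have "eventually (\<lambda>n. X n y \<in> - cbox a c) sequentially"
          by (rule topological_tendstoD[OF lim]) (use \<open>z \<in> - cbox a c\<close> in \<open>auto intro: open_Compl closed_cbox\<close>)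
        then have "eventually (\<lambda>n. X n y \<notin> E) sequentially"
          by eventually_elim (use box_subset_cbox in \<open>auto simp: E_def\<close>)
        then show ?thesis
          by (intro tendsto_eventually) (use False in \<open>auto elim!: eventually_mono simp: indicator_def\<close>)
      qed
    qed
    show "AE y in lborel. norm (indicator E (X n y) * \<rho> y) \<le> \<rho> y" for n
      by (intro always_eventually allI) (auto simp: indicator_def \<rho>_nonneg)
  qed (use \<rho>i in auto)
  then have "(\<lambda>n. \<integral>y. indicator E (X n y) * \<rho> y \<partial>lborel) \<longlonglongrightarrow> indicator E z"
    using \<rho>_int by simp
  then have "(\<lambda>n. q n ^ DIM('a) * (\<integral>y. indicator E (X n y) * \<rho> y \<partial>lborel)) \<longlonglongrightarrow> 1 ^ DIM('a) * indicator E z"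
    by (intro tendsto_intros qlim)
  then show "(\<lambda>n. \<integral>x. indicator E x * kern (\<tau> n) x z \<partial>lborel) \<longlonglongrightarrow> indicator E z"
    by (simp add: eq)
  have i01: "0 \<le> (\<integral>y. indicator E (X n y) * \<rho> y \<partial>lborel)" "(\<integral>y. indicator E (X n y) * \<rho> y \<partial>lborel) \<le> 1"
  proof -
    show "0 \<le> (\<integral>y. indicator E (X n y) * \<rho> y \<partial>lborel)"
      by (rule Bochner_Integration.integral_nonneg) (simp add: \<rho>_nonneg)
    have "(\<integral>y. indicator E (X n y) * \<rho> y \<partial>lborel) \<le> (\<integral>y. \<rho> y \<partial>lborel)"
      by (rule integral_mono'[OF \<rho>i]) (auto simp: indicator_def \<rho>_nonneg)
    then show "(\<integral>y. indicator E (X n y) * \<rho> y \<partial>lborel) \<le> 1" by (simp add: \<rho>_int)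
  qed
  have "q n ^ DIM('a) * (\<integral>y. indicator E (X n y) * \<rho> y \<partial>lborel) \<le> 2 ^ DIM('a) * 1"
    using i01 q[of n] by (intro mult_mono power_mono) auto
  then show "\<bar>\<integral>x. indicator E x * kern (\<tau> n) x z \<partial>lborel\<bar> \<le> 2 ^ DIM('a)"
    using i01 q[of n] by (simp add: eq abs_mult)
qed

text \<open>Both sides are limits of the integral of the averages over the box: uniform convergence
  of the averages gives the left one, Fubini's theorem and the dual averages give the right
  one.\<close>

lemma box_integral_rep:
  fixes a c :: 'a
  assumes sub: "cbox a c \<subseteq> Q"
  shows "(\<integral>x. indicator (box a c) x * rep x \<partial>lborel) = (\<integral>x. indicator (box a c) x * u x \<partial>lebesgue)"
proof -
  define E where "E = box a c"
  have E: "E \<subseteq> cbox a c" "E \<subseteq> closure Q" "E \<in> sets borel"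
    unfolding E_def using box_subset_cbox[of a c] sub closure_subset[of Q] by auto
  \<comment> \<open>Times of at most 1/2 keep the factor of the dual averages below 2 to the power
    of the dimension.\<close>
  define \<tau> where "\<tau> n = inverse (real n + 2)" for n
  have \<tau>: "0 < \<tau> n" "\<tau> n \<le> 1 / 2" "\<tau> n \<le> 1" for n
    by (auto simp: \<tau>_def field_simps)
  have \<tau>0: "\<tau> \<longlonglongrightarrow> 0"
    using LIMSEQ_Suc[OF LIMSEQ_inverse_real_of_nat] by (simp add: \<tau>_def[abs_def] add.commute)
  define K where "K = reach {0..1/2} (cbox a c)"
  have K: "compact K" "K \<subseteq> Q"
    unfolding K_def by (rule compact_reach, simp, simp, rule reach_subset', use sub in auto)
  have EK: "E \<subseteq> K"
  proof
    fix x assume "x \<in> E"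
    obtain y where "y \<in> supp" using supp_nonempty by blast
    then show "x \<in> K"
      unfolding K_def reach_def using E \<open>x \<in> E\<close> by (intro image_eqI[of _ _ "(0, x, y)"]) auto
  qed
  have iK: "integrable lebesgue (\<lambda>z. indicator K z * u z)"
    using li(1) K by (auto simp: locally_integrable_def set_integrable_def)
  \<comment> \<open>Fubini's theorem is applied on the Borel product, so \<open>u\<close> is
    exchanged for a Borel version on the compact set \<open>K\<close>.\<close>
  obtain f where f[measurable]: "f \<in> borel_measurable lborel" and ae: "AE z in lborel. indicator K z * u z = f z"
    using completion_ex_borel_measurable_real[OF borel_measurable_integrable[OF iK]] by auto
  have aeL: "AE z in lebesgue. indicator K z * u z = f z" using ae by (rule AE_completion)
  have fL: "f \<in> borel_measurable lebesgue" using f by (rule measurable_completion)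
  have "integrable lebesgue f"
    by (rule integrable_cong_AE_imp[OF iK fL]) (use aeL in \<open>auto simp: eq_commute\<close>)
  then have fi: "integrable lborel f" by (simp add: integrable_completion f)
  have avg_eq: "avg x (\<tau> n) = (\<integral>z. f z * kern (\<tau> n) x z \<partial>lborel)" if "x \<in> E" for x n
  proof -
    have off: "kern (\<tau> n) x z = 0" if "z \<notin> K" for z
      using kern_zero(2)[OF \<tau>(1), of n "{0..1/2}" x "cbox a c" z] \<open>x \<in> E\<close> E \<tau>[of n] that by (auto simp: K_def)
    have km: "kern (\<tau> n) x \<in> borel_measurable lebesgue"
      by (rule measurable_completion) (simp add: kern_borel)
    have "avg x (\<tau> n) = (\<integral>z. (indicator K z * u z) * kern (\<tau> n) x z \<partial>lebesgue)"
      unfolding avg_def by (rule Bochner_Integration.integral_cong) (auto simp: indicator_def off)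
    also have "\<dots> = (\<integral>z. f z * kern (\<tau> n) x z \<partial>lebesgue)"
    proof (rule integral_cong_AE)
      show "(\<lambda>z. indicator K z * u z * kern (\<tau> n) x z) \<in> borel_measurable lebesgue"
        by (rule borel_measurable_times[OF borel_measurable_integrable[OF iK] km])
      show "(\<lambda>z. f z * kern (\<tau> n) x z) \<in> borel_measurable lebesgue"
        by (rule borel_measurable_times[OF fL km])
    qed (use aeL in auto)
    also have "\<dots> = (\<integral>z. f z * kern (\<tau> n) x z \<partial>lborel)"
      by (rule integral_completion) (use kern_borel[of "\<tau> n" x] in measurable)
    finally show ?thesis .
  qed
  define \<Psi> where "\<Psi> n z = (\<integral>x. indicator E x * kern (\<tau> n) x z \<partial>lborel)" for n z
  have [measurable]: "E \<in> sets borel" "\<rho> \<in> borel_measurable borel" by (auto simp: E(3) \<rho>_borel)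
  have [measurable]: "(\<lambda>(x, z). kern (\<tau> n) x z) \<in> borel_measurable (lborel \<Otimes>\<^sub>M lborel)" for n
    unfolding kern_def by measurable
  have Emeas: "integrable lborel (indicator E :: 'a \<Rightarrow> real)"
    unfolding E_def by (intro integrable_real_indicator) (use emeasure_bounded_finite[OF bounded_box, of a c] in auto)
  have fub: "(\<integral>x. indicator E x * avg x (\<tau> n) \<partial>lborel) = (\<integral>z. f z * \<Psi> n z \<partial>lborel)" for n
  proof -
    define h where "h x z = indicator E x * (f z * kern (\<tau> n) x z)" for x z
    define C where "C = M * inverse (\<tau> n) ^ DIM('a)"
    have C: "0 \<le> C" "\<And>x z. kern (\<tau> n) x z \<le> C" "\<And>x z. 0 \<le> kern (\<tau> n) x z"
      using kern_le kern_nonneg \<tau>[of n] M_nonneg by (auto simp: C_def)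
    have hm[measurable]: "case_prod h \<in> borel_measurable (lborel \<Otimes>\<^sub>M lborel)"
      unfolding h_def by measurable
    have bd: "\<bar>h x z\<bar> \<le> indicator E x * (C * \<bar>f z\<bar>)" for x z
      unfolding h_def using C mult_right_mono[of "kern (\<tau> n) x z" C "\<bar>f z\<bar>"]
      by (auto simp: abs_mult indicator_def mult.commute)
    have hi: "integrable lborel (\<lambda>z. h x z)" for x
    proof (rule Bochner_Integration.integrable_bound[where f = "\<lambda>z. indicator E x * (C * \<bar>f z\<bar>)"])
      show "integrable lborel (\<lambda>z. indicator E x * (C * \<bar>f z\<bar>))"
        using fi by (intro integrable_mult_right integrable_abs)
      show "AE z in lborel. norm (h x z) \<le> norm (indicator E x * (C * \<bar>f z\<bar>))"
        using bd[of x] by (intro always_eventually allI) (auto intro: order_trans[OF _ abs_ge_self])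
    qed measurable
    have "integrable (lborel \<Otimes>\<^sub>M lborel) (case_prod h)"
    proof (rule lborel_pair.Fubini_integrable[OF hm])
      show "integrable lborel (\<lambda>x. \<integral>z. norm (case_prod h (x, z)) \<partial>lborel)"
      proof (rule Bochner_Integration.integrable_bound[where f = "\<lambda>x. indicator E x * (C * (\<integral>z. \<bar>f z\<bar> \<partial>lborel))"])
        show "integrable lborel (\<lambda>x. indicator E x * (C * (\<integral>z. \<bar>f z\<bar> \<partial>lborel)))"
          using Emeas by (intro integrable_mult_left)
        show "AE x in lborel. norm (\<integral>z. norm (case_prod h (x, z)) \<partial>lborel)
            \<le> norm (indicator E x * (C * (\<integral>z. \<bar>f z\<bar> \<partial>lborel)))"
        proof (intro always_eventually allI)
          fix x
          have "(\<integral>z. norm (h x z) \<partial>lborel) \<le> (\<integral>z. indicator E x * (C * \<bar>f z\<bar>) \<partial>lborel)"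
            using hi[of x] fi bd[of x]
            by (intro integral_mono integrable_mult_right integrable_abs integrable_norm) auto
          then have "(\<integral>z. norm (h x z) \<partial>lborel) \<le> indicator E x * (C * (\<integral>z. \<bar>f z\<bar> \<partial>lborel))" by simp
          moreover have "0 \<le> (\<integral>z. norm (h x z) \<partial>lborel)" by (intro Bochner_Integration.integral_nonneg) simp
          ultimately show "norm (\<integral>z. norm (case_prod h (x, z)) \<partial>lborel)
            \<le> norm (indicator E x * (C * (\<integral>z. \<bar>f z\<bar> \<partial>lborel)))" by simp
        qed
      qed measurable
    qed (use hi in auto)
    from lborel_pair.Fubini_integral[OF this]
    have "(\<integral>x. (\<integral>z. h x z \<partial>lborel) \<partial>lborel) = (\<integral>z. (\<integral>x. h x z \<partial>lborel) \<partial>lborel)" by simp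
    also have "(\<lambda>z. \<integral>x. h x z \<partial>lborel) = (\<lambda>z. f z * \<Psi> n z)"
      unfolding h_def \<Psi>_def by (subst integral_mult_right_zero[symmetric]) (simp add: mult.left_commute)
    also have "(\<lambda>x. \<integral>z. h x z \<partial>lborel) = (\<lambda>x. indicator E x * avg x (\<tau> n))"
      unfolding h_def by (auto simp: avg_eq indicator_def fun_eq_iff)
    finally show ?thesis .
  qed
  have lim1: "(\<lambda>n. \<integral>z. f z * \<Psi> n z \<partial>lborel) \<longlonglongrightarrow> (\<integral>z. f z * indicator E z \<partial>lborel)"
  proof (rule integral_dominated_convergence[where w = "\<lambda>z. \<bar>f z\<bar> * 2 ^ DIM('a)"])
    show "AE z in lborel. (\<lambda>n. f z * \<Psi> n z) \<longlonglongrightarrow> f z * indicator E z"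
      using AE_not_boundary_of_box[of a c]
      by eventually_elim (auto simp: \<Psi>_def E_def intro!: tendsto_mult dual_average_tendsto(1) \<tau> \<tau>0)
    show "AE z in lborel. norm (f z * \<Psi> n z) \<le> \<bar>f z\<bar> * 2 ^ DIM('a)" for n
      using AE_not_boundary_of_box[of a c]
      by eventually_elim (auto simp: \<Psi>_def E_def abs_mult intro!: mult_left_mono dual_average_tendsto(2) \<tau> \<tau>0)
    show "integrable lborel (\<lambda>z. \<bar>f z\<bar> * 2 ^ DIM('a))"
      using fi by (intro integrable_mult_left integrable_abs)
    show "(\<lambda>z. f z * \<Psi> n z) \<in> borel_measurable lborel" for n
      unfolding \<Psi>_def by measurable
  qed measurable
  have cE: "continuous_on E (\<lambda>x. avg x (\<tau> n))" "continuous_on E rep" for n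
    using \<tau>[of n] by (intro continuous_on_subset[OF _ E(2)] avg_continuous_space rep_continuous; simp)+
  have mE: "(\<lambda>x. indicator E x * avg x (\<tau> n)) \<in> borel_measurable lborel"
    "(\<lambda>x. indicator E x * rep x) \<in> borel_measurable lborel" for n
    using borel_measurable_continuous_on_indicator[OF E(3) cE(1)[of n]]
      borel_measurable_continuous_on_indicator[OF E(3) cE(2)] by auto
  obtain B where B: "\<And>x. x \<in> E \<Longrightarrow> \<bar>rep x\<bar> \<le> B"
  proof -
    have "compact (rep ` cbox a c)"
      using sub closure_subset by (intro compact_continuous_image continuous_on_subset[OF rep_continuous]) auto
    from bounded_pos[THEN iffD1, OF compact_imp_bounded[OF this]]
    show ?thesis using that E(1) by (auto simp: subset_eq)
  qed
  have lim2: "(\<lambda>n. \<integral>x. indicator E x * avg x (\<tau> n) \<partial>lborel) \<longlonglongrightarrow> (\<integral>x. indicator E x * rep x \<partial>lborel)"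
  proof (rule integral_dominated_convergence[where w = "\<lambda>x. indicator E x * (B + holder_const)"])
    show "integrable lborel (\<lambda>x. indicator E x * (B + holder_const))"
      using Emeas by (intro integrable_mult_left)
    have ul: "uniform_limit (closure Q) (\<lambda>n x. avg x (\<tau> n)) rep sequentially"
      by (rule rep_uniform_limit[OF _ \<tau>0]) (use \<tau> in auto)
    show "AE x in lborel. (\<lambda>n. indicator E x * avg x (\<tau> n)) \<longlonglongrightarrow> indicator E x * rep x"
      using tendsto_uniform_limitI[OF ul] E by (intro always_eventually allI) (auto simp: indicator_def)
    show "AE x in lborel. norm (indicator E x * avg x (\<tau> n)) \<le> indicator E x * (B + holder_const)" for n
    proof (intro always_eventually allI)
      fix x
      show "norm (indicator E x * avg x (\<tau> n)) \<le> indicator E x * (B + holder_const)"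
      proof (cases "x \<in> E")
        case True
        have "\<tau> n powr expo \<le> 1 powr expo"
          using \<tau>[of n] expo_pos by (intro powr_mono2) auto
        then have "holder_const * \<tau> n powr expo \<le> holder_const"
          using holder_const_nonneg mult_left_mono[of "\<tau> n powr expo" 1 holder_const] by simp
        then have "\<bar>avg x (\<tau> n) - rep x\<bar> \<le> holder_const"
          using rep_bound[OF \<tau>(1,3), of x n] subsetD[OF E(2) True] by linarith
        then show ?thesis using B[OF True] True by simp
      qed simp
    qed
  qed (rule mE)+
  have "(\<integral>x. indicator E x * rep x \<partial>lborel) = (\<integral>z. f z * indicator E z \<partial>lborel)"
    using LIMSEQ_unique[OF lim2] lim1 unfolding fub by blast
  also have "\<dots> = (\<integral>z. f z * indicator E z \<partial>lebesgue)"
    by (rule integral_completion[symmetric]) measurable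
  also have "\<dots> = (\<integral>z. indicator E z * (indicator K z * u z) \<partial>lebesgue)"
  proof (rule integral_cong_AE)
    have Em: "(indicator E :: 'a \<Rightarrow> real) \<in> borel_measurable lebesgue"
      using E(3) by (intro borel_measurable_indicator) auto
    show "(\<lambda>z. f z * indicator E z) \<in> borel_measurable lebesgue"
      by (rule borel_measurable_times[OF fL Em])
    show "(\<lambda>z. indicator E z * (indicator K z * u z)) \<in> borel_measurable lebesgue"
      by (rule borel_measurable_times[OF Em borel_measurable_integrable[OF iK]])
  qed (use aeL in auto)
  also have "\<dots> = (\<integral>z. indicator E z * u z \<partial>lebesgue)"
    using EK by (intro Bochner_Integration.integral_cong) (auto simp: indicator_def)
  finally show ?thesis by (simp add: E_def)
qed

text \<open>On each closed box inside \<open>Q\<close> both functions have equal integrals over all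
  subboxes, hence agree almost everywhere; countably many such boxes exhaust
  \<open>Q\<close>.\<close>

lemma rep_eq_AE: "AE x in lebesgue. x \<in> Q \<longrightarrow> u x = rep x"
proof -
  have cb: "AE x in lebesgue. x \<in> cbox a c \<longrightarrow> u x = rep x" if sub: "cbox a c \<subseteq> Q" for a c
  proof -
    have iE: "integrable lebesgue (\<lambda>z. indicator (cbox a c) z * u z)"
      using li(1) sub by (auto simp: locally_integrable_def set_integrable_def)
    obtain f where f[measurable]: "f \<in> borel_measurable lborel"
      and ae: "AE z in lborel. indicator (cbox a c) z * u z = f z"
      using completion_ex_borel_measurable_real[OF borel_measurable_integrable[OF iE]] by auto
    have aeL: "AE z in lebesgue. indicator (cbox a c) z * u z = f z" using ae by (rule AE_completion)
    have fL: "f \<in> borel_measurable lebesgue" using f by (rule measurable_completion)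
    have fiL: "integrable lebesgue f"
      by (rule integrable_cong_AE_imp[OF iE fL]) (use aeL in \<open>auto simp: eq_commute\<close>)
    then have fi: "integrable lborel f" by (simp add: integrable_completion f)
    define g where "g x = indicator (cbox a c) x * rep x" for x
    have gi: "integrable lborel g"
    proof -
      have "set_integrable lborel (cbox a c) rep"
        unfolding set_integrable_def using sub closure_subset[of Q]
        by (intro borel_integrable_compact continuous_on_subset[OF rep_continuous]) auto
      then show ?thesis by (simp add: set_integrable_def g_def[abs_def])
    qed
    have "AE x in lborel. f x - g x = 0"
    proof (rule AE_zero_of_box_integrals)
      show "integrable lborel (\<lambda>x. f x - g x)" using fi gi by (rule Bochner_Integration.integrable_diff)
      fix a' c' :: 'a
      have bm: "box a' c' \<in> sets lborel" by simp
      \<comment> \<open>A test box cut with the fixed box is again a box, so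
        \<open>box_integral_rep\<close> applies to the intersection.\<close>
      obtain a2 c2 where B: "cbox a c \<inter> cbox a' c' = cbox a2 c2" "box a c \<inter> box a' c' = box a2 c2"
        unfolding Int_interval box_Int_box by blast
      have sub2: "cbox a2 c2 \<subseteq> Q" using B sub by blast
      have ind: "AE x in lborel. indicator (box a' c') x * indicator (cbox a c) x = (indicator (box a2 c2) x :: real)"
        using AE_not_boundary_of_box[of a c]
        by eventually_elim (use B(2) box_subset_cbox[of a c] in \<open>auto simp: indicator_def set_eq_iff\<close>)
      have bm2: "(indicator (box r s) :: 'a \<Rightarrow> real) \<in> borel_measurable lebesgue" for r s :: 'a
        by (intro borel_measurable_indicator) auto
      have "(LINT x:box a' c'|lborel. f x) = (\<integral>x. indicator (box a' c') x * f x \<partial>lebesgue)"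
        unfolding set_lebesgue_integral_def by (subst integral_completion) auto
      also have "\<dots> = (\<integral>x. indicator (box a2 c2) x * u x \<partial>lebesgue)"
      proof (rule integral_cong_AE)
        show "(\<lambda>x. indicator (box a' c') x * f x) \<in> borel_measurable lebesgue"
          by (rule borel_measurable_times[OF bm2 fL])
        have "(\<lambda>x. indicator (box a2 c2) x * (indicator (cbox a c) x * u x)) \<in> borel_measurable lebesgue"
          by (rule borel_measurable_times[OF bm2 borel_measurable_integrable[OF iE]])
        moreover have "(\<lambda>x. indicator (box a2 c2) x * (indicator (cbox a c) x * u x)) = (\<lambda>x. indicator (box a2 c2) x * u x)"
          using B(2) box_subset_cbox[of a c] by (auto simp: indicator_def fun_eq_iff set_eq_iff)
        ultimately show "(\<lambda>x. indicator (box a2 c2) x * u x) \<in> borel_measurable lebesgue" by simp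
        show "AE x in lebesgue. indicator (box a' c') x * f x = indicator (box a2 c2) x * u x"
          using aeL AE_completion[OF ind] by eventually_elim (metis mult.assoc)
      qed
      also have "\<dots> = (\<integral>x. indicator (box a2 c2) x * rep x \<partial>lborel)"
        by (rule box_integral_rep[OF sub2, symmetric])
      also have "\<dots> = (LINT x:box a' c'|lborel. g x)"
        unfolding set_lebesgue_integral_def
      proof (rule integral_cong_AE)
        show "(\<lambda>x. indicator (box a2 c2) x * rep x) \<in> borel_measurable lborel"
          using borel_measurable_continuous_on_indicator[of "box a2 c2" rep]
            continuous_on_subset[OF rep_continuous, of "box a2 c2"] sub2 closure_subset[of Q] box_subset_cbox[of a2 c2]
          by simp
        show "(\<lambda>x. indicator (box a' c') x *\<^sub>R g x) \<in> borel_measurable lborel"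
          using gi by auto
        show "AE x in lborel. indicator (box a2 c2) x * rep x = indicator (box a' c') x *\<^sub>R g x"
          using ind by eventually_elim (simp add: g_def)
      qed
      finally have "(LINT x:box a' c'|lborel. f x) = (LINT x:box a' c'|lborel. g x)" .
      moreover have "set_integrable lborel (box a' c') f" "set_integrable lborel (box a' c') g"
        using integrable_mult_indicator[OF bm fi] integrable_mult_indicator[OF bm gi] by (auto simp: set_integrable_def)
      ultimately show "(LINT x:box a' c'|lborel. f x - g x) = 0"
        by (simp add: set_integral_diff)
    qed
    from AE_completion[OF this] aeL show ?thesis
      by eventually_elim (auto simp: g_def indicator_def)
  qed
  obtain \<D> where \<D>: "countable \<D>" "\<D> \<subseteq> Pow Q" "\<And>X. X \<in> \<D> \<Longrightarrow> \<exists>a b. X = cbox a b" "\<Union>\<D> = Q"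
    using open_countable_Union_open_cbox[OF Q(1)] by metis
  have "AE x in lebesgue. \<forall>X\<in>\<D>. x \<in> X \<longrightarrow> u x = rep x"
    using \<D> cb by (subst AE_ball_countable[OF \<D>(1)]) (metis PowD subsetD)
  then show ?thesis by eventually_elim (use \<D>(4) in blast)
qed

end

text \<open>The constant sees \<open>Q\<close> only through \<open>D\<close> and \<open>M\<close>,
  which makes the bound usable for tubes of degenerating shape.\<close>

theorem morrey_convex:
  fixes Q :: "'a::euclidean_space set"
  assumes Q: "open Q" "convex Q" and w: "weak_gradient Q u G"
    and \<rho>: "test_function Q \<rho>" "\<And>y. 0 \<le> \<rho> y" "\<And>y. \<rho> y \<le> M" "(\<integral>y. \<rho> y \<partial>lborel) = 1"
    and D: "\<And>x y. x \<in> closure Q \<Longrightarrow> y \<in> Q \<Longrightarrow> norm (y - x) \<le> D"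
    and G: "set_integrable lebesgue Q (\<lambda>x. norm (G x) powr p)" and p: "real DIM('a) < p"
  obtains v where "continuous_on (closure Q) v" "AE x in lebesgue. x \<in> Q \<longrightarrow> u x = v x"
    "\<And>x y. x \<in> closure Q \<Longrightarrow> y \<in> closure Q \<Longrightarrow> \<bar>v x - v y\<bar> powr p
      \<le> (2 * D / (1 - real DIM('a) / p)) powr p * (M * (LINT x:Q|lebesgue. norm (G x) powr p))"
proof -
  define I where "I = M * (LINT x:Q|lebesgue. norm (G x) powr p)"
  have M: "0 \<le> M" using \<rho>(2,3) order_trans by blast
  have I: "0 \<le> I"
    unfolding I_def set_lebesgue_integral_def using M
    by (intro mult_nonneg_nonneg Bochner_Integration.integral_nonneg) auto
  have p1: "1 < p" using p DIM_positive[where 'a = 'a] by linarith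
  define b where "b \<epsilon> = (I + \<epsilon>) powr (1 / p)" for \<epsilon>
  have loc: "convex_averages Q u G \<rho> M p D (b \<epsilon>)" if "0 < \<epsilon>" for \<epsilon>
    by unfold_locales (use assms I p1 that in \<open>auto simp: b_def powr_powr I_def\<close>)
  \<comment> \<open>\<open>rep\<close> is built from \<open>u\<close> and \<rho> alone, so the same
    function obeys the bound for every \<epsilon>, and \<epsilon> can tend to 0.\<close>
  define v where "v = convex_averages.rep u \<rho>"
  interpret one: convex_averages Q u G \<rho> M p D "b 1" by (rule loc) simp
  show ?thesis
  proof (rule that)
    show "continuous_on (closure Q) v" unfolding v_def by (rule one.rep_continuous)
    show "AE x in lebesgue. x \<in> Q \<longrightarrow> u x = v x" unfolding v_def by (rule one.rep_eq_AE)
    fix x y assume xy: "x \<in> closure Q" "y \<in> closure Q"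
    let ?C = "2 * D / (1 - real DIM('a) / p)"
    have C: "0 \<le> ?C" using one.D_nonneg one.expo_pos by (simp add: one.expo_def)
    have "\<bar>v x - v y\<bar> powr p \<le> ?C powr p * I + ?C powr p * \<epsilon>" if "0 < \<epsilon>" for \<epsilon>
    proof -
      interpret e: convex_averages Q u G \<rho> M p D "b \<epsilon>" by (rule loc[OF that])
      have "\<bar>v x - v y\<bar> \<le> ?C * b \<epsilon>"
        using e.rep_oscillation[OF xy] by (simp add: v_def e.holder_const_def)
      then have "\<bar>v x - v y\<bar> powr p \<le> (?C * b \<epsilon>) powr p"
        using p1 by (intro powr_mono2) auto
      also have "\<dots> = ?C powr p * (I + \<epsilon>)"
        unfolding powr_mult using I that p1 by (simp add: b_def powr_powr)
      finally show ?thesis by (simp add: algebra_simps)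
    qed
    note le = this
    show "\<bar>v x - v y\<bar> powr p \<le> ?C powr p * (M * (LINT x:Q|lebesgue. norm (G x) powr p))"
      unfolding I_def[symmetric]
    proof (rule field_le_epsilon)
      fix e :: real assume e: "0 < e"
      define \<delta> where "\<delta> = e / (?C powr p + 1)"
      have pos: "0 < ?C powr p + 1" by (simp add: add_nonneg_pos)
      have "?C powr p * \<delta> \<le> (?C powr p + 1) * \<delta>"
        using e pos by (intro mult_right_mono) (auto simp: \<delta>_def)
      also have "\<dots> = e" using pos by (simp add: \<delta>_def)
      finally show "\<bar>v x - v y\<bar> powr p \<le> ?C powr p * I + e"
        using le[of \<delta>] e pos by (simp add: \<delta>_def)
    qed
  qed
qed

section \<open>Two-dimensional Hausdorff measure of plane sets\<close>

text \<open>A cover of small mesh is also a cover for every larger \<delta>, so meshes up to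
  \<epsilon>0 suffice; the finite cover is padded with empty sets, whose gauge is 0.\<close>

lemma hausdorff_outer_le_of_covers:
  fixes A :: "'a::metric_space set"
  assumes \<epsilon>0: "0 < \<epsilon>0"
    and cov: "\<And>\<epsilon>. 0 < \<epsilon> \<Longrightarrow> \<epsilon> \<le> \<epsilon>0 \<Longrightarrow> \<exists>N U. A \<subseteq> (\<Union>k<N. U k) \<and>
      (\<forall>k<N. bounded (U k) \<and> diameter (U k) \<le> \<epsilon>) \<and> real N * \<epsilon> ^ s \<le> C"
  shows "hausdorff_outer s A \<le> ennreal (unit_ball_vol (real s) * C)"
  unfolding hausdorff_outer_def
proof (rule SUP_least)
  fix \<delta> :: real assume "\<delta> \<in> {0<..}"
  define \<epsilon> where "\<epsilon> = min \<delta> \<epsilon>0"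
  have \<epsilon>: "0 < \<epsilon>" "\<epsilon> \<le> \<epsilon>0" "\<epsilon> \<le> \<delta>" using \<open>\<delta> \<in> {0<..}\<close> \<epsilon>0 by (auto simp: \<epsilon>_def)
  obtain N and U :: "nat \<Rightarrow> 'a set" where U: "A \<subseteq> (\<Union>k<N. U k)" "\<And>k. k < N \<Longrightarrow> bounded (U k)"
    "\<And>k. k < N \<Longrightarrow> diameter (U k) \<le> \<epsilon>" "real N * \<epsilon> ^ s \<le> C"
    using cov[OF \<epsilon>(1,2)] by auto
  define V where "V k = (if k < N then U k else {})" for k
  have "hausdorff_cover \<delta> A V"
    using U \<epsilon> unfolding hausdorff_cover_def V_def by (fastforce split: if_splits)
  then have "hausdorff_pre s \<delta> A \<le> (\<Sum>n. hausdorff_gauge s (V n))"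
    unfolding hausdorff_pre_def by (intro INF_lower) auto
  also have "\<dots> = (\<Sum>n<N. hausdorff_gauge s (V n))"
    by (rule suminf_finite) (auto simp: V_def hausdorff_gauge_def)
  also have "\<dots> \<le> (\<Sum>n<N. ennreal (unit_ball_vol (real s) * \<epsilon> ^ s))"
  proof (rule sum_mono)
    fix n assume n: "n \<in> {..<N}"
    have d0: "0 \<le> diameter (U n)" using U(2) n by (intro diameter_ge_0) auto
    have "diameter (U n) / 2 \<le> \<epsilon>" using U(3)[of n] d0 n by simp
    then have "(diameter (U n) / 2) ^ s \<le> \<epsilon> ^ s" using d0 by (intro power_mono) auto
    then show "hausdorff_gauge s (V n) \<le> ennreal (unit_ball_vol (real s) * \<epsilon> ^ s)"
      using n by (auto simp: hausdorff_gauge_def V_def intro!: ennreal_leI mult_left_mono)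
  qed
  also have "\<dots> = ennreal (unit_ball_vol (real s) * (real N * \<epsilon> ^ s))"
    using \<epsilon> by (simp add: ennreal_of_nat_eq_real_of_nat ennreal_mult[symmetric] mult.left_commute)
  also have "\<dots> \<le> ennreal (unit_ball_vol (real s) * C)"
    using U(4) by (intro ennreal_leI mult_left_mono) auto
  finally show "hausdorff_pre s \<delta> A \<le> ennreal (unit_ball_vol (real s) * C)" .
qed

definition parallelogram :: "'a::real_vector \<Rightarrow> 'a \<Rightarrow> 'a \<Rightarrow> 'a set" where
  "parallelogram p v w = (\<lambda>(s, t). p + s *\<^sub>R v + t *\<^sub>R w) ` ({0..1} \<times> {0..1})"

text \<open>A grid of about 2a/\<epsilon> by 2b/\<epsilon> cells has cells of diameter at most
  \<epsilon>, and rounding up costs at most a factor 2 in each direction, whence 4a times 4b. Only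
  the lengths of the sides enter, which suits the slanted walls of the tubes.\<close>

lemma hausdorff_outer_parallelogram:
  fixes p v w :: "'a::real_normed_vector"
  assumes "norm v \<le> a" "norm w \<le> b" "0 < a" "0 < b"
  shows "hausdorff_outer 2 (parallelogram p v w) \<le> ennreal (unit_ball_vol 2 * (16 * a * b))"
proof -
  have "hausdorff_outer 2 (parallelogram p v w) \<le> ennreal (unit_ball_vol (real 2) * (16 * a * b))"
  proof (rule hausdorff_outer_le_of_covers[of "min a b"])
    show "0 < min a b" using assms by simp
    fix \<epsilon> :: real assume \<epsilon>: "0 < \<epsilon>" "\<epsilon> \<le> min a b"
    define n where "n = nat \<lceil>2 * a / \<epsilon>\<rceil>"
    define m where "m = nat \<lceil>2 * b / \<epsilon>\<rceil>"
    have nm: "0 < n" "0 < m" using assms \<epsilon> by (auto simp: n_def m_def)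
    have n: "2 * a / \<epsilon> \<le> real n" "real n \<le> 2 * a / \<epsilon> + 1"
      and m: "2 * b / \<epsilon> \<le> real m" "real m \<le> 2 * b / \<epsilon> + 1"
      using assms \<epsilon> unfolding n_def m_def by (auto simp: of_nat_ceiling ceiling_correct intro!: of_nat_ceiling)
    define cell where "cell i j = (\<lambda>(s, t). p + s *\<^sub>R v + t *\<^sub>R w) `
      ({real i / n..(real i + 1) / n} \<times> {real j / m..(real j + 1) / m})" for i j
    have small: "dist x y \<le> \<epsilon>" if xy: "x \<in> cell i j" "y \<in> cell i j" for x y i j
    proof -
      obtain s t s' t' where s: "x = p + s *\<^sub>R v + t *\<^sub>R w" "y = p + s' *\<^sub>R v + t' *\<^sub>R w"
        "real i / n \<le> s" "s \<le> (real i + 1) / n" "real j / m \<le> t" "t \<le> (real j + 1) / m"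
        "real i / n \<le> s'" "s' \<le> (real i + 1) / n" "real j / m \<le> t'" "t' \<le> (real j + 1) / m"
        using xy by (auto simp: cell_def)
      have d: "\<bar>s - s'\<bar> \<le> 1 / n" "\<bar>t - t'\<bar> \<le> 1 / m"
        using s by (auto simp: add_divide_distrib abs_le_iff)
      have "x - y = (s - s') *\<^sub>R v + (t - t') *\<^sub>R w" using s by (simp add: algebra_simps)
      then have "dist x y \<le> \<bar>s - s'\<bar> * norm v + \<bar>t - t'\<bar> * norm w"
        by (metis dist_norm norm_scaleR norm_triangle_ineq)
      also have "\<dots> \<le> 1 / n * a + 1 / m * b"
        using d assms by (intro add_mono mult_mono) auto
      also have "\<dots> \<le> \<epsilon> / 2 + \<epsilon> / 2"
        using n(1) m(1) nm \<epsilon> by (intro add_mono) (auto simp: field_simps)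
      finally show ?thesis by simp
    qed
    show "\<exists>N U. parallelogram p v w \<subseteq> (\<Union>k<N. U k) \<and>
        (\<forall>k<N. bounded (U k) \<and> diameter (U k) \<le> \<epsilon>) \<and> real N * \<epsilon> ^ 2 \<le> 16 * a * b"
    proof (intro exI conjI allI impI)
      let ?U = "\<lambda>k. cell (k div m) (k mod m)"
      show "parallelogram p v w \<subseteq> (\<Union>k<n * m. ?U k)"
      proof
        fix x assume "x \<in> parallelogram p v w"
        then obtain s t where st: "x = p + s *\<^sub>R v + t *\<^sub>R w" "0 \<le> s" "s \<le> 1" "0 \<le> t" "t \<le> 1"
          by (auto simp: parallelogram_def)
        have ex: "\<exists>i<q. real i / q \<le> s \<and> s \<le> (real i + 1) / q" if "0 \<le> s" "s \<le> 1" "0 < q" for s :: real and q :: nat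
        proof (cases "s = 1")
          case True
          then show ?thesis using that by (intro exI[of _ "q - 1"]) (auto simp: field_simps of_nat_diff)
        next
          case False
          define i where "i = nat \<lfloor>s * q\<rfloor>"
          have i: "real i \<le> s * q" "s * q \<le> real i + 1"
            using that by (auto simp: i_def)
          have "s * q < q" using that False by simp
          then have "i < q" using i by linarith
          then show ?thesis using i that by (intro exI[of _ i]) (auto simp: field_simps)
        qed
        obtain i where i: "i < n" "real i / n \<le> s" "s \<le> (real i + 1) / n" using ex[OF st(2,3) nm(1)] by blast
        obtain j where j: "j < m" "real j / m \<le> t" "t \<le> (real j + 1) / m" using ex[OF st(4,5) nm(2)] by blast
        have "x \<in> cell i j"
          unfolding cell_def using st i j by (intro image_eqI[of _ _ "(s, t)"]) auto
        moreover have "i * m + j < n * m"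
        proof -
          have "i * m + j < (i + 1) * m" using j by simp
          also have "\<dots> \<le> n * m" using i by (intro mult_le_mono1) simp
          finally show ?thesis .
        qed
        ultimately show "x \<in> (\<Union>k<n * m. ?U k)" using j by (intro UN_I[of "i * m + j"]) auto
      qed
      fix k
      show "bounded (?U k)"
        unfolding bounded_two_points using small by blast
      show "diameter (?U k) \<le> \<epsilon>"
        using small \<epsilon> by (intro diameter_le) (auto simp: dist_norm)
    next
      have "real n * \<epsilon> \<le> 4 * a" "real m * \<epsilon> \<le> 4 * b"
        using mult_right_mono[OF n(2), of \<epsilon>] mult_right_mono[OF m(2), of \<epsilon>] \<epsilon> assms
        by (auto simp: distrib_right)
      then have "(real n * \<epsilon>) * (real m * \<epsilon>) \<le> (4 * a) * (4 * b)"
        by (rule mult_mono) (use \<epsilon> assms in auto)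
      then show "real (n * m) * \<epsilon> ^ 2 \<le> 16 * a * b"
        by (simp add: power2_eq_square algebra_simps)
    qed
  qed
  then show ?thesis by simp
qed

section \<open>Positive area of the unit square in the bottom plane\<close>

lemma emeasure_lborel_cbox_3:
  fixes a b :: "real^3"
  assumes "\<And>i. a $ i \<le> b $ i"
  shows "emeasure lborel (cbox a b) = ennreal ((b $ 1 - a $ 1) * (b $ 2 - a $ 2) * (b $ 3 - a $ 3))"
proof -
  have ne: "cbox a b \<noteq> {}" using assms by (simp add: interval_ne_empty_cart)
  have "emeasure lborel (cbox a b) = ennreal (measure lborel (cbox a b))"
    using emeasure_lborel_cbox_finite[of a b] by (intro emeasure_eq_ennreal_measure) auto
  also have "measure lborel (cbox a b) = (\<Prod>i\<in>UNIV. b $ i - a $ i)"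
    using content_cbox_cart[OF ne] .
  also have "\<dots> = (b $ 1 - a $ 1) * (b $ 2 - a $ 2) * (b $ 3 - a $ 3)"
    unfolding UNIV_3 by simp
  finally show ?thesis .
qed

definition floor_square :: "(real^3) set" where
  "floor_square = {x. x $ 1 \<in> {0..1} \<and> x $ 2 \<in> {0..1} \<and> x $ 3 = 0}"

text \<open>Comparison with volume: a covering set of diameter d projects into a square of side 2 d.
  The boxes of height 1 on these squares cover the unit cube, and their volumes 4 d^2 are at most 16
  times the gauge pi d^2 / 4; so the gauges sum to at least 1/16.\<close>

lemma hausdorff_outer_floor_square: "0 < hausdorff_outer 2 floor_square"
proof -
  have "1 / 16 \<le> hausdorff_pre 2 1 floor_square"
    unfolding hausdorff_pre_def
  proof (rule INF_greatest)
    fix U :: "nat \<Rightarrow> (real^3) set" assume "U \<in> {U. hausdorff_cover 1 floor_square U}"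
    then have U: "\<And>n. bounded (U n)" "floor_square \<subseteq> (\<Union>n. U n)" by (auto simp: hausdorff_cover_def)
    define d where "d n = diameter (U n)" for n
    have d: "0 \<le> d n" for n using U by (simp add: d_def diameter_ge_0)
    define y where "y n = (SOME y. y \<in> U n)" for n
    have y: "\<bar>x $ i - y n $ i\<bar> \<le> d n" if "x \<in> U n" for x n i
    proof -
      have "y n \<in> U n" unfolding y_def using that by (rule someI)
      then have "dist x (y n) \<le> d n" unfolding d_def using U that by (intro diameter_bounded_bound)
      then show ?thesis using component_le_norm_cart[of "x - y n" i] by (simp add: dist_norm)
    qed
    define B where "B n = (if U n = {} then {} else
      cbox (vector [y n $ 1 - d n, y n $ 2 - d n, 0]) (vector [y n $ 1 + d n, y n $ 2 + d n, 1] :: real^3))" for n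
    have Bm: "emeasure lborel (B n) \<le> 16 * hausdorff_gauge 2 (U n)" for n
    proof (cases "U n = {}")
      case False
      have "emeasure lborel (B n) = ennreal (2 * d n * (2 * d n))"
      proof -
        have "vector [y n $ 1 - d n, y n $ 2 - d n, 0] $ i \<le> (vector [y n $ 1 + d n, y n $ 2 + d n, 1] :: real^3) $ i" for i
          using exhaust_3[of i] d[of n] by auto
        then show ?thesis using False by (simp add: B_def emeasure_lborel_cbox_3)
      qed
      also have "\<dots> \<le> ennreal (16 * (pi * (d n / 2) ^ 2))"
        using pi_ge_two d[of n] mult_mono[of 1 pi "d n * d n" "d n * d n"]
        by (intro ennreal_leI) (simp add: power2_eq_square)
      also have "\<dots> = 16 * hausdorff_gauge 2 (U n)"
        using False d[of n] by (simp add: hausdorff_gauge_def d_def ennreal_mult unit_ball_vol_2)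
      finally show ?thesis .
    qed (simp add: B_def)
    have "cbox (vector [0, 0, 0]) (vector [1, 1, 1]) \<subseteq> (\<Union>n. B n)"
    proof
      fix x :: "real^3" assume "x \<in> cbox (vector [0, 0, 0]) (vector [1, 1, 1])"
      then have x: "0 \<le> x $ 1" "x $ 1 \<le> 1" "0 \<le> x $ 2" "x $ 2 \<le> 1" "0 \<le> x $ 3" "x $ 3 \<le> 1"
        by (auto simp: mem_box_cart forall_3)
      then have "vector [x $ 1, x $ 2, 0] \<in> floor_square" by (simp add: floor_square_def)
      then obtain n where n: "vector [x $ 1, x $ 2, 0] \<in> U n" using U(2) by blast
      have "x \<in> B n"
        using y[OF n, of 1] y[OF n, of 2] n x by (auto simp: B_def mem_box_cart forall_3)
      then show "x \<in> (\<Union>n. B n)" by blast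
    qed
    then have "emeasure lborel (cbox (vector [0, 0, 0]) (vector [1, 1, 1]) :: (real^3) set) \<le> emeasure lborel (\<Union>n. B n)"
      by (rule emeasure_mono) (auto simp: B_def)
    also have "\<dots> \<le> (\<Sum>n. emeasure lborel (B n))"
      by (rule emeasure_subadditive_countably) (auto simp: B_def)
    also have "\<dots> \<le> (\<Sum>n. 16 * hausdorff_gauge 2 (U n))"
      by (intro suminf_le Bm) auto
    finally have "1 \<le> 16 * (\<Sum>n. hausdorff_gauge 2 (U n))"
    proof (subst (asm) emeasure_lborel_cbox_3)
      show "vector [0, 0, 0] $ i \<le> (vector [1, 1, 1] :: real^3) $ i" for i using exhaust_3[of i] by auto
    qed simp
    then have "(1 / 16) * 1 \<le> (1 / 16) * (16 * (\<Sum>n. hausdorff_gauge 2 (U n)))"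
      by (rule mult_left_mono) simp
    also have "\<dots> = (\<Sum>n. hausdorff_gauge 2 (U n))"
    proof -
      have "(1 / 16) * 16 = (1 :: ennreal)"
        by (simp add: ennreal_divide_times)
      then show ?thesis by (simp only: mult.assoc[symmetric]) simp
    qed
    finally show "1 / 16 \<le> (\<Sum>n. hausdorff_gauge 2 (U n))" by simp
  qed
  also have "\<dots> \<le> hausdorff_outer 2 floor_square" by (rule hausdorff_pre_le_outer) simp
  finally show ?thesis by (rule less_le_trans[rotated]) (simp add: divide_ennreal_def ennreal_inverse_positive)
qed

lemma hausdorff_outer_UN_finite:
  "finite I \<Longrightarrow> hausdorff_outer s (\<Union>i\<in>I. A i) \<le> (\<Sum>i\<in>I. hausdorff_outer s (A i))"
proof (induction I rule: finite_induct)
  case (insert i I)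
  have "hausdorff_outer s (\<Union>i\<in>insert i I. A i) \<le> hausdorff_outer s (A i) + hausdorff_outer s (\<Union>i\<in>I. A i)"
    using hausdorff_outer_Un by simp
  also have "\<dots> \<le> hausdorff_outer s (A i) + (\<Sum>i\<in>I. hausdorff_outer s (A i))"
    by (rule add_left_mono) (rule insert)
  finally show ?case using insert by simp
qed (simp add: hausdorff_outer_empty)

section \<open>The tree of tubes\<close>

definition ht :: "nat \<Rightarrow> real" where "ht k = (1 / 2) ^ k"
text \<open>The factor 1/8 makes the radius at most \<open>ht k / 8\<close> even at level 0, which
  is enough to keep tubes with different parents apart.\<close>

definition rad :: "nat \<Rightarrow> real" where "rad k = ht k ^ 8 / 8"

text \<open>Descending by \<open>ht (Suc k)\<close> at slope 1/2 shifts an axis by a quarter of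
  \<open>ht k\<close>: even indices go to the midpoint of the left half of the parent's dyadic
  interval, odd ones to that of the right half.\<close>

definition slope :: "nat \<Rightarrow> real" where "slope i = (if even i then 1 / 2 else - 1 / 2)"
definition centre :: "nat \<Rightarrow> nat \<Rightarrow> real" where "centre k i = (real i + 1 / 2) * ht k"
definition line :: "nat \<Rightarrow> nat \<Rightarrow> real \<Rightarrow> real" where
  "line k i z = centre k i + slope i * (z - ht k)"

text \<open>The axis of \<open>tube (k + 1) i j\<close> starts, at height \<open>ht k\<close>, at the lower end of the axis of
  its parent \<open>tube k (i div 2) (j div 2)\<close>.\<close>

definition tube :: "nat \<Rightarrow> nat \<Rightarrow> nat \<Rightarrow> (real^3) set" where
  "tube k i j = {v. ht k < v $ 3 \<and> v $ 3 < 2 * ht k + rad k \<and>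
    \<bar>v $ 1 - line k i (v $ 3)\<bar> < rad k \<and> \<bar>v $ 2 - line k j (v $ 3)\<bar> < rad k}"

definition ctube :: "nat \<Rightarrow> nat \<Rightarrow> nat \<Rightarrow> (real^3) set" where
  "ctube k i j = {v. ht k \<le> v $ 3 \<and> v $ 3 \<le> 2 * ht k + rad k \<and>
    \<bar>v $ 1 - line k i (v $ 3)\<bar> \<le> rad k \<and> \<bar>v $ 2 - line k j (v $ 3)\<bar> \<le> rad k}"

lemma ht_pos: "0 < ht k" and ht_le_1: "ht k \<le> 1" and ht_Suc: "ht (Suc k) = ht k / 2" and ht_0: "ht 0 = 1"
  by (auto simp: ht_def power_le_one)

lemma rad_pos: "0 < rad k"
  using ht_pos[of k] by (simp add: rad_def)

lemma rad_Suc: "rad (Suc k) = rad k / 256"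
  by (simp add: rad_def ht_Suc power_divide)

lemma rad_le: "rad k \<le> ht k / 8"
proof -
  have "ht k ^ 8 \<le> ht k ^ 1" using ht_pos[of k] ht_le_1 by (intro power_decreasing) auto
  then show ?thesis by (simp add: rad_def)
qed

lemma ht_antimono: "k \<le> l \<Longrightarrow> ht l \<le> ht k"
  by (simp add: ht_def power_decreasing)

lemma slope_bound: "\<bar>slope i\<bar> = 1 / 2"
  by (simp add: slope_def)

lemma centre_Suc: "centre (Suc k) i = centre k (i div 2) - slope i * ht (Suc k)"
  by (cases "even i") (auto elim!: evenE oddE simp: centre_def slope_def ht_Suc algebra_simps add_divide_distrib)

lemma line_Suc: "line (Suc k) i z = centre k (i div 2) + slope i * (z - ht k)"
  by (simp add: line_def centre_Suc ht_Suc algebra_simps)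

lemma line_near: "\<bar>line k i z - centre k i\<bar> = \<bar>z - ht k\<bar> / 2"
  by (simp add: line_def abs_mult slope_bound)

lemma line_Suc_near: "\<bar>line (Suc k) i z - centre k (i div 2)\<bar> = \<bar>z - ht k\<bar> / 2"
  by (simp add: line_Suc abs_mult slope_bound)

lemma centre_separated: "i \<noteq> j \<Longrightarrow> ht k \<le> \<bar>centre k i - centre k j\<bar>"
proof -
  assume "i \<noteq> j"
  then have "1 \<le> \<bar>real i - real j\<bar>" by linarith
  then have "1 * ht k \<le> \<bar>real i - real j\<bar> * ht k" using ht_pos[of k] by (intro mult_right_mono) auto
  also have "\<dots> = \<bar>(real i - real j) * ht k\<bar>" using ht_pos[of k] by (simp add: abs_mult)
  also have "(real i - real j) * ht k = centre k i - centre k j" by (simp add: centre_def algebra_simps)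
  finally show ?thesis by simp
qed

section \<open>Shape of a single tube\<close>

lemma tube_halfspaces:
  "tube k i j = {v. (axis 3 1 :: real^3) \<bullet> v > ht k} \<inter> {v. (axis 3 1 :: real^3) \<bullet> v < 2 * ht k + rad k} \<inter>
    {v. (axis 1 1 - slope i *\<^sub>R axis 3 1 :: real^3) \<bullet> v < line k i 0 + rad k} \<inter>
    {v. (axis 1 1 - slope i *\<^sub>R axis 3 1 :: real^3) \<bullet> v > line k i 0 - rad k} \<inter>
    {v. (axis 2 1 - slope j *\<^sub>R axis 3 1 :: real^3) \<bullet> v < line k j 0 + rad k} \<inter>
    {v. (axis 2 1 - slope j *\<^sub>R axis 3 1 :: real^3) \<bullet> v > line k j 0 - rad k}"
  by (auto simp: tube_def line_def inner_diff_left inner_axis' abs_less_iff algebra_simps)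

lemma ctube_halfspaces:
  "ctube k i j = {v. (axis 3 1 :: real^3) \<bullet> v \<ge> ht k} \<inter> {v. (axis 3 1 :: real^3) \<bullet> v \<le> 2 * ht k + rad k} \<inter>
    {v. (axis 1 1 - slope i *\<^sub>R axis 3 1 :: real^3) \<bullet> v \<le> line k i 0 + rad k} \<inter>
    {v. (axis 1 1 - slope i *\<^sub>R axis 3 1 :: real^3) \<bullet> v \<ge> line k i 0 - rad k} \<inter>
    {v. (axis 2 1 - slope j *\<^sub>R axis 3 1 :: real^3) \<bullet> v \<le> line k j 0 + rad k} \<inter>
    {v. (axis 2 1 - slope j *\<^sub>R axis 3 1 :: real^3) \<bullet> v \<ge> line k j 0 - rad k}"
  by (auto simp: ctube_def line_def inner_diff_left inner_axis' abs_le_iff algebra_simps)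

lemma open_tube: "open (tube k i j)"
  unfolding tube_halfspaces by (intro open_Int open_halfspace_lt open_halfspace_gt)

lemma convex_tube: "convex (tube k i j)"
  unfolding tube_halfspaces by (intro convex_Int convex_halfspace_lt convex_halfspace_gt)

lemma closed_ctube: "closed (ctube k i j)"
  unfolding ctube_halfspaces by (intro closed_Int closed_halfspace_le closed_halfspace_ge)

lemma tube_subset_ctube: "tube k i j \<subseteq> ctube k i j"
  by (auto simp: tube_def ctube_def)

lemma closure_tube: "closure (tube k i j) \<subseteq> ctube k i j"
  by (rule closure_minimal[OF tube_subset_ctube closed_ctube])

lemma norm_le_sum_3: "norm (v :: real^3) \<le> \<bar>v $ 1\<bar> + \<bar>v $ 2\<bar> + \<bar>v $ 3\<bar>"
  using norm_le_l1_cart[of v] by (simp add: sum_3)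

lemma ctube_diameter:
  assumes "v \<in> ctube k i j" "w \<in> ctube k i j"
  shows "norm (v - w) \<le> 3 * ht k"
proof -
  have z: "\<bar>v $ 3 - w $ 3\<bar> \<le> ht k + rad k"
    using assms by (auto simp: ctube_def abs_le_iff)
  have xy: "\<bar>v $ n - w $ n\<bar> \<le> 2 * rad k + \<bar>v $ 3 - w $ 3\<bar> / 2"
    if "\<bar>v $ n - line k l (v $ 3)\<bar> \<le> rad k" "\<bar>w $ n - line k l (w $ 3)\<bar> \<le> rad k" for n l
  proof -
    have "\<bar>line k l (v $ 3) - line k l (w $ 3)\<bar> = \<bar>slope l * (v $ 3 - w $ 3)\<bar>"
      by (simp add: line_def algebra_simps)
    then have "\<bar>line k l (v $ 3) - line k l (w $ 3)\<bar> = \<bar>v $ 3 - w $ 3\<bar> / 2"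
      by (simp add: abs_mult slope_bound)
    then show ?thesis using that by linarith
  qed
  have "norm (v - w) \<le> \<bar>v $ 1 - w $ 1\<bar> + \<bar>v $ 2 - w $ 2\<bar> + \<bar>v $ 3 - w $ 3\<bar>"
    using norm_le_sum_3[of "v - w"] by simp
  then show ?thesis
    using xy[of 1 i] xy[of 2 j] z rad_le[of k] ht_pos[of k] assms by (auto simp: ctube_def)
qed

lemma bounded_ctube: "bounded (ctube k i j)"
  unfolding bounded_two_points dist_norm using ctube_diameter by blast

lemma compact_closure_tube: "compact (closure (tube k i j))"
  using bounded_subset[OF bounded_ctube tube_subset_ctube] by (simp add: compact_closure)

text \<open>A common point of a tube and its four children: the children reach up to
  \<open>rad (Suc k)\<close> above the height \<open>ht k\<close> where the parent ends, and the
  node sits in the middle of this overlap.\<close>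

definition node :: "nat \<Rightarrow> nat \<Rightarrow> nat \<Rightarrow> real^3" where
  "node k i j = vector [centre k i, centre k j, ht k + rad (Suc k) / 2]"

lemma node_in_tube: "node k i j \<in> tube k i j"
  using line_near[of k i "ht k + rad (Suc k) / 2"] line_near[of k j "ht k + rad (Suc k) / 2"]
    rad_pos[of k] ht_pos[of k] rad_le[of k]
  by (auto simp: node_def tube_def rad_Suc abs_minus_commute)

lemma node_in_child: "node k (i div 2) (j div 2) \<in> tube (Suc k) i j"
  using line_Suc_near[of k i "ht k + rad (Suc k) / 2"] line_Suc_near[of k j "ht k + rad (Suc k) / 2"]
    rad_pos[of "Suc k"] ht_pos[of k]
  by (auto simp: node_def tube_def ht_Suc abs_minus_commute)

section \<open>Which tubes can touch\<close>

lemma abs_diff_chain: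
  fixes c c' x l l' :: real
  assumes "H \<le> \<bar>c - c'\<bar>" "\<bar>x - l\<bar> \<le> r" "\<bar>x - l'\<bar> \<le> r'" "\<bar>l - c\<bar> = d" "\<bar>l' - c'\<bar> = d'"
  shows "H \<le> r + r' + d + d'"
  using assms by linarith

text \<open>At heights of level \<open>Suc k\<close> an axis is within a quarter of
  \<open>ht k\<close> of its parent's centre, and the radii are at most a sixteenth of
  \<open>ht k\<close>. Distinct parents have centres at least \<open>ht k\<close> apart, which is
  more than all of these together.\<close>

lemma tube_same_parent:
  assumes "\<bar>x - line (Suc k) i z\<bar> \<le> rad (Suc k)" "\<bar>x - line (Suc k) i' z\<bar> \<le> rad (Suc k)"
    and "ht (Suc k) \<le> z" "z \<le> 2 * ht (Suc k) + rad (Suc k)"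
  shows "i div 2 = i' div 2"
proof (rule ccontr)
  assume "i div 2 \<noteq> i' div 2"
  from centre_separated[OF this, of k]
  have "ht k \<le> \<bar>centre k (i div 2) - centre k (i' div 2)\<bar>" .
  moreover have "\<bar>z - ht k\<bar> \<le> ht k / 2"
    using assms(3,4) rad_le[of "Suc k"] ht_pos[of k] unfolding ht_Suc by linarith
  ultimately show False
    using abs_diff_chain[OF _ assms(1,2) line_Suc_near line_Suc_near] rad_le[of "Suc k"] ht_pos[of k]
    by (fastforce simp: ht_Suc)
qed

lemma tube_parent_child:
  assumes "\<bar>x - line k i z\<bar> \<le> rad k" "\<bar>x - line (Suc k) i' z\<bar> \<le> rad (Suc k)"
    and "ht k \<le> z" "z \<le> 2 * ht (Suc k) + rad (Suc k)"
  shows "i = i' div 2"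
proof (rule ccontr)
  assume "i \<noteq> i' div 2"
  from centre_separated[OF this, of k]
  have "ht k \<le> \<bar>centre k i - centre k (i' div 2)\<bar>" .
  moreover have "\<bar>z - ht k\<bar> \<le> rad (Suc k)"
    using assms(3,4) rad_pos[of "Suc k"] unfolding ht_Suc by linarith
  ultimately show False
    using abs_diff_chain[OF _ assms(1,2) line_near line_Suc_near] rad_le[of k] rad_Suc[of k] ht_pos[of k]
    by fastforce
qed

lemma strips_adjacent:
  assumes "ht k \<le> z" "z \<le> 2 * ht k' + rad k'"
  shows "k' \<le> Suc k"
proof (rule ccontr)
  assume "\<not> k' \<le> Suc k"
  then have "ht k' \<le> ht (k + 2)" by (intro ht_antimono) simp
  also have "\<dots> = ht k / 4" by (simp add: ht_def)
  finally show False using assms rad_le[of k'] ht_pos[of k] by linarith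
qed

text \<open>Heights admit only equal or consecutive levels. Horizontal separation then leaves parent
  and child, two children of one parent, or the single tube of level 0, and in each case a node lies
  in both open tubes. So closed tubes never touch along their walls alone, and functions on them can
  be compared on an open set.\<close>

lemma tubes_meet:
  assumes v: "v \<in> ctube k i j" "v \<in> ctube k' i' j'"
    and idx: "i < 2 ^ k" "j < 2 ^ k" "i' < 2 ^ k'" "j' < 2 ^ k'"
  shows "tube k i j \<inter> tube k' i' j' \<noteq> {}"
proof -
  have *: "tube k i j \<inter> tube k' i' j' \<noteq> {}"
    if v: "v \<in> ctube k i j" "v \<in> ctube k' i' j'" and le: "k \<le> k'"
      and idx: "i < 2 ^ k" "j < 2 ^ k" "i' < 2 ^ k'" "j' < 2 ^ k'" for k i j k' i' j'
  proof -
    have "k' \<le> Suc k"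
      using v by (intro strips_adjacent[of k "v $ 3" k']) (auto simp: ctube_def)
    then consider "k' = Suc k" | "k' = k" "k = 0" | l where "k' = k" "k = Suc l"
      using le by (metis le_SucE le_antisym not0_implies_Suc)
    then show ?thesis
    proof cases
      case 1
      have "i = i' div 2" "j = j' div 2"
        using v 1 tube_parent_child[of "v $ 1" k i "v $ 3" i'] tube_parent_child[of "v $ 2" k j "v $ 3" j']
        by (auto simp: ctube_def)
      then show ?thesis using node_in_tube[of k i j] node_in_child[of k i' j'] 1 by auto
    next
      case 2
      then show ?thesis using idx node_in_tube[of 0 0 0] by auto
    next
      case 3
      have "i div 2 = i' div 2" "j div 2 = j' div 2"
        using v 3 tube_same_parent[of "v $ 1" l i "v $ 3" i'] tube_same_parent[of "v $ 2" l j "v $ 3" j']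
        by (auto simp: ctube_def)
      then show ?thesis using node_in_child[of l i j] node_in_child[of l i' j'] 3 by auto
    qed
  qed
  show ?thesis
    using *[OF v] *[OF v(2,1)] idx by (cases "k \<le> k'") (auto simp: Int_commute)
qed

section \<open>The tree, its closure and its frontier\<close>

definition levels :: "(nat \<times> nat \<times> nat) set" where
  "levels = {(k, i, j). i < 2 ^ k \<and> j < 2 ^ k}"

definition level :: "nat \<Rightarrow> (nat \<times> nat \<times> nat) set" where
  "level k = {k} \<times> {..<2 ^ k} \<times> {..<2 ^ k}"

definition tb :: "nat \<times> nat \<times> nat \<Rightarrow> (real^3) set" where
  "tb = (\<lambda>(k, i, j). tube k i j)"

definition tree :: "(real^3) set" where
  "tree = (\<Union>w\<in>levels. tb w)"

lemma finite_level: "finite (level k)"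
  by (simp add: level_def)

text \<open>A point lies in tubes of at most two consecutive levels, and within a level at most two
  sibling indices are possible per coordinate; this gives 2 times 2 times 2.\<close>

lemma tube_multiplicity: "finite {w \<in> levels. v \<in> tb w}" "card {w \<in> levels. v \<in> tb w} \<le> 8"
proof -
  let ?S = "{w \<in> levels. v \<in> tb w}"
  define I where "I k x = {i. i < 2 ^ k \<and> \<bar>x - line k i (v $ 3)\<bar> < rad k}" for k x
  have I: "card (I k x) \<le> 2 \<and> finite (I k x)" if k: "ht k < v $ 3" "v $ 3 < 2 * ht k + rad k" for k x
  proof (cases "I k x = {}")
    case False
    then obtain i0 where i0: "i0 \<in> I k x" by blast
    have "I k x \<subseteq> {2 * (i0 div 2), 2 * (i0 div 2) + 1}"
    proof
      fix i assume i: "i \<in> I k x"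
      have "i div 2 = i0 div 2"
      proof (cases k)
        case 0
        then show ?thesis using i i0 by (simp add: I_def)
      next
        case (Suc l)
        then show ?thesis
          using i i0 k by (intro tube_same_parent[of x l i "v $ 3" i0]) (auto simp: I_def)
      qed
      then show "i \<in> {2 * (i0 div 2), 2 * (i0 div 2) + 1}" by auto
    qed
    then show ?thesis
      using card_mono[of "{2 * (i0 div 2), 2 * (i0 div 2) + 1}" "I k x"] finite_subset by auto
  qed simp
  have fin_card: "finite ?S \<and> card ?S \<le> 8"
  proof (cases "?S = {}")
    case False
    define k0 where "k0 = (LEAST k. \<exists>i j. (k, i, j) \<in> ?S)"
    have ex: "\<exists>k i j. (k, i, j) \<in> ?S" using False by (metis ex_in_conv prod_cases3)
    obtain i0 j0 where w0: "(k0, i0, j0) \<in> ?S"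
      unfolding k0_def using LeastI_ex[OF ex] by blast
    define A where "A k = {w \<in> ?S. fst w = k}" for k
    have A: "finite (A k) \<and> card (A k) \<le> 4" for k
    proof (cases "A k = {}")
      case False
      then have k: "ht k < v $ 3" "v $ 3 < 2 * ht k + rad k"
        by (auto simp: A_def tb_def tube_def)
      have sub: "A k \<subseteq> {k} \<times> I k (v $ 1) \<times> I k (v $ 2)"
        by (auto simp: A_def tb_def tube_def I_def levels_def)
      have fin: "finite ({k} \<times> I k (v $ 1) \<times> I k (v $ 2))" using I[OF k] by auto
      have "card (A k) \<le> card (I k (v $ 1)) * card (I k (v $ 2))"
        using card_mono[OF fin sub] by (simp add: card_cartesian_product)
      also have "\<dots> \<le> 2 * 2" using I[OF k] by (intro mult_le_mono) auto
      finally show ?thesis using finite_subset[OF sub fin] by simp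
    qed simp
    have "?S \<subseteq> A k0 \<union> A (Suc k0)"
    proof
      fix w assume w: "w \<in> ?S"
      obtain k i j where [simp]: "w = (k, i, j)" by (cases w)
      have "k0 \<le> k" unfolding k0_def using w by (intro Least_le) auto
      moreover have "k \<le> Suc k0"
        using w w0 by (intro strips_adjacent[of k0 "v $ 3" k]) (auto simp: tb_def tube_def)
      ultimately show "w \<in> A k0 \<union> A (Suc k0)" using w by (auto simp: A_def)
    qed
    moreover have "finite (A k0 \<union> A (Suc k0))" "card (A k0 \<union> A (Suc k0)) \<le> 8"
      using A[of k0] A[of "Suc k0"] card_Un_le[of "A k0" "A (Suc k0)"] by auto
    ultimately show ?thesis by (meson card_mono finite_subset le_trans)
  next
    case True
    show ?thesis unfolding True by simp
  qed
  then show "finite ?S" "card ?S \<le> 8" by auto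
qed

lemma open_tree: "open tree"
  unfolding tree_def by (intro open_UN ballI) (auto simp: tb_def open_tube)

lemma tree_nonempty: "tree \<noteq> {}"
  using node_in_tube[of 0 0 0] by (force simp: tree_def levels_def tb_def)

text \<open>Each tube is convex and meets its parent in a node, so every point is joined to the root
  by climbing the levels.\<close>

lemma connected_tree: "connected tree"
proof -
  have sub: "tube k i j \<subseteq> tree" if "i < 2 ^ k" "j < 2 ^ k" for k i j
    using that by (force simp: tree_def levels_def tb_def)
  have same: "connected_component tree x y"
    if "x \<in> tube k i j" "y \<in> tube k i j" "i < 2 ^ k" "j < 2 ^ k" for x y k i j
    using that sub[OF that(3,4)] convex_connected[OF convex_tube]
    unfolding connected_component_def by blast
  have "connected_component tree x (node 0 0 0)"
    if "x \<in> tube k i j" "i < 2 ^ k" "j < 2 ^ k" for x k i j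
    using that
  proof (induction k arbitrary: x i j)
    case 0
    then show ?case using same[of x 0 0 0 "node 0 0 0"] node_in_tube[of 0 0 0] by simp
  next
    case (Suc k)
    have "connected_component tree x (node k (i div 2) (j div 2))"
      using same[OF Suc.prems(1) node_in_child[of k i j]] Suc.prems by simp
    moreover have "connected_component tree (node k (i div 2) (j div 2)) (node 0 0 0)"
      using Suc.prems by (intro Suc.IH[OF node_in_tube]) auto
    ultimately show ?case by (rule connected_component_trans)
  qed
  then have "connected_component tree x (node 0 0 0)" if "x \<in> tree" for x
    using that by (auto simp: tree_def levels_def tb_def)
  then show ?thesis
    unfolding connected_iff_connected_component
    by (meson connected_component_sym connected_component_trans)
qed

lemma tree_third_pos: "v \<in> tree \<Longrightarrow> 0 < v $ 3"
  using ht_pos by (auto simp: tree_def tb_def tube_def intro: less_trans)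

lemma tree_component_bounds:
  assumes "v \<in> tree"
  shows "\<bar>v $ 1\<bar> \<le> 4" "\<bar>v $ 2\<bar> \<le> 4"
proof -
  have b: "\<bar>x\<bar> \<le> 4" if "ht k < z" "z < 2 * ht k + rad k" "\<bar>x - line k i z\<bar> < rad k" "i < 2 ^ k" for x z k i
  proof -
    have "real i < 2 ^ k" using that(4) by (metis of_nat_less_iff of_nat_numeral of_nat_power)
    then have "real i * ht k < 2 ^ k * ht k" using ht_pos[of k] by (rule mult_strict_right_mono)
    also have "\<dots> = 1" by (simp add: ht_def power_mult_distrib[symmetric])
    finally have "0 \<le> centre k i" "centre k i \<le> 1 + ht k / 2"
      using ht_pos[of k] by (auto simp: centre_def distrib_right)
    moreover have "\<bar>z - ht k\<bar> \<le> 2" using that(1,2) rad_le[of k] ht_le_1[of k] by linarith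
    then have "\<bar>line k i z - centre k i\<bar> \<le> 1" using line_near[of k i z] by simp
    ultimately show ?thesis
      using that(3) rad_le[of k] ht_le_1[of k] by linarith
  qed
  show "\<bar>v $ 1\<bar> \<le> 4" "\<bar>v $ 2\<bar> \<le> 4"
    using assms b by (auto simp: tree_def levels_def tb_def tube_def)
qed

text \<open>Tubes of level \<open>k\<close> stay below height 3 \<open>ht k\<close>. Away from the
  floor the tree is therefore a finite union of tubes, where closures and continuity pass to the
  union.\<close>

lemma tubes_above_finite:
  assumes "0 < z0"
  obtains N where "\<And>k i j v. v \<in> ctube k i j \<Longrightarrow> z0 < v $ 3 \<Longrightarrow> k < N"
proof -
  have "(\<lambda>k. 3 * ht k) \<longlonglongrightarrow> 3 * 0"
    unfolding ht_def by (intro tendsto_intros LIMSEQ_power_zero) auto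
  then have "eventually (\<lambda>k. 3 * ht k < z0) sequentially"
    using assms by (intro order_tendstoD) auto
  then obtain N where N: "\<And>k. k \<ge> N \<Longrightarrow> 3 * ht k < z0" by (auto simp: eventually_sequentially)
  show ?thesis
  proof (rule that[of N], rule ccontr)
    fix k i j and v :: "real^3" assume v: "v \<in> ctube k i j" "z0 < v $ 3" "\<not> k < N"
    then have "v $ 3 \<le> 3 * ht k" using rad_le[of k] ht_pos[of k] by (auto simp: ctube_def)
    then show False using N[of k] v by simp
  qed
qed

text \<open>Above half the height of a given point only finitely many tubes occur, so a point at
  positive height lies in the closure of one of them.\<close>

lemma closure_tree:
  "closure tree \<subseteq> (\<Union>w\<in>levels. closure (tb w)) \<union> {v. \<bar>v $ 1\<bar> \<le> 4 \<and> \<bar>v $ 2\<bar> \<le> 4 \<and> v $ 3 = 0}"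
proof
  fix x assume x: "x \<in> closure tree"
  let ?C = "{v :: real^3. \<bar>v $ 1\<bar> \<le> 4 \<and> \<bar>v $ 2\<bar> \<le> 4 \<and> 0 \<le> v $ 3}"
  have "closed ?C"
    by (intro closed_Collect_conj closed_Collect_le continuous_intros)
  then have "closure tree \<subseteq> ?C"
    using tree_component_bounds tree_third_pos by (intro closure_minimal) (auto simp: less_imp_le)
  then have xC: "x \<in> ?C" using x by blast
  show "x \<in> (\<Union>w\<in>levels. closure (tb w)) \<union> {v. \<bar>v $ 1\<bar> \<le> 4 \<and> \<bar>v $ 2\<bar> \<le> 4 \<and> v $ 3 = 0}"
  proof (cases "x $ 3 = 0")
    case False
    then have x3: "0 < x $ 3 / 2" using xC by simp
    obtain N where N: "\<And>k i j v. v \<in> ctube k i j \<Longrightarrow> x $ 3 / 2 < v $ 3 \<Longrightarrow> k < N"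
      using tubes_above_finite[OF x3] by metis
    let ?F = "(\<Union>k<N. \<Union>w\<in>level k. closure (tb w))"
    have "tree \<subseteq> ?F \<union> {v. v $ 3 \<le> x $ 3 / 2}"
    proof
      fix v assume "v \<in> tree"
      then obtain k i j where w: "v \<in> tube k i j" "i < 2 ^ k" "j < 2 ^ k"
        by (auto simp: tree_def levels_def tb_def)
      show "v \<in> ?F \<union> {v. v $ 3 \<le> x $ 3 / 2}"
      proof (cases "v $ 3 \<le> x $ 3 / 2")
        case False
        then have "k < N" using N[of v k i j] w tube_subset_ctube by auto
        then show ?thesis
          using w closure_subset[of "tube k i j"] by (force simp: level_def tb_def)
      qed simp
    qed
    moreover have "closed (?F \<union> {v. v $ 3 \<le> x $ 3 / 2})"
      by (intro closed_Un closed_Collect_le continuous_intros) (auto intro!: closed_UN finite_level)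
    ultimately have "x \<in> ?F \<union> {v. v $ 3 \<le> x $ 3 / 2}"
      using x closure_minimal by blast
    then show ?thesis using x3 by (auto simp: level_def levels_def)
  qed (use xC in auto)
qed

lemma frontier_tree:
  "frontier tree \<subseteq> (\<Union>w\<in>levels. frontier (tb w)) \<union> {v. \<bar>v $ 1\<bar> \<le> 4 \<and> \<bar>v $ 2\<bar> \<le> 4 \<and> v $ 3 = 0}"
proof
  fix x assume "x \<in> frontier tree"
  then have x: "x \<in> closure tree" "x \<notin> tree" by (auto simp: frontier_def interior_open open_tree)
  have "frontier (tb w) = closure (tb w) - tb w" for w
    by (cases w) (simp add: tb_def frontier_def interior_open open_tube)
  then show "x \<in> (\<Union>w\<in>levels. frontier (tb w)) \<union> {v. \<bar>v $ 1\<bar> \<le> 4 \<and> \<bar>v $ 2\<bar> \<le> 4 \<and> v $ 3 = 0}"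
    using x closure_tree by (auto simp: tree_def)
qed

text \<open>The nodes of level \<open>k\<close> lie over the midpoints of a dyadic grid of mesh
  \<open>ht k\<close>, at height about \<open>ht k\<close>.\<close>

lemma floor_square_in_frontier: "floor_square \<subseteq> frontier tree"
proof
  fix x assume x: "x \<in> floor_square"
  have "x \<in> closure tree"
    unfolding closure_approachable
  proof (intro allI impI)
    fix e :: real assume e: "0 < e"
    have "(\<lambda>k. 4 * ht k) \<longlonglongrightarrow> 4 * 0"
      unfolding ht_def by (intro tendsto_intros LIMSEQ_power_zero) auto
    then have "eventually (\<lambda>k. 4 * ht k < e) sequentially" using e by (intro order_tendstoD) auto
    then obtain k where k: "4 * ht k < e" by (auto simp: eventually_sequentially)
    have near: "\<exists>i<2 ^ k. \<bar>centre k i - s\<bar> \<le> ht k" if s: "0 \<le> s" "s \<le> 1" for s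
    proof -
      have hk: "2 ^ k * ht k = 1" by (simp add: ht_def power_mult_distrib[symmetric])
      \<comment> \<open>The minimum matters only for s = 1, where the floor would give the index
        2^k.\<close>
      define i where "i = min (nat \<lfloor>s * 2 ^ k\<rfloor>) (2 ^ k - 1)"
      have i: "i < 2 ^ k" by (simp add: i_def min_less_iff_disj)
      have b: "real i \<le> s * 2 ^ k" "s * 2 ^ k \<le> real i + 1"
      proof -
        have "real (nat \<lfloor>s * 2 ^ k\<rfloor>) \<le> s * 2 ^ k" using s by simp
        moreover have "real i \<le> real (nat \<lfloor>s * 2 ^ k\<rfloor>)" by (simp add: i_def)
        ultimately show "real i \<le> s * 2 ^ k" by linarith
        have "s * 2 ^ k \<le> real (nat \<lfloor>s * 2 ^ k\<rfloor>) + 1" using s by linarith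
        moreover have "s * 2 ^ k \<le> real (2 ^ k - 1) + 1" using s by (simp add: of_nat_diff)
        ultimately show "s * 2 ^ k \<le> real i + 1" by (auto simp: i_def min_def)
      qed
      have "real i * ht k \<le> s" "s \<le> (real i + 1) * ht k"
        using mult_right_mono[OF b(1), of "ht k"] mult_right_mono[OF b(2), of "ht k"] ht_pos[of k] hk
        by (auto simp: mult.assoc)
      then have "\<bar>centre k i - s\<bar> \<le> ht k" using ht_pos[of k] by (auto simp: centre_def abs_le_iff algebra_simps)
      then show ?thesis using i by blast
    qed
    obtain i where i: "i < 2 ^ k" "\<bar>centre k i - x $ 1\<bar> \<le> ht k" using near[of "x $ 1"] x by (auto simp: floor_square_def)
    obtain j where j: "j < 2 ^ k" "\<bar>centre k j - x $ 2\<bar> \<le> ht k" using near[of "x $ 2"] x by (auto simp: floor_square_def)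
    have "node k i j \<in> tree" using node_in_tube[of k i j] i j by (force simp: tree_def levels_def tb_def)
    moreover have "dist (node k i j) x < e"
    proof -
      have "norm (node k i j - x) \<le> \<bar>centre k i - x $ 1\<bar> + \<bar>centre k j - x $ 2\<bar> + \<bar>ht k + rad (Suc k) / 2\<bar>"
        using norm_le_sum_3[of "node k i j - x"] x by (simp add: node_def floor_square_def)
      also have "\<dots> < e" using i j k rad_le[of k] rad_Suc[of k] rad_pos[of k] ht_pos[of k] by linarith
      finally show ?thesis by (simp add: dist_norm)
    qed
    ultimately show "\<exists>y\<in>tree. dist y x < e" by blast
  qed
  moreover have "x \<notin> tree" using tree_third_pos[of x] x by (auto simp: floor_square_def)
  ultimately show "x \<in> frontier tree" by (simp add: frontier_def interior_open open_tree)
qed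

section \<open>Volumes and wall areas of the tubes\<close>

definition slanted :: "real \<Rightarrow> real \<Rightarrow> real^3 \<Rightarrow> real^3 \<Rightarrow> (real^3) set" where
  "slanted s t a b = {v. a $ 1 \<le> v $ 1 - s * v $ 3 \<and> v $ 1 - s * v $ 3 \<le> b $ 1 \<and>
    a $ 2 \<le> v $ 2 - t * v $ 3 \<and> v $ 2 - t * v $ 3 \<le> b $ 2 \<and> a $ 3 \<le> v $ 3 \<and> v $ 3 \<le> b $ 3}"

lemma closed_slanted: "closed (slanted s t a b)"
  unfolding slanted_def by (intro closed_Collect_conj closed_Collect_le continuous_intros)

text \<open>The set is the image of \<open>cbox a b\<close> under a shear of determinant 1.\<close>

lemma emeasure_slanted:
  assumes "\<And>i. a $ i \<le> b $ i"
  shows "emeasure lborel (slanted s t a b) = ennreal ((b $ 1 - a $ 1) * (b $ 2 - a $ 2) * (b $ 3 - a $ 3))"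
proof -
  define f where "f v = (vector [v $ 1 + s * v $ 3, v $ 2 + t * v $ 3, v $ 3] :: real^3)" for v :: "real^3"
  have lin: "linear f"
    by (rule linearI) (simp_all add: f_def vec_eq_iff forall_3 algebra_simps)
  have "det (matrix f) = 1"
    by (simp add: det_3 matrix_def f_def axis_def)
  have img: "slanted s t a b = f ` cbox a b"
  proof (intro set_eqI iffI)
    fix v assume v: "v \<in> slanted s t a b"
    have "v = f (vector [v $ 1 - s * v $ 3, v $ 2 - t * v $ 3, v $ 3])"
      by (simp add: f_def vec_eq_iff forall_3)
    moreover have "vector [v $ 1 - s * v $ 3, v $ 2 - t * v $ 3, v $ 3] \<in> cbox a b"
      using v by (simp add: slanted_def mem_box_cart forall_3)
    ultimately show "v \<in> f ` cbox a b" by blast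
  qed (auto simp: slanted_def f_def mem_box_cart forall_3)
  have m: "measure lebesgue (slanted s t a b) = measure lebesgue (cbox a b)" "slanted s t a b \<in> lmeasurable"
    unfolding img using measure_linear_image[OF lin, of "cbox a b"] measurable_linear_image[OF lin, of "cbox a b"]
      \<open>det (matrix f) = 1\<close> by auto
  have "emeasure lborel (slanted s t a b) = emeasure lebesgue (slanted s t a b)"
    using closed_slanted by simp
  also have "\<dots> = ennreal (measure lebesgue (slanted s t a b))"
    using m(2) by (simp add: emeasure_eq_measure2)
  also have "\<dots> = emeasure lborel (cbox a b)"
    unfolding m(1) using emeasure_eq_measure2[of "cbox a b" lebesgue] by simp
  finally show ?thesis using emeasure_lborel_cbox_3[OF assms] by simp
qed

lemma emeasure_tube: "emeasure lborel (tube k i j) \<le> ennreal (ht k ^ 17)"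
proof -
  define a :: "real^3" where "a = vector [line k i 0 - rad k, line k j 0 - rad k, ht k]"
  define b :: "real^3" where "b = vector [line k i 0 + rad k, line k j 0 + rad k, 2 * ht k + rad k]"
  have "tube k i j \<subseteq> slanted (slope i) (slope j) a b"
    by (auto simp: tube_def slanted_def a_def b_def line_def abs_less_iff algebra_simps)
  then have "emeasure lborel (tube k i j) \<le> emeasure lborel (slanted (slope i) (slope j) a b)"
    using closed_slanted by (intro emeasure_mono) auto
  also have "\<dots> = ennreal ((2 * rad k) * (2 * rad k) * (ht k + rad k))"
  proof (subst emeasure_slanted)
    show "a $ n \<le> b $ n" for n
      using exhaust_3[of n] rad_pos[of k] ht_pos[of k] by (auto simp: a_def b_def)
  qed (simp add: a_def b_def)
  also have "\<dots> \<le> ennreal (ht k ^ 17)"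
  proof (rule ennreal_leI)
    have "(2 * rad k) * (2 * rad k) * (ht k + rad k) \<le> (ht k ^ 8 / 4) * (ht k ^ 8 / 4) * (2 * ht k)"
      using rad_le[of k] rad_pos[of k] ht_pos[of k] by (intro mult_mono) (auto simp: rad_def)
    also have "\<dots> \<le> ht k ^ 17" using ht_pos[of k] by (simp add: field_simps power_numeral_reduce)
    finally show "(2 * rad k) * (2 * rad k) * (ht k + rad k) \<le> ht k ^ 17" .
  qed
  finally show ?thesis .
qed

text \<open>The frontier lies in six parallelograms with sides at most 2 \<open>rad k\<close> and 3
  \<open>ht k\<close>. This gives 6 * 16 * 2 * 3 = 576 times pi \<open>rad k\<close>
  \<open>ht k\<close>, and the 1/8 in \<open>rad k\<close> leaves 72.\<close>

lemma hausdorff_outer_frontier_tube: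
  "hausdorff_outer 2 (frontier (tube k i j)) \<le> ennreal (72 * pi * ht k ^ 9)"
proof -
  define H where "H = ht k + rad k"
  have r: "0 < rad k" and h: "0 < ht k" and H: "0 < H" and rl: "rad k \<le> ht k / 8"
    using rad_pos ht_pos rad_le by (auto simp: H_def add_pos_pos)
  define up where "up = H *\<^sub>R (vector [slope i, slope j, 1] :: real^3)"
  define e1 e2 where "e1 = (vector [2 * rad k, 0, 0] :: real^3)" and "e2 = (vector [0, 2 * rad k, 0] :: real^3)"
  define P where "P X Y z = (vector [line k i z + X, line k j z + Y, z] :: real^3)" for X Y z
  have up: "norm up \<le> 3 * ht k"
  proof -
    have "norm up = H * norm (vector [slope i, slope j, 1] :: real^3)" using H by (simp add: up_def)
    also have "\<dots> \<le> H * 2"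
      using H norm_le_sum_3[of "vector [slope i, slope j, 1]"] by (intro mult_left_mono) (auto simp: slope_bound)
    also have "\<dots> \<le> 3 * ht k" using rl h by (simp add: H_def)
    finally show ?thesis .
  qed
  have e: "norm e1 \<le> 2 * rad k" "norm e2 \<le> 2 * rad k"
    using norm_le_sum_3[of e1] norm_le_sum_3[of e2] r by (auto simp: e1_def e2_def)
  have e': "norm e2 \<le> 3 * ht k" using e rl h by linarith
  define F where "F n = (if n = 0 then parallelogram (P (- rad k) (- rad k) (ht k)) e1 e2
    else if n = 1 then parallelogram (P (- rad k) (- rad k) (ht k + H)) e1 e2
    else if n = 2 then parallelogram (P (- rad k) (- rad k) (ht k)) e1 up
    else if n = 3 then parallelogram (P (- rad k) (rad k) (ht k)) e1 up
    else if n = 4 then parallelogram (P (- rad k) (- rad k) (ht k)) e2 up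
    else parallelogram (P (rad k) (- rad k) (ht k)) e2 up)" for n :: nat
  define C where "C = ennreal (unit_ball_vol 2 * (16 * (2 * rad k) * (3 * ht k)))"
  have "hausdorff_outer 2 (parallelogram p w w') \<le> C"
    if "norm w \<le> 2 * rad k" "norm w' \<le> 3 * ht k" for p w w' :: "real^3"
    unfolding C_def using that r h by (intro hausdorff_outer_parallelogram) auto
  then have F: "hausdorff_outer 2 (F n) \<le> C" for n
    by (simp add: F_def e e' up)
  have "frontier (tube k i j) \<subseteq> (\<Union>n\<in>{..<6}. F n)"
  proof
    fix v assume "v \<in> frontier (tube k i j)"
    then have v: "v \<in> ctube k i j" "v \<notin> tube k i j"
      using closure_tube by (auto simp: frontier_def interior_open open_tube)
    define X Y Z where "X = v $ 1 - line k i (v $ 3)" and "Y = v $ 2 - line k j (v $ 3)" and "Z = v $ 3 - ht k"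
    have b: "- rad k \<le> X" "X \<le> rad k" "- rad k \<le> Y" "Y \<le> rad k" "0 \<le> Z" "Z \<le> H"
      using v(1) by (auto simp: ctube_def X_def Y_def Z_def H_def abs_le_iff)
    define x y z where "x = (X + rad k) / (2 * rad k)" and "y = (Y + rad k) / (2 * rad k)" and "z = Z / H"
    have u: "x \<in> {0..1}" "y \<in> {0..1}" "z \<in> {0..1}"
      using b r H by (auto simp: x_def y_def z_def)
    have xyz: "x * (2 * rad k) = X + rad k" "y * (2 * rad k) = Y + rad k" "z * H = Z"
      using r H by (auto simp: x_def y_def z_def)
    have faces: "X = - rad k \<or> X = rad k \<or> Y = - rad k \<or> Y = rad k \<or> Z = 0 \<or> Z = H"
      using v(2) b unfolding tube_def X_def Y_def Z_def H_def by (auto simp: abs_less_iff)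
    have up1: "z * (H * slope l) = slope l * (v $ 3 - ht k)" for l
    proof -
      have "z * (H * slope l) = (z * H) * slope l" by simp
      then show ?thesis unfolding xyz(3) by (simp add: Z_def)
    qed
    have e12: "P (- rad k) (- rad k) (ht k + Z) + x *\<^sub>R e1 + y *\<^sub>R e2 = v"
      by (simp add: vec_eq_iff forall_3 P_def e1_def e2_def xyz X_def Y_def Z_def)
    have e1u: "P (- rad k) Y (ht k) + x *\<^sub>R e1 + z *\<^sub>R up = v"
      by (simp add: vec_eq_iff forall_3 P_def e1_def up_def xyz up1 X_def Y_def Z_def line_def)
    have e2u: "P X (- rad k) (ht k) + y *\<^sub>R e2 + z *\<^sub>R up = v"
      by (simp add: vec_eq_iff forall_3 P_def e2_def up_def xyz up1 X_def Y_def Z_def line_def)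
    have m: "v \<in> parallelogram p w w'" if "p + s *\<^sub>R w + t *\<^sub>R w' = v" "s \<in> {0..1}" "t \<in> {0..1}" for p w w' s t
      unfolding parallelogram_def using that by (intro image_eqI[of _ _ "(s, t)"]) auto
    from faces consider "v \<in> F 0" | "v \<in> F 1" | "v \<in> F 2" | "v \<in> F 3" | "v \<in> F 4" | "v \<in> F 5"
      using m[OF e12 u(1,2)] m[OF e1u u(1,3)] m[OF e2u u(2,3)] unfolding F_def by auto
    then show "v \<in> (\<Union>n\<in>{..<6}. F n)"
      by cases auto
  qed
  then have "hausdorff_outer 2 (frontier (tube k i j)) \<le> hausdorff_outer 2 (\<Union>n\<in>{..<6}. F n)"
    by (rule hausdorff_outer_mono)
  also have "\<dots> \<le> (\<Sum>n<6. hausdorff_outer 2 (F n))" by (rule hausdorff_outer_UN_finite) simp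
  also have "\<dots> \<le> (\<Sum>n<6::nat. C)"
    by (intro sum_mono F)
  also have "\<dots> = ennreal (6 * (unit_ball_vol 2 * (16 * (2 * rad k) * (3 * ht k))))"
    unfolding C_def using r h by (subst sum_ennreal) auto
  also have "6 * (unit_ball_vol 2 * (16 * (2 * rad k) * (3 * ht k))) = 72 * pi * ht k ^ 9"
    by (simp add: unit_ball_vol_2 rad_def power_numeral_reduce)
  finally show ?thesis .
qed

lemma hausdorff_outer_bottom:
  "hausdorff_outer 2 {v :: real^3. \<bar>v $ 1\<bar> \<le> 4 \<and> \<bar>v $ 2\<bar> \<le> 4 \<and> v $ 3 = 0} < \<infinity>"
proof -
  let ?e1 = "vector [8, 0, 0] :: real^3" and ?e2 = "vector [0, 8, 0] :: real^3"
  have "{v :: real^3. \<bar>v $ 1\<bar> \<le> 4 \<and> \<bar>v $ 2\<bar> \<le> 4 \<and> v $ 3 = 0} \<subseteq> parallelogram (vector [-4, -4, 0]) ?e1 ?e2"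
  proof
    fix v :: "real^3" assume v: "v \<in> {v :: real^3. \<bar>v $ 1\<bar> \<le> 4 \<and> \<bar>v $ 2\<bar> \<le> 4 \<and> v $ 3 = 0}"
    then have "v = vector [-4, -4, 0] + ((v $ 1 + 4) / 8) *\<^sub>R ?e1 + ((v $ 2 + 4) / 8) *\<^sub>R ?e2"
      by (simp add: vec_eq_iff forall_3 add_divide_distrib)
    then show "v \<in> parallelogram (vector [-4, -4, 0]) ?e1 ?e2"
      unfolding parallelogram_def using v
      by (intro image_eqI[of _ _ "((v $ 1 + 4) / 8, (v $ 2 + 4) / 8)"]) auto
  qed
  then have "hausdorff_outer 2 {v :: real^3. \<bar>v $ 1\<bar> \<le> 4 \<and> \<bar>v $ 2\<bar> \<le> 4 \<and> v $ 3 = 0}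
      \<le> hausdorff_outer 2 (parallelogram (vector [-4, -4, 0]) ?e1 ?e2)"
    by (rule hausdorff_outer_mono)
  also have "\<dots> \<le> ennreal (unit_ball_vol 2 * (16 * 8 * 8))"
    using norm_le_sum_3[of ?e1] norm_le_sum_3[of ?e2] by (intro hausdorff_outer_parallelogram) auto
  also have "\<dots> < \<infinity>" by simp
  finally show ?thesis .
qed

lemma card_level: "real (card (level k)) = 4 ^ k"
  by (simp add: level_def card_cartesian_product power_mult_distrib[symmetric])

text \<open>The walls of level \<open>k\<close> have total area of order 4^k times
  \<open>ht k ^ 9\<close>, that is 2^(-7k), which is summable; the rest of the frontier lies in a
  bounded plane square.\<close>

lemma hausdorff_outer_frontier_tree: "hausdorff_outer 2 (frontier tree) < \<infinity>"
proof -
  let ?B = "{v :: real^3. \<bar>v $ 1\<bar> \<le> 4 \<and> \<bar>v $ 2\<bar> \<le> 4 \<and> v $ 3 = 0}"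
  let ?F = "\<lambda>k. \<Union>w\<in>level k. frontier (tb w)"
  have lev: "hausdorff_outer 2 (?F k) \<le> ennreal (72 * pi * (1 / 2) ^ k)" for k
  proof -
    have "hausdorff_outer 2 (?F k) \<le> (\<Sum>w\<in>level k. hausdorff_outer 2 (frontier (tb w)))"
      by (rule hausdorff_outer_UN_finite[OF finite_level])
    also have "\<dots> \<le> (\<Sum>w\<in>level k. ennreal (72 * pi * ht k ^ 9))"
      by (rule sum_mono) (auto simp: level_def tb_def hausdorff_outer_frontier_tube)
    also have "\<dots> = ennreal (4 ^ k * (72 * pi * ht k ^ 9))"
      using ht_pos[of k] card_level[of k]
      by (simp add: ennreal_of_nat_eq_real_of_nat ennreal_mult[symmetric])
    also have "\<dots> \<le> ennreal (72 * pi * (1 / 2) ^ k)"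
    proof (rule ennreal_leI)
      have "4 ^ k * ht k ^ 9 = (4 * (1 / 2) ^ 9) ^ k"
        by (simp add: ht_def power_mult_distrib power_mult[symmetric] mult.commute flip: power_mult_distrib)
      also have "\<dots> \<le> (1 / 2 :: real) ^ k" by (intro power_mono) (auto simp: power_numeral_reduce)
      finally have "72 * pi * (4 ^ k * ht k ^ 9) \<le> 72 * pi * (1 / 2) ^ k" by (intro mult_left_mono) auto
      then show "4 ^ k * (72 * pi * ht k ^ 9) \<le> 72 * pi * (1 / 2) ^ k" by (simp add: mult.left_commute)
    qed
    finally show ?thesis .
  qed
  have "frontier tree \<subseteq> (\<Union>k. ?F k) \<union> ?B"
    using frontier_tree by (fastforce simp: levels_def level_def)
  then have "hausdorff_outer 2 (frontier tree) \<le> hausdorff_outer 2 ((\<Union>k. ?F k) \<union> ?B)"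
    by (rule hausdorff_outer_mono)
  also have "\<dots> \<le> hausdorff_outer 2 (\<Union>k. ?F k) + hausdorff_outer 2 ?B" by (rule hausdorff_outer_Un)
  also have "hausdorff_outer 2 (\<Union>k. ?F k) \<le> (\<Sum>k. hausdorff_outer 2 (?F k))"
    by (rule hausdorff_outer_subadditive)
  also have "(\<Sum>k. hausdorff_outer 2 (?F k)) \<le> (\<Sum>k. ennreal (72 * pi * (1 / 2) ^ k))"
    by (intro suminf_le lev) auto
  also have "\<dots> = ennreal (\<Sum>k. 72 * pi * (1 / 2) ^ k)"
    by (intro suminf_ennreal2 summable_mult summable_geometric) auto
  finally show ?thesis
    using hausdorff_outer_bottom by (auto simp: add_mono add_right_mono intro: le_less_trans)
qed

text \<open>The bump in \<open>tube_kernel\<close> has integral at least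
  \<open>ht k ^ 17 / kernel_const\<close>: its six factors are at least \<open>rise (1 / 4)\<close>
  on an inner slanted box of volume at least \<open>ht k ^ 17 / 1024\<close>.\<close>

definition kernel_const :: real where "kernel_const = 1024 / rise (1 / 4) ^ 6"

lemma tube_kernel:
  obtains \<rho> where "test_function (tube k i j) \<rho>" "\<And>v. 0 \<le> \<rho> v"
    "\<And>v. \<rho> v \<le> kernel_const / ht k ^ 17" "(\<integral>v. \<rho> v \<partial>lborel) = 1"
proof -
  define H where "H = ht k + rad k"
  have r: "0 < rad k" and h: "0 < ht k" and H: "0 < H" using rad_pos ht_pos by (auto simp: H_def add_pos_pos)
  \<comment> \<open>Bumps vanishing outside [-3/4, 3/4] and [1/8, 7/8], in coordinates rescaled to
    the tube. The factors 1 and -1 are written out to match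
    \<open>tcd_compose_affine\<close>.\<close>
  define f g where "f s = rise (3 / 4 + 1 * s) * rise (3 / 4 + (- 1) * s)" and "g s = rise (- (1 / 8) + 1 * s) * rise (7 / 8 + (- 1) * s)" for s
  define T where "T n l v = (v $ n - line k l (v $ 3)) / rad k" for n and l and v :: "real^3"
  define T3 where "T3 v = (v $ 3 - ht k) / H" for v :: "real^3"
  define \<rho>0 where "\<rho>0 v = f (T 1 i v) * (f (T 2 j v) * g (T3 v))" for v
  have tf: "tcd n f" "tcd n g" for n
    unfolding f_def[abs_def] g_def[abs_def]
    by (intro tcd_mult tcd_compose_affine[OF bounded_linear_mult_right tcd_rise])+
  have lin: "bounded_linear (\<lambda>v::real^3. (v $ n - slope l * v $ 3) / rad k)" for n l
    by (intro bounded_linear_divide[THEN bounded_linear_compose] bounded_linear_sub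
        bounded_linear_vec_nth bounded_linear_const_mult)
  have Teq: "T n l = (\<lambda>v. - (centre k l - slope l * ht k) / rad k + (v $ n - slope l * v $ 3) / rad k)" for n l
    by (simp add: T_def line_def fun_eq_iff diff_divide_distrib add_divide_distrib algebra_simps)
  have fT: "tcd m (\<lambda>v. f (T n l v))" for m n l
    unfolding Teq by (rule tcd_compose_affine[OF lin tf(1)])
  have gT: "tcd m (\<lambda>v. g (T3 v))" for m
  proof -
    have eq: "T3 = (\<lambda>v. - ht k / H + v $ 3 / H)" by (simp add: T3_def fun_eq_iff diff_divide_distrib)
    show ?thesis unfolding eq
      by (rule tcd_compose_affine[OF _ tf(2)])
        (intro bounded_linear_divide[THEN bounded_linear_compose] bounded_linear_vec_nth)
  qed
  have t0: "tcd m \<rho>0" for m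
    unfolding \<rho>0_def[abs_def] by (intro tcd_mult fT gT)
  define K where "K = {v. \<bar>T 1 i v\<bar> \<le> 3 / 4 \<and> \<bar>T 2 j v\<bar> \<le> 3 / 4 \<and> 1 / 8 \<le> T3 v \<and> T3 v \<le> 7 / 8}"
  have Kt: "K \<subseteq> tube k i j"
  proof
    fix v assume v: "v \<in> K"
    have "\<bar>v $ 1 - line k i (v $ 3)\<bar> \<le> 3 / 4 * rad k" "\<bar>v $ 2 - line k j (v $ 3)\<bar> \<le> 3 / 4 * rad k"
      using v r by (auto simp: K_def T_def abs_divide divide_le_eq)
    moreover have "1 / 8 * H \<le> v $ 3 - ht k" "v $ 3 - ht k \<le> 7 / 8 * H"
      using v H by (auto simp: K_def T3_def le_divide_eq divide_le_eq)
    ultimately show "v \<in> tube k i j" using r H by (auto simp: tube_def H_def)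
  qed
  have "closed K"
    unfolding K_def T_def T3_def line_def using r H
    by (intro closed_Collect_conj closed_Collect_le continuous_intros) auto
  moreover have "bounded K"
    using bounded_subset[OF bounded_ctube] Kt tube_subset_ctube by blast
  ultimately have K: "compact K" by (simp add: compact_eq_bounded_closed)
  have off: "\<rho>0 v = 0" if "v \<notin> K" for v
  proof -
    have "f s = 0" if "3 / 4 < \<bar>s\<bar>" for s
      using that by (cases "0 < s") (auto simp: f_def rise_bounds(4))
    moreover have "g s = 0" if "s < 1 / 8 \<or> 7 / 8 < s" for s
      using that by (auto simp: g_def rise_bounds(4))
    ultimately show ?thesis using that by (auto simp: K_def \<rho>0_def not_le)
  qed
  have f01: "0 \<le> f s" "f s \<le> 1" "0 \<le> g s" "g s \<le> 1" for s
    by (auto simp: f_def g_def rise_bounds mult_le_one)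
  have \<rho>01: "0 \<le> \<rho>0 v" "\<rho>0 v \<le> 1" for v
    by (auto simp: \<rho>0_def f01 mult_le_one)
  define c where "c = rise (1 / 4)"
  have c: "0 < c" by (simp add: c_def rise_bounds)
  define a b :: "real^3" where
    "a = vector [line k i 0 - rad k / 4, line k j 0 - rad k / 4, ht k + 3 / 8 * H]" and
    "b = vector [line k i 0 + rad k / 4, line k j 0 + rad k / 4, ht k + 5 / 8 * H]"
  define S where "S = slanted (slope i) (slope j) a b"
  have big: "c ^ 6 * indicator S v \<le> \<rho>0 v" for v
  proof (cases "v \<in> S")
    case True
    have l0: "line k l (v $ 3) = line k l 0 + slope l * v $ 3" for l by (simp add: line_def algebra_simps)
    have "line k i 0 - rad k / 4 \<le> v $ 1 - slope i * v $ 3 \<and> v $ 1 - slope i * v $ 3 \<le> line k i 0 + rad k / 4 \<and>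
      line k j 0 - rad k / 4 \<le> v $ 2 - slope j * v $ 3 \<and> v $ 2 - slope j * v $ 3 \<le> line k j 0 + rad k / 4 \<and>
      ht k + 3 / 8 * H \<le> v $ 3 \<and> v $ 3 \<le> ht k + 5 / 8 * H"
      using True by (simp add: S_def slanted_def a_def b_def)
    then have "\<bar>v $ 1 - line k i (v $ 3)\<bar> \<le> rad k / 4" "\<bar>v $ 2 - line k j (v $ 3)\<bar> \<le> rad k / 4"
      "3 / 8 * H \<le> v $ 3 - ht k" "v $ 3 - ht k \<le> 5 / 8 * H"
      using l0[of i] l0[of j] by linarith+
    then have t: "\<bar>T 1 i v\<bar> \<le> 1 / 4" "\<bar>T 2 j v\<bar> \<le> 1 / 4" "3 / 8 \<le> T3 v" "T3 v \<le> 5 / 8"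
      using r H by (auto simp: T_def T3_def abs_divide divide_le_eq le_divide_eq)
    have fc: "c * c \<le> f s" if "\<bar>s\<bar> \<le> 1 / 4" for s
      unfolding f_def c_def using that by (intro mult_mono rise_mono rise_bounds) auto
    have gc: "c * c \<le> g s" if "3 / 8 \<le> s" "s \<le> 5 / 8" for s
      unfolding g_def c_def using that by (intro mult_mono rise_mono rise_bounds) auto
    have "(c * c) * ((c * c) * (c * c)) \<le> \<rho>0 v"
      unfolding \<rho>0_def using t c f01 by (intro mult_mono fc gc) auto
    then show ?thesis using True by (simp add: power_numeral_reduce mult.assoc)
  qed (use \<rho>01 in auto)
  have i0: "integrable lborel \<rho>0"
    by (rule continuous_zero_off_compact_integrable[OF tcd_continuous[OF t0[of 0]] K off])
  define I where "I = (\<integral>v. \<rho>0 v \<partial>lborel)"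
  have eS: "emeasure lborel S = ennreal ((rad k / 2) * (rad k / 2) * (H / 4))"
    unfolding S_def
  proof (subst emeasure_slanted)
    show "a $ n \<le> b $ n" for n
      using exhaust_3[of n] r H by (auto simp: a_def b_def)
  qed (simp add: a_def b_def)
  have iS: "integrable lborel (indicator S :: real^3 \<Rightarrow> real)"
  proof (rule integrable_real_indicator)
    show "S \<in> sets lborel" by (simp add: S_def closed_slanted)
  qed (simp add: eS)
  have "(\<integral>v. c ^ 6 * indicator S v \<partial>lborel) \<le> I"
    unfolding I_def using big i0 iS by (intro integral_mono integrable_mult_right) auto
  moreover have "(\<integral>v. c ^ 6 * indicator S v \<partial>lborel) = c ^ 6 * ((rad k / 2) * (rad k / 2) * (H / 4))"
    using eS r H by (simp add: measure_def)
  moreover have "c ^ 6 * ((rad k / 2) * (rad k / 2) * (ht k / 4)) \<le> c ^ 6 * ((rad k / 2) * (rad k / 2) * (H / 4))"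
    using r h c by (intro mult_left_mono) (auto simp: H_def)
  moreover have "c ^ 6 * ((rad k / 2) * (rad k / 2) * (ht k / 4)) = ht k ^ 17 / (1024 / c ^ 6)"
    using c by (simp add: rad_def power_numeral_reduce)
  ultimately have "ht k ^ 17 / (1024 / c ^ 6) \<le> I" by linarith
  then have I: "ht k ^ 17 / kernel_const \<le> I" by (simp add: kernel_const_def c_def)
  have kc: "0 < kernel_const" using c by (simp add: kernel_const_def c_def)
  have Ipos: "0 < I" using I h kc by (meson divide_pos_pos less_le_trans zero_less_power)
  show ?thesis
  proof (rule that)
    show "test_function (tube k i j) (\<lambda>v. (1 / I) * \<rho>0 v)"
      by (rule test_functionI[OF tcd_mult[OF tcd_const t0] K Kt]) (simp add: off)
    show "0 \<le> (1 / I) * \<rho>0 v" for v using Ipos \<rho>01 by simp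
    show "(1 / I) * \<rho>0 v \<le> kernel_const / ht k ^ 17" for v
    proof -
      have "(1 / I) * \<rho>0 v \<le> (1 / I) * 1" using Ipos \<rho>01 by (intro mult_left_mono) auto
      also have "\<dots> \<le> 1 / (ht k ^ 17 / kernel_const)"
        using frac_le[of 1 1 "ht k ^ 17 / kernel_const" I] I h kc by simp
      finally show ?thesis by simp
    qed
    show "(\<integral>v. (1 / I) * \<rho>0 v \<partial>lborel) = 1" using Ipos by (simp add: I_def)
  qed
qed

section \<open>Continuous representatives on the tree\<close>

text \<open>The set of disagreement is open, and a nonempty open set is not negligible.\<close>

lemma continuous_AE_unique:
  fixes f g :: "'a::euclidean_space \<Rightarrow> real"
  assumes "open S" "continuous_on S f" "continuous_on S g" "AE x in lebesgue. x \<in> S \<longrightarrow> f x = g x"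
    and x: "x \<in> S"
  shows "f x = g x"
proof (rule ccontr)
  let ?T = "{x \<in> S. f x - g x \<noteq> 0}"
  assume "f x \<noteq> g x"
  then have "?T \<noteq> {}" using x by auto
  moreover have "?T = S \<inter> (\<lambda>x. f x - g x) -` (- {0})" by auto
  then have "open ?T"
    using assms continuous_open_preimage[of S "\<lambda>x. f x - g x" "- {0}"] by (auto intro: continuous_on_diff)
  moreover have "negligible ?T"
    using assms(4) AE_iff_null_sets[of ?T lebesgue] \<open>open ?T\<close>
    by (auto simp: negligible_iff_null_sets elim: eventually_mono)
  ultimately show False using open_not_negligible by blast
qed

text \<open>For convex open sets that meet, closure and intersection commute;
  \<open>tubes_meet\<close> supplies a common point of the open tubes.\<close>

lemma closure_tb_Int:
  assumes w: "w \<in> levels" "w' \<in> levels" and meet: "closure (tb w) \<inter> closure (tb w') \<noteq> {}"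
  shows "closure (tb w \<inter> tb w') = closure (tb w) \<inter> closure (tb w')"
proof -
  obtain k i j k' i' j' where eq: "w = (k, i, j)" "w' = (k', i', j')" by (metis prod_cases3)
  have "tb w \<inter> tb w' \<noteq> {}"
    using meet w closure_tube tubes_meet[of _ k i j k' i' j'] by (fastforce simp: eq tb_def levels_def)
  then show ?thesis
    by (intro closure_Int_convex) (auto simp: eq tb_def convex_tube rel_interior_open open_tube)
qed

lemma open_tb: "open (tb w)"
  by (cases w) (simp add: tb_def open_tube)

lemma tb_subset_tree: "w \<in> levels \<Longrightarrow> tb w \<subseteq> tree"
  by (auto simp: tree_def)

lemma countable_levels: "countable levels"
  by (rule countableI_type)

text \<open>The base 9 comes from Morrey's constant on a tube of diameter at most 3 h: 2 (3 h) / (1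
  - 3/9) = 9 h.\<close>

definition osc_const :: real where "osc_const = 9 ^ 9 * kernel_const"

lemma tube_representative:
  assumes w: "weak_gradient tree u G" and G: "set_integrable lebesgue tree (\<lambda>x. norm (G x) powr 9)"
    and lv: "(k, i, j) \<in> levels"
  shows "\<exists>v. continuous_on (closure (tube k i j)) v \<and> (AE x in lebesgue. x \<in> tube k i j \<longrightarrow> u x = v x) \<and>
    (\<forall>x\<in>closure (tube k i j). \<forall>y\<in>closure (tube k i j). \<bar>v x - v y\<bar> ^ 9
      \<le> osc_const * (LINT x:tube k i j|lebesgue. norm (G x) powr 9) / ht k ^ 8)"
proof -
  obtain \<rho> where \<rho>: "test_function (tube k i j) \<rho>" "\<And>v. 0 \<le> \<rho> v"
    "\<And>v. \<rho> v \<le> kernel_const / ht k ^ 17" "(\<integral>v. \<rho> v \<partial>lborel) = 1"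
    using tube_kernel[of k i j] by metis
  have sub: "tube k i j \<subseteq> tree" using tb_subset_tree[OF lv] by (simp add: tb_def)
  have D: "norm (y - x) \<le> 3 * ht k" if "x \<in> closure (tube k i j)" "y \<in> tube k i j" for x y
    using that closure_tube[of k i j] tube_subset_ctube[of k i j] by (intro ctube_diameter[of y k i j x]) auto
  have Gt: "set_integrable lebesgue (tube k i j) (\<lambda>x. norm (G x) powr 9)"
    using open_tube[of k i j] by (intro set_integrable_subset[OF G _ sub]) auto
  have dim: "real DIM(real^3) < 9" by simp
  obtain v where v: "continuous_on (closure (tube k i j)) v"
      "AE x in lebesgue. x \<in> tube k i j \<longrightarrow> u x = v x"
      "\<And>x y. x \<in> closure (tube k i j) \<Longrightarrow> y \<in> closure (tube k i j) \<Longrightarrow> \<bar>v x - v y\<bar> powr 9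
      \<le> (2 * (3 * ht k) / (1 - real DIM(real^3) / 9)) powr 9 *
        (kernel_const / ht k ^ 17 * (LINT x:tube k i j|lebesgue. norm (G x) powr 9))"
  proof (rule morrey_convex[OF open_tube convex_tube weak_gradient_mono[OF w sub] \<rho> D Gt dim])
  qed (assumption | rule that)+
  let ?A = "LINT x:tube k i j|lebesgue. norm (G x) powr 9"
  have "(2 * (3 * ht k) / (1 - real DIM(real^3) / 9)) powr 9 * (kernel_const / ht k ^ 17 * ?A)
      = osc_const * ?A / ht k ^ 8"
  proof -
    have "2 * (3 * ht k) / (1 - real DIM(real^3) / 9) = 9 * ht k" by simp
    then have "(2 * (3 * ht k) / (1 - real DIM(real^3) / 9)) powr 9 = 9 ^ 9 * ht k ^ 9"
      using ht_pos[of k] by (simp add: power_mult_distrib)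
    then show ?thesis using ht_pos[of k] by (simp add: osc_const_def field_simps power_numeral_reduce)
  qed
  then show ?thesis using v by (intro exI[of _ v]) auto
qed

text \<open>On the overlap of two open tubes the representatives agree everywhere, being continuous
  and almost everywhere equal to \<open>u\<close>. The overlap is dense in the intersection of the
  closed tubes, so they agree there too and define a single function.\<close>

lemma tree_representative:
  assumes w: "weak_gradient tree u G" and G: "set_integrable lebesgue tree (\<lambda>x. norm (G x) powr 9)"
  obtains V where "\<And>w. w \<in> levels \<Longrightarrow> continuous_on (closure (tb w)) V"
    and "AE x in lebesgue. x \<in> tree \<longrightarrow> u x = V x"
    and "\<And>w x y. w \<in> levels \<Longrightarrow> x \<in> closure (tb w) \<Longrightarrow> y \<in> closure (tb w) \<Longrightarrow>
      \<bar>V x - V y\<bar> ^ 9 \<le> osc_const * (LINT x:tb w|lebesgue. norm (G x) powr 9) / ht (fst w) ^ 8"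
    and "\<And>x. x \<notin> (\<Union>w\<in>levels. closure (tb w)) \<Longrightarrow> V x = 0"
proof -
  have "\<forall>w\<in>levels. \<exists>v. continuous_on (closure (tb w)) v \<and> (AE x in lebesgue. x \<in> tb w \<longrightarrow> u x = v x) \<and>
    (\<forall>x\<in>closure (tb w). \<forall>y\<in>closure (tb w). \<bar>v x - v y\<bar> ^ 9
      \<le> osc_const * (LINT x:tb w|lebesgue. norm (G x) powr 9) / ht (fst w) ^ 8)"
    using tube_representative[OF w G] by (auto simp: tb_def)
  from bchoice[OF this]
  obtain v where v: "\<And>w. w \<in> levels \<Longrightarrow> continuous_on (closure (tb w)) (v w)"
    "\<And>w. w \<in> levels \<Longrightarrow> AE x in lebesgue. x \<in> tb w \<longrightarrow> u x = v w x"
    "\<And>w x y. w \<in> levels \<Longrightarrow> x \<in> closure (tb w) \<Longrightarrow> y \<in> closure (tb w) \<Longrightarrow>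
      \<bar>v w x - v w y\<bar> ^ 9 \<le> osc_const * (LINT x:tb w|lebesgue. norm (G x) powr 9) / ht (fst w) ^ 8"
    by blast
  \<comment> \<open>The choice of the closed tube through the point is immaterial by
    \<open>agree\<close> below; off all closed tubes \<open>V\<close> gets the default 0.\<close>
  define ix where "ix x = (SOME w. w \<in> levels \<and> x \<in> closure (tb w))" for x
  define V where "V x = (if \<exists>w\<in>levels. x \<in> closure (tb w) then v (ix x) x else 0)" for x
  have agree: "v w x = v w' x" if "w \<in> levels" "w' \<in> levels" "x \<in> closure (tb w)" "x \<in> closure (tb w')" for w w' x
  proof -
    let ?S = "tb w \<inter> tb w'"
    have cl: "closure ?S = closure (tb w) \<inter> closure (tb w')"
      using that by (intro closure_tb_Int) auto
    have c: "continuous_on (closure ?S) (v w)" "continuous_on (closure ?S) (v w')"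
      unfolding cl using that by (auto intro: continuous_on_subset[OF v(1)])
    have ae: "AE x in lebesgue. x \<in> ?S \<longrightarrow> v w x = v w' x"
      using v(2)[OF that(1)] v(2)[OF that(2)] by eventually_elim auto
    have "v w y - v w' y = 0" if "y \<in> ?S" for y
      using continuous_AE_unique[OF _ _ _ ae that] c closure_subset[of ?S]
      by (auto intro: continuous_on_subset open_tb)
    from continuous_constant_on_closure[OF continuous_on_diff[OF c] this]
    have "v w x - v w' x = 0" using that cl by blast
    then show ?thesis by simp
  qed
  have V: "V x = v w x" if "w \<in> levels" "x \<in> closure (tb w)" for w x
  proof -
    have "ix x \<in> levels \<and> x \<in> closure (tb (ix x))"
      unfolding ix_def by (rule someI[of _ w]) (use that in auto)
    then show ?thesis using that agree[of "ix x" w x] by (auto simp: V_def)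
  qed
  show ?thesis
  proof (rule that)
    show "continuous_on (closure (tb w)) V" if "w \<in> levels" for w
      using v(1)[OF that] V[OF that] by (simp cong: continuous_on_cong)
    have "AE x in lebesgue. \<forall>w\<in>levels. x \<in> tb w \<longrightarrow> u x = v w x"
      using v(2) by (subst AE_ball_countable[OF countable_levels]) auto
    then show "AE x in lebesgue. x \<in> tree \<longrightarrow> u x = V x"
    proof eventually_elim
      case (elim x)
      then show ?case using V closure_subset by (fastforce simp: tree_def)
    qed
    show "\<bar>V x - V y\<bar> ^ 9 \<le> osc_const * (LINT x:tb w|lebesgue. norm (G x) powr 9) / ht (fst w) ^ 8"
      if "w \<in> levels" "x \<in> closure (tb w)" "y \<in> closure (tb w)" for w x y
      using v(3)[OF that] V that by simp
    show "V x = 0" if "x \<notin> (\<Union>w\<in>levels. closure (tb w))" for x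
      using that by (auto simp: V_def)
  qed
qed

section \<open>Summation over the levels\<close>

lemma sum_level: "(\<Sum>w\<in>level k. f w) = (\<Sum>i<2 ^ k. \<Sum>j<2 ^ k. f (k, i, j))"
  by (simp add: level_def sum.cartesian_product' split: prod.splits)

lemma sum_div_two: "(\<Sum>i<2 * n. f (i div 2)) = 2 * (\<Sum>i<n. f i)" for f :: "nat \<Rightarrow> real"
  by (induction n) (auto simp: algebra_simps)

text \<open>Halving both indices sends four children to each parent.\<close>

lemma sum_level_parent:
  fixes f :: "nat \<times> nat \<times> nat \<Rightarrow> real"
  shows "(\<Sum>w\<in>level (Suc k). f (k, fst (snd w) div 2, snd (snd w) div 2)) = 4 * (\<Sum>w\<in>level k. f w)"
proof -
  have "(\<Sum>w\<in>level (Suc k). f (k, fst (snd w) div 2, snd (snd w) div 2))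
      = (\<Sum>i<2 * 2 ^ k. \<Sum>j<2 * 2 ^ k. f (k, i div 2, j div 2))"
    by (simp add: sum_level)
  also have "\<dots> = (\<Sum>i<2 * 2 ^ k. (\<lambda>i'. 2 * (\<Sum>j<2 ^ k. f (k, i', j))) (i div 2))"
    by (simp only: sum_div_two[where f = "\<lambda>j. f (k, _ div 2, j)"])
  also have "\<dots> = 2 * (\<Sum>i<2 ^ k. 2 * (\<Sum>j<2 ^ k. f (k, i, j)))" by (rule sum_div_two)
  finally show ?thesis by (simp add: sum_level sum_distrib_left)
qed

lemma level_subset_levels: "w \<in> level k \<Longrightarrow> w \<in> levels \<and> fst w = k"
  by (auto simp: level_def levels_def)

text \<open>At most eight tubes contain a given point, so the indicators of the tubes sum to at most
  8 on the tree.\<close>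

lemma sum_tube_integrals:
  fixes g :: "real^3 \<Rightarrow> real"
  assumes g: "set_integrable lebesgue tree g" and g0: "\<And>x. 0 \<le> g x"
  shows "(\<Sum>k<n. \<Sum>w\<in>level k. LINT x:tb w|lebesgue. g x) \<le> 8 * (LINT x:tree|lebesgue. g x)"
proof -
  let ?W = "\<Union>k<n. level k"
  have fin: "finite ?W" by (simp add: finite_level)
  have sub: "?W \<subseteq> levels" using level_subset_levels by blast
  have gi: "integrable lebesgue (\<lambda>x. indicator (tb w) x * g x)" if "w \<in> levels" for w
    using set_integrable_subset[OF g _ tb_subset_tree[OF that]] open_tb[of w] by (simp add: set_integrable_def)
  have "(\<Sum>k<n. \<Sum>w\<in>level k. LINT x:tb w|lebesgue. g x) = (\<Sum>w\<in>?W. LINT x:tb w|lebesgue. g x)"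
    by (rule sum.UNION_disjoint[symmetric]) (auto simp: finite_level level_def)
  also have "\<dots> = (\<Sum>w\<in>?W. \<integral>x. indicator (tb w) x * g x \<partial>lebesgue)"
    by (simp add: set_lebesgue_integral_def)
  also have "\<dots> = (\<integral>x. (\<Sum>w\<in>?W. indicator (tb w) x * g x) \<partial>lebesgue)"
    using gi sub by (intro Bochner_Integration.integral_sum[symmetric]) auto
  also have "\<dots> \<le> (\<integral>x. 8 * (indicator tree x * g x) \<partial>lebesgue)"
  proof (rule integral_mono)
    show "integrable lebesgue (\<lambda>x. \<Sum>w\<in>?W. indicator (tb w) x * g x)"
      using gi sub by (intro Bochner_Integration.integrable_sum) auto
    show "integrable lebesgue (\<lambda>x. 8 * (indicator tree x * g x))"
      using g by (simp add: set_integrable_def)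
    fix x
    have "(\<Sum>w\<in>?W. indicator (tb w) x * g x) = (\<Sum>w\<in>{w \<in> ?W. x \<in> tb w}. g x)"
      by (subst sum.inter_filter[OF fin]) (auto intro!: sum.cong simp: indicator_def)
    also have "\<dots> = real (card {w \<in> ?W. x \<in> tb w}) * g x" by simp
    also have "\<dots> \<le> 8 * (indicator tree x * g x)"
    proof (cases "x \<in> tree")
      case True
      have "card {w \<in> ?W. x \<in> tb w} \<le> card {w \<in> levels. x \<in> tb w}"
        using sub tube_multiplicity(1)[of x] by (intro card_mono) auto
      then have "card {w \<in> ?W. x \<in> tb w} \<le> 8" using tube_multiplicity(2)[of x] by linarith
      then show ?thesis using True g0[of x] by (simp add: mult_right_mono)
    next
      case False
      then have none: "{w \<in> ?W. x \<in> tb w} = {}" using sub tb_subset_tree by blast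
      show ?thesis unfolding none using False by simp
    qed
    finally show "(\<Sum>w\<in>?W. indicator (tb w) x * g x) \<le> 8 * (indicator tree x * g x)" .
  qed
  finally show ?thesis by (simp add: set_lebesgue_integral_def)
qed

text \<open>A discrete Hardy inequality: passing to the next level multiplies \<open>m\<close> by at most 8, up to an
  error controlled by the gradient, while the weight \<open>ht k ^ 8\<close> drops by the factor 256.\<close>

lemma weighted_level_sums:
  fixes m A :: "nat \<Rightarrow> real"
  assumes m: "\<And>k. 0 \<le> m k" and A: "\<And>k. 0 \<le> A k" and C: "0 \<le> C"
    and step: "\<And>k. m (Suc k) \<le> 8 * m k + C * A (Suc k) / ht (Suc k) ^ 8"
    and B: "\<And>n. (\<Sum>k<n. A k) \<le> B"
  shows "(\<Sum>k<n. ht k ^ 8 * m k) \<le> 2 * (m 0 + C * B)"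
proof (induction n)
  case 0
  have "0 \<le> B" using B[of 0] by simp
  then show ?case using m C by simp
next
  case (Suc n)
  have one: "ht (Suc k) ^ 8 * m (Suc k) \<le> (1 / 32) * (ht k ^ 8 * m k) + C * A (Suc k)" for k
  proof -
    have "ht (Suc k) ^ 8 * m (Suc k) \<le> ht (Suc k) ^ 8 * (8 * m k + C * A (Suc k) / ht (Suc k) ^ 8)"
      using step ht_pos[of "Suc k"] by (intro mult_left_mono) auto
    also have "\<dots> = ht (Suc k) ^ 8 * (8 * m k) + C * A (Suc k)"
      using ht_pos[of "Suc k"] by (simp add: distrib_left)
    also have "ht (Suc k) ^ 8 * (8 * m k) = (1 / 32) * (ht k ^ 8 * m k)"
      by (simp add: ht_Suc power_divide)
    finally show ?thesis .
  qed
  have "(\<Sum>k<Suc n. ht k ^ 8 * m k) = m 0 + (\<Sum>k<n. ht (Suc k) ^ 8 * m (Suc k))"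
    by (subst sum.lessThan_Suc_shift) (simp add: ht_0)
  also have "\<dots> \<le> m 0 + (\<Sum>k<n. (1 / 32) * (ht k ^ 8 * m k) + C * A (Suc k))"
    by (intro add_left_mono sum_mono one)
  also have "\<dots> = m 0 + ((1 / 32) * (\<Sum>k<n. ht k ^ 8 * m k) + C * (\<Sum>k<n. A (Suc k)))"
    by (simp only: sum.distrib sum_distrib_left)
  also have "\<dots> \<le> m 0 + ((1 / 32) * (2 * (m 0 + C * B)) + C * B)"
  proof -
    have "(\<Sum>k<n. A (Suc k)) \<le> (\<Sum>k<Suc n. A k)"
      using A[of 0] by (subst sum.lessThan_Suc_shift) simp
    then have "(\<Sum>k<n. A (Suc k)) \<le> B" using B[of "Suc n"] by linarith
    then have "C * (\<Sum>k<n. A (Suc k)) \<le> C * B" using C by (rule mult_left_mono)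
    then show ?thesis using Suc.IH by linarith
  qed
  also have "\<dots> \<le> 2 * (m 0 + C * B)"
    using m[of 0] C B[of 0] by simp
  finally show ?case .
qed

text \<open>The coefficient 2 is the point: summed over four children it becomes 8, well below the
  factor 256 by which the weight drops. Plain convexity would give 2^8, and four times that exceeds
  256. Either t is so small compared with s that (17/16)^9 <= 2 applies, or s is below 16 t.\<close>

lemma power9_sum_le:
  fixes s t :: real
  assumes "0 \<le> s" "0 \<le> t"
  shows "(s + t) ^ 9 \<le> 2 * s ^ 9 + 17 ^ 9 * t ^ 9"
proof (cases "16 * t \<le> s")
  case True
  then have "(s + t) ^ 9 \<le> (17 / 16 * s) ^ 9" using assms by (intro power_mono) auto
  also have "\<dots> = (17 / 16) ^ 9 * s ^ 9" by (rule power_mult_distrib)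
  also have "\<dots> \<le> 2 * s ^ 9" using assms by (intro mult_right_mono) (auto simp: power_numeral_reduce)
  finally show ?thesis using assms by (simp add: add_increasing2)
next
  case False
  then have "(s + t) ^ 9 \<le> (17 * t) ^ 9" using assms by (intro power_mono) auto
  also have "\<dots> = 17 ^ 9 * t ^ 9" by (rule power_mult_distrib)
  finally show ?thesis using assms by (simp add: add_increasing)
qed

lemma closure_tb_nonempty: "closure (tb w) \<noteq> {}"
  using node_in_tube by (cases w) (auto simp: tb_def)

lemma compact_closure_tb: "compact (closure (tb w))"
  by (cases w) (simp only: tb_def prod.case compact_closure_tube)

text \<open>A tube and its parent share a node, so the maximum on the tube is at most that on the
  parent plus the oscillation on the tube. Ninth powers summed over a level give the recursion of
  \<open>weighted_level_sums\<close>, and the oscillation terms add up to a multiple of the integral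
  of \<open>g\<close> over the tree.\<close>

lemma maximal_values_summable:
  fixes V g :: "real^3 \<Rightarrow> real"
  assumes c: "\<And>w. w \<in> levels \<Longrightarrow> continuous_on (closure (tb w)) V"
    and g: "set_integrable lebesgue tree g" "\<And>x. 0 \<le> g x"
    and osc: "\<And>w x y. w \<in> levels \<Longrightarrow> x \<in> closure (tb w) \<Longrightarrow> y \<in> closure (tb w) \<Longrightarrow>
      \<bar>V x - V y\<bar> ^ 9 \<le> C * (LINT x:tb w|lebesgue. g x) / ht (fst w) ^ 8" and C: "0 \<le> C"
  obtains S where "\<And>w x. w \<in> levels \<Longrightarrow> x \<in> closure (tb w) \<Longrightarrow> \<bar>V x\<bar> \<le> S w"
    "\<And>w. w \<in> levels \<Longrightarrow> 0 \<le> S w"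
    "summable (\<lambda>k. ht k ^ 8 * (\<Sum>w\<in>level k. S w ^ 9))"
proof -
  have "\<forall>w\<in>levels. \<exists>x. x \<in> closure (tb w) \<and> (\<forall>y\<in>closure (tb w). \<bar>V y\<bar> \<le> \<bar>V x\<bar>)"
    using continuous_attains_sup[OF compact_closure_tb closure_tb_nonempty continuous_on_rabs[OF c]] by blast
  from bchoice[OF this] obtain X where X: "\<And>w. w \<in> levels \<Longrightarrow> X w \<in> closure (tb w)"
    "\<And>w y. w \<in> levels \<Longrightarrow> y \<in> closure (tb w) \<Longrightarrow> \<bar>V y\<bar> \<le> \<bar>V (X w)\<bar>"
    by blast
  define S where "S w = \<bar>V (X w)\<bar>" for w
  define I where "I w = (LINT x:tb w|lebesgue. g x)" for w
  have I0: "0 \<le> I w" for w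
    unfolding I_def set_lebesgue_integral_def by (intro Bochner_Integration.integral_nonneg) (simp add: g(2))
  have parent: "S w ^ 9 \<le> 2 * S (k, fst (snd w) div 2, snd (snd w) div 2) ^ 9 + 17 ^ 9 * (C * I w / ht (Suc k) ^ 8)"
    if w: "w \<in> level (Suc k)" for w k
  proof -
    obtain i j where eq: "w = (Suc k, i, j)" and ij: "i < 2 ^ Suc k" "j < 2 ^ Suc k"
      using w by (auto simp: level_def)
    have wl: "w \<in> levels" and pl: "(k, i div 2, j div 2) \<in> levels" using ij by (auto simp: levels_def eq)
    let ?n = "node k (i div 2) (j div 2)"
    have n: "?n \<in> closure (tb w)" "?n \<in> closure (tb (k, i div 2, j div 2))"
      using node_in_child node_in_tube closure_subset by (auto simp: eq tb_def intro: subsetD[OF closure_subset])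
    have "S w \<le> \<bar>V ?n\<bar> + \<bar>V (X w) - V ?n\<bar>" by (simp add: S_def)
    also have "\<bar>V ?n\<bar> \<le> S (k, i div 2, j div 2)" unfolding S_def by (rule X(2)[OF pl n(2)])
    finally have "S w \<le> S (k, i div 2, j div 2) + \<bar>V (X w) - V ?n\<bar>" by simp
    then have "S w ^ 9 \<le> (S (k, i div 2, j div 2) + \<bar>V (X w) - V ?n\<bar>) ^ 9"
      by (rule power_mono) (simp add: S_def)
    also have "\<dots> \<le> 2 * S (k, i div 2, j div 2) ^ 9 + 17 ^ 9 * \<bar>V (X w) - V ?n\<bar> ^ 9"
      by (rule power9_sum_le) (auto simp: S_def)
    also have "\<dots> \<le> 2 * S (k, i div 2, j div 2) ^ 9 + 17 ^ 9 * (C * I w / ht (Suc k) ^ 8)"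
      using osc[OF wl X(1)[OF wl] n(1)] by (intro add_left_mono mult_left_mono) (auto simp: I_def eq)
    finally show ?thesis by (simp add: eq)
  qed
  define m where "m k = (\<Sum>w\<in>level k. S w ^ 9)" for k
  define A where "A k = (\<Sum>w\<in>level k. I w)" for k
  have m0: "0 \<le> m k" for k unfolding m_def S_def by (intro sum_nonneg) auto
  have A0: "0 \<le> A k" for k unfolding A_def by (intro sum_nonneg I0)
  have step: "m (Suc k) \<le> 8 * m k + (17 ^ 9 * C) * A (Suc k) / ht (Suc k) ^ 8" for k
  proof -
    have "m (Suc k) \<le> (\<Sum>w\<in>level (Suc k). 2 * S (k, fst (snd w) div 2, snd (snd w) div 2) ^ 9
        + 17 ^ 9 * (C * I w / ht (Suc k) ^ 8))"
      unfolding m_def by (intro sum_mono parent)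
    also have "\<dots> = 2 * (\<Sum>w\<in>level (Suc k). S (k, fst (snd w) div 2, snd (snd w) div 2) ^ 9)
        + (17 ^ 9 * C / ht (Suc k) ^ 8) * A (Suc k)"
      unfolding sum.distrib A_def sum_distrib_left by (simp add: mult.assoc)
    also have "(\<Sum>w\<in>level (Suc k). S (k, fst (snd w) div 2, snd (snd w) div 2) ^ 9) = 4 * m k"
      unfolding m_def by (rule sum_level_parent[where f = "\<lambda>w. S w ^ 9"])
    finally show ?thesis by simp
  qed
  have B: "(\<Sum>k<n. A k) \<le> 8 * (LINT x:tree|lebesgue. g x)" for n
    unfolding A_def I_def by (rule sum_tube_integrals[OF g])
  have "summable (\<lambda>k. ht k ^ 8 * m k)"
  proof (rule bounded_imp_summable)
    show "0 \<le> ht k ^ 8 * m k" for k using m0 ht_pos[of k] by simp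
    show "(\<Sum>k\<le>n. ht k ^ 8 * m k) \<le> 2 * (m 0 + (17 ^ 9 * C) * (8 * (LINT x:tree|lebesgue. g x)))" for n
      using weighted_level_sums[OF m0 A0 _ step B, of "Suc n"] C by (simp add: lessThan_Suc_atMost)
  qed
  then show ?thesis
    using that[of S] X(2) by (auto simp: m_def S_def)
qed

text \<open>The indicators of the sets, weighted by \<open>c\<close>, sum to a majorant of
  \<open>f\<close>; overlaps of the sets only increase it.\<close>

lemma nn_integral_levels:
  fixes f :: "real^3 \<Rightarrow> ennreal"
  assumes E: "\<And>w. w \<in> levels \<Longrightarrow> E w \<in> sets M"
    and le: "\<And>w x. w \<in> levels \<Longrightarrow> x \<in> E w \<Longrightarrow> f x \<le> c w"
    and off: "\<And>x. x \<in> space M \<Longrightarrow> f x \<noteq> 0 \<Longrightarrow> \<exists>w\<in>levels. x \<in> E w"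
  shows "(\<integral>\<^sup>+x. f x \<partial>M) \<le> (\<Sum>k. \<Sum>w\<in>level k. c w * emeasure M (E w))"
proof -
  have "(\<integral>\<^sup>+x. f x \<partial>M) \<le> (\<integral>\<^sup>+x. (\<Sum>k. \<Sum>w\<in>level k. c w * indicator (E w) x) \<partial>M)"
  proof (rule nn_integral_mono)
    fix x assume x: "x \<in> space M"
    show "f x \<le> (\<Sum>k. \<Sum>w\<in>level k. c w * indicator (E w) x)"
    proof (cases "f x = 0")
      case False
      then obtain w where w: "w \<in> levels" "x \<in> E w" using off[OF x] by blast
      have wl: "w \<in> level (fst w)" using w by (auto simp: levels_def level_def)
      have "f x \<le> c w * indicator (E w) x" using le[OF w] w by simp
      also have "\<dots> \<le> (\<Sum>w\<in>level (fst w). c w * indicator (E w) x)"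
        by (rule member_le_sum[OF wl]) (auto simp: finite_level)
      also have "\<dots> = (\<Sum>k\<in>{fst w}. \<Sum>w\<in>level k. c w * indicator (E w) x)" by simp
      also have "\<dots> \<le> (\<Sum>k. \<Sum>w\<in>level k. c w * indicator (E w) x)"
        by (rule sum_le_suminf) auto
      finally show ?thesis .
    qed simp
  qed
  also have "\<dots> = (\<Sum>k. \<integral>\<^sup>+x. (\<Sum>w\<in>level k. c w * indicator (E w) x) \<partial>M)"
    using E level_subset_levels by (intro nn_integral_suminf borel_measurable_sum) auto
  also have "\<dots> = (\<Sum>k. \<Sum>w\<in>level k. c w * emeasure M (E w))"
    using E level_subset_levels
    by (intro suminf_cong) (auto simp: nn_integral_sum nn_integral_cmult_indicator intro!: sum.cong)
  finally show ?thesis .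
qed

text \<open>The common last step for the Hardy integral and the boundary integral:
  \<open>T w\<close> is the bound for the contribution of the tube \<open>w\<close> in either of
  them.\<close>

lemma suminf_levels_finite:
  assumes S: "\<And>w. w \<in> levels \<Longrightarrow> 0 \<le> S w" and sm: "summable (\<lambda>k. ht k ^ 8 * (\<Sum>w\<in>level k. S w ^ 9))"
    and B: "0 \<le> B"
    and le: "\<And>w. w \<in> levels \<Longrightarrow> T w \<le> ennreal (B * (ht (fst w) ^ 8 * S w ^ 9))"
  shows "(\<Sum>k. \<Sum>w\<in>level k. T w) < \<infinity>"
proof -
  have "(\<Sum>k. \<Sum>w\<in>level k. T w) \<le> (\<Sum>k. ennreal (B * (ht k ^ 8 * (\<Sum>w\<in>level k. S w ^ 9))))"
  proof (intro suminf_le)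
    fix k
    have "(\<Sum>w\<in>level k. T w) \<le> (\<Sum>w\<in>level k. ennreal (B * (ht k ^ 8 * S w ^ 9)))"
      using le level_subset_levels by (intro sum_mono) force
    also have "\<dots> = ennreal (\<Sum>w\<in>level k. B * (ht k ^ 8 * S w ^ 9))"
      using S level_subset_levels B ht_pos[of k] by (intro sum_ennreal) auto
    finally show "(\<Sum>w\<in>level k. T w) \<le> ennreal (B * (ht k ^ 8 * (\<Sum>w\<in>level k. S w ^ 9)))"
      by (simp add: sum_distrib_left)
  qed auto
  also have "\<dots> = ennreal (\<Sum>k. B * (ht k ^ 8 * (\<Sum>w\<in>level k. S w ^ 9)))"
  proof (intro suminf_ennreal2 summable_mult sm)
    fix k
    have "0 \<le> (\<Sum>w\<in>level k. S w ^ 9)" using S level_subset_levels by (intro sum_nonneg) auto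
    then show "0 \<le> B * (ht k ^ 8 * (\<Sum>w\<in>level k. S w ^ 9))" using B ht_pos[of k] by simp
  qed
  finally show ?thesis by (simp add: le_less_trans)
qed

section \<open>Cutting off near the bottom\<close>

text \<open>Vanishes up to height 1/n and tends to 1 at each positive height; for n = 0 it is
  identically 0.\<close>

definition cutoff :: "nat \<Rightarrow> real^3 \<Rightarrow> real" where
  "cutoff n x = rise (real n * x $ 3 - 1)"

definition cutoff_grad :: "nat \<Rightarrow> real^3 \<Rightarrow> real^3" where
  "cutoff_grad n x = (real n * rise' (real n * x $ 3 - 1)) *\<^sub>R axis 3 1"

lemma cutoff_tcd: "tcd k (cutoff n)"
proof -
  have eq: "cutoff n = (\<lambda>x. rise (-1 + real n * x $ 3))" by (simp add: cutoff_def fun_eq_iff)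
  show ?thesis unfolding eq
    by (rule tcd_compose_affine[OF _ tcd_rise])
      (intro bounded_linear_const_mult bounded_linear_vec_nth)
qed

lemma cutoff_has_derivative: "(cutoff n has_derivative (\<lambda>h. cutoff_grad n x \<bullet> h)) (at x)"
proof -
  have "((\<lambda>x::real^3. real n * x $ 3 - 1) has_derivative (\<lambda>h. real n * h $ 3)) (at x)"
    by (rule derivative_eq_intros bounded_linear_imp_has_derivative bounded_linear_vec_nth refl | simp)+
  from has_derivative_compose[OF this rise_has_derivative[unfolded has_field_derivative_def]]
  show ?thesis
    unfolding cutoff_def[abs_def] cutoff_grad_def by (simp add: inner_axis' ac_simps)
qed

lemma cutoff_continuous: "continuous_on S (cutoff n)"
  using tcd_continuous cutoff_tcd by blast

lemma cutoff_grad_continuous: "continuous_on S (cutoff_grad n)"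
proof -
  have "continuous_on UNIV rise'" using tcd_continuous tcd_rise' by blast
  then have "continuous_on S (\<lambda>x::real^3. rise' (real n * x $ 3 - 1))"
    by (rule continuous_on_compose2) (auto intro!: continuous_intros)
  then show ?thesis unfolding cutoff_grad_def by (intro continuous_intros)
qed

lemma cutoff_bounds: "0 \<le> cutoff n x" "cutoff n x \<le> 1"
  by (auto simp: cutoff_def rise_bounds)

lemma cutoff_zero: "real n * x $ 3 \<le> 1 \<Longrightarrow> cutoff n x = 0"
  by (simp add: cutoff_def rise_bounds)

lemma filterlim_cut_argument:
  assumes "0 < z"
  shows "filterlim (\<lambda>n. real n * z - 1) at_top sequentially"
proof -
  have "filterlim (\<lambda>n. z * real n) at_top sequentially"
    by (rule filterlim_tendsto_pos_mult_at_top[OF tendsto_const assms filterlim_real_sequentially])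
  from filterlim_tendsto_add_at_top[OF tendsto_const[of "-1"] this] show ?thesis
    by (simp add: mult.commute)
qed

lemma cutoff_tendsto: "0 < x $ 3 \<Longrightarrow> (\<lambda>n. cutoff n x) \<longlonglongrightarrow> 1"
  unfolding cutoff_def by (rule filterlim_compose[OF tendsto_rise filterlim_cut_argument])

lemma norm_cut_grad: "norm (cutoff_grad n x) = real n * rise' (real n * x $ 3 - 1)"
  by (simp add: cutoff_grad_def norm_axis_1 rise'_nonneg)

lemma cutoff_grad_bound: "0 < x $ 3 \<Longrightarrow> norm (cutoff_grad n x) \<le> 3 / x $ 3"
  using rise'_bound[of "real n * x $ 3 - 1"] by (simp add: norm_cut_grad field_simps)

lemma cutoff_grad_tendsto:
  assumes "0 < x $ 3"
  shows "(\<lambda>n. norm (cutoff_grad n x)) \<longlonglongrightarrow> 0"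
proof -
  have "(\<lambda>n. (1 / x $ 3) * ((real n * x $ 3 - 1 + 1) * rise' (real n * x $ 3 - 1))) \<longlonglongrightarrow> (1 / x $ 3) * 0"
    by (intro tendsto_mult tendsto_const filterlim_compose[OF tendsto_rise' filterlim_cut_argument] assms)
  then show ?thesis using assms by (simp add: norm_cut_grad)
qed

section \<open>Convergence of the cut-offs in the Sobolev norm\<close>

lemma powr_add_le:
  fixes a b p :: real
  assumes "0 \<le> a" "0 \<le> b" "0 \<le> p"
  shows "(a + b) powr p \<le> 2 powr p * (a powr p + b powr p)"
proof -
  have "(a + b) powr p \<le> (2 * max a b) powr p" using assms by (intro powr_mono2) auto
  also have "\<dots> = 2 powr p * max a b powr p" using assms by (simp add: powr_mult)
  also have "\<dots> \<le> 2 powr p * (a powr p + b powr p)"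
    by (intro mult_left_mono) (auto simp: max_def)
  finally show ?thesis .
qed

lemma Lp_norm_tendsto_zero:
  fixes f :: "nat \<Rightarrow> 'a \<Rightarrow> 'b::euclidean_space"
  assumes "1 \<le> p" and W: "integrable M W"
    and meas: "\<And>n. f n \<in> borel_measurable M"
    and bound: "\<And>n x. x \<in> space M \<Longrightarrow> norm (f n x) powr p \<le> W x"
    and lim: "\<And>x. x \<in> space M \<Longrightarrow> (\<lambda>n. norm (f n x)) \<longlonglongrightarrow> 0"
  shows "(\<lambda>n. Lp_norm M p (f n)) \<longlonglongrightarrow> 0 \<and> (\<forall>n. f n \<in> Lp_space M p)"
proof (intro conjI allI)
  have "(\<lambda>n. \<integral>x. norm (f n x) powr p \<partial>M) \<longlonglongrightarrow> (\<integral>x. 0 \<partial>M)"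
  proof (rule integral_dominated_convergence[OF _ _ W])
    show "(\<lambda>x. norm (f n x) powr p) \<in> borel_measurable M" for n using meas by measurable
    show "AE x in M. (\<lambda>n. norm (f n x) powr p) \<longlonglongrightarrow> 0"
    proof (rule AE_I2)
      fix x assume "x \<in> space M"
      then have "(\<lambda>n. norm (f n x) powr p) \<longlonglongrightarrow> 0 powr p"
        using assms(1) lim by (intro tendsto_powr') auto
      then show "(\<lambda>n. norm (f n x) powr p) \<longlonglongrightarrow> 0" by simp
    qed
    show "AE x in M. norm (norm (f n x) powr p) \<le> W x" for n using bound by (intro AE_I2) simp
  qed simp
  then have "(\<lambda>n. (\<integral>x. norm (f n x) powr p \<partial>M) powr (1 / p)) \<longlonglongrightarrow> 0 powr (1 / p)"
    using assms(1) by (intro tendsto_powr') auto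
  then show "(\<lambda>n. Lp_norm M p (f n)) \<longlonglongrightarrow> 0" by (simp add: Lp_norm_def)
next
  fix n
  have "integrable M (\<lambda>x. norm (f n x) powr p)"
  proof (rule Bochner_Integration.integrable_bound[OF W])
    show "(\<lambda>x. norm (f n x) powr p) \<in> borel_measurable M" using meas by measurable
    show "AE x in M. norm (norm (f n x) powr p) \<le> norm (W x)"
      using bound[of _ n] by (intro AE_I2) (auto intro: order_trans[OF _ abs_ge_self])
  qed
  then show "f n \<in> Lp_space M p" using meas by (simp add: Lp_space_def)
qed

lemma Lp_space_add:
  fixes f g :: "'a \<Rightarrow> 'b::euclidean_space"
  assumes "0 \<le> p" "f \<in> Lp_space M p" "g \<in> Lp_space M p"
  shows "(\<lambda>x. f x + g x) \<in> Lp_space M p"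
proof -
  have [measurable]: "f \<in> borel_measurable M" "g \<in> borel_measurable M"
    using assms by (auto simp: Lp_space_def)
  have "integrable M (\<lambda>x. 2 powr p * (norm (f x) powr p + norm (g x) powr p))"
    using assms by (intro integrable_mult_right Bochner_Integration.integrable_add) (auto simp: Lp_space_def)
  then have "integrable M (\<lambda>x. norm (f x + g x) powr p)"
  proof (rule Bochner_Integration.integrable_bound)
    show "AE x in M. norm (norm (f x + g x) powr p) \<le> norm (2 powr p * (norm (f x) powr p + norm (g x) powr p))"
    proof (intro AE_I2)
      fix x
      have "norm (f x + g x) powr p \<le> (norm (f x) + norm (g x)) powr p"
        using assms by (intro powr_mono2 norm_triangle_ineq) auto
      also have "\<dots> \<le> 2 powr p * (norm (f x) powr p + norm (g x) powr p)"
        using assms by (intro powr_add_le) auto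
      finally show "norm (norm (f x + g x) powr p) \<le> norm (2 powr p * (norm (f x) powr p + norm (g x) powr p))"
        by simp
    qed
  qed measurable
  then show ?thesis by (simp add: Lp_space_def)
qed

text \<open>With \<theta> the cut-off, the gradient error is (\<theta> - 1) G + u grad \<theta>. The
  last term is at most 3 |u| / z and tends to 0 pointwise, so \<open>hardy\<close> provides the
  majorant for dominated convergence. For a Sobolev function this yields the approximants, for the
  constant 1 the non-uniqueness.\<close>

lemma cutoff_converges:
  fixes u :: "real^3 \<Rightarrow> real" and G :: "real^3 \<Rightarrow> real^3"
  assumes \<Omega>: "open \<Omega>" "\<And>x. x \<in> \<Omega> \<Longrightarrow> 0 < x $ 3" and p: "1 \<le> p"
    and w: "weak_gradient \<Omega> u G" and u: "u \<in> Lp_space (lebesgue_on \<Omega>) p" and G: "G \<in> Lp_space (lebesgue_on \<Omega>) p"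
    and hardy: "integrable (lebesgue_on \<Omega>) (\<lambda>x. (\<bar>u x\<bar> / x $ 3) powr p)"
  defines "v \<equiv> \<lambda>n x. cutoff n x * u x" and "H \<equiv> \<lambda>n x. cutoff n x *\<^sub>R G x + u x *\<^sub>R cutoff_grad n x"
  shows "weak_gradient \<Omega> (v n) (H n)" and "v n \<in> Lp_space (lebesgue_on \<Omega>) p" and "H n \<in> Lp_space (lebesgue_on \<Omega>) p"
    and "(\<lambda>n. Lp_norm (lebesgue_on \<Omega>) p (\<lambda>x. v n x - u x)) \<longlonglongrightarrow> 0"
    and "(\<lambda>n. Lp_norm (lebesgue_on \<Omega>) p (\<lambda>x. H n x - G x)) \<longlonglongrightarrow> 0"
proof -
  let ?M = "lebesgue_on \<Omega>"
  have \<Omega>m: "\<Omega> \<in> sets lebesgue" using \<Omega>(1) by simp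
  have sp: "space ?M = \<Omega>" by simp
  have [measurable]: "u \<in> borel_measurable ?M" "G \<in> borel_measurable ?M"
    using u G by (auto simp: Lp_space_def)
  have [measurable]: "cutoff n \<in> borel_measurable ?M" "cutoff_grad n \<in> borel_measurable ?M" for n
    using continuous_imp_measurable_on_sets_lebesgue[OF cutoff_continuous \<Omega>m]
      continuous_imp_measurable_on_sets_lebesgue[OF cutoff_grad_continuous \<Omega>m] by auto
  show "weak_gradient \<Omega> (v n) (H n)"
    unfolding v_def H_def
    by (rule weak_gradient_mult[OF w cutoff_tcd cutoff_grad_continuous cutoff_has_derivative])
  have ui: "integrable ?M (\<lambda>x. norm (u x) powr p)" and Gi: "integrable ?M (\<lambda>x. norm (G x) powr p)"
    using u G by (auto simp: Lp_space_def)
  define W where "W x = 2 powr p * (norm (G x) powr p + 3 powr p * (\<bar>u x\<bar> / x $ 3) powr p)" for x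
  have Wi: "integrable ?M W"
    unfolding W_def using Gi hardy by (intro integrable_mult_right Bochner_Integration.integrable_add)
  have c1: "\<bar>cutoff n x - 1\<bar> \<le> 1" for n x using cutoff_bounds[of n x] by auto
  have Wle: "norm y powr p \<le> W x" if x: "x \<in> \<Omega>" and y: "norm y \<le> norm (G x) + \<bar>u x\<bar> * norm (cutoff_grad n x)" for x y n
  proof -
    have "\<bar>u x\<bar> * norm (cutoff_grad n x) \<le> \<bar>u x\<bar> * (3 / x $ 3)"
      using cutoff_grad_bound[OF \<Omega>(2)[OF x], of n] by (rule mult_left_mono) simp
    moreover have "\<bar>u x\<bar> * (3 / x $ 3) = 3 * (\<bar>u x\<bar> / x $ 3)" by simp
    ultimately have "norm y \<le> norm (G x) + 3 * (\<bar>u x\<bar> / x $ 3)" using y by linarith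
    then have "norm y powr p \<le> (norm (G x) + 3 * (\<bar>u x\<bar> / x $ 3)) powr p"
      using p by (intro powr_mono2) auto
    also have "\<dots> \<le> 2 powr p * (norm (G x) powr p + (3 * (\<bar>u x\<bar> / x $ 3)) powr p)"
      using p \<Omega>(2)[OF x] by (intro powr_add_le) auto
    finally show ?thesis by (simp only: W_def powr_mult)
  qed
  have dv: "v n x - u x = (cutoff n x - 1) * u x" and dH: "H n x - G x = (cutoff n x - 1) *\<^sub>R G x + u x *\<^sub>R cutoff_grad n x" for n x
    by (auto simp: v_def H_def algebra_simps)
  have zero: "(\<lambda>n. \<bar>cutoff n x - 1\<bar> * c) \<longlonglongrightarrow> 0" if "x \<in> \<Omega>" for x c
  proof -
    have "(\<lambda>n. \<bar>cutoff n x - 1\<bar> * c) \<longlonglongrightarrow> \<bar>1 - 1\<bar> * c"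
      by (intro tendsto_intros cutoff_tendsto \<Omega>(2) that)
    then show ?thesis by simp
  qed
  have V: "(\<lambda>n. Lp_norm ?M p (\<lambda>x. v n x - u x)) \<longlonglongrightarrow> 0 \<and> (\<forall>n. (\<lambda>x. v n x - u x) \<in> Lp_space ?M p)"
  proof (rule Lp_norm_tendsto_zero[OF p ui])
    show "(\<lambda>x. v n x - u x) \<in> borel_measurable ?M" for n unfolding dv by measurable
    show "norm (v n x - u x) powr p \<le> norm (u x) powr p" for n x
      unfolding dv using p c1[of n x] by (intro powr_mono2) (auto simp: abs_mult mult_left_le_one_le)
    show "(\<lambda>n. norm (v n x - u x)) \<longlonglongrightarrow> 0" if "x \<in> space ?M" for x
      using zero[of x "\<bar>u x\<bar>"] that by (simp add: dv abs_mult)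
  qed
  have H: "(\<lambda>n. Lp_norm ?M p (\<lambda>x. H n x - G x)) \<longlonglongrightarrow> 0 \<and> (\<forall>n. (\<lambda>x. H n x - G x) \<in> Lp_space ?M p)"
  proof (rule Lp_norm_tendsto_zero[OF p Wi])
    show "(\<lambda>x. H n x - G x) \<in> borel_measurable ?M" for n unfolding dH by measurable
    have le: "norm (H n x - G x) \<le> \<bar>cutoff n x - 1\<bar> * norm (G x) + \<bar>u x\<bar> * norm (cutoff_grad n x)" for n x
      unfolding dH by (rule order_trans[OF norm_triangle_ineq]) simp
    show "norm (H n x - G x) powr p \<le> W x" if "x \<in> space ?M" for n x
    proof (rule Wle)
      show "x \<in> \<Omega>" using that by simp
      have "\<bar>cutoff n x - 1\<bar> * norm (G x) \<le> norm (G x)" using c1[of n x] by (simp add: mult_left_le_one_le)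
      then show "norm (H n x - G x) \<le> norm (G x) + \<bar>u x\<bar> * norm (cutoff_grad n x)"
        using le[of n x] by linarith
    qed
    show "(\<lambda>n. norm (H n x - G x)) \<longlonglongrightarrow> 0" if "x \<in> space ?M" for x
    proof (rule tendsto_sandwich[OF _ _ tendsto_const])
      have x: "x \<in> \<Omega>" using that by simp
      have "(\<lambda>n. \<bar>cutoff n x - 1\<bar> * norm (G x) + \<bar>u x\<bar> * norm (cutoff_grad n x)) \<longlonglongrightarrow> 0 + \<bar>u x\<bar> * 0"
        by (intro tendsto_intros zero[OF x] cutoff_grad_tendsto \<Omega>(2) x)
      then show "(\<lambda>n. \<bar>cutoff n x - 1\<bar> * norm (G x) + \<bar>u x\<bar> * norm (cutoff_grad n x)) \<longlonglongrightarrow> 0" by simp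
    qed (use le in auto)
  qed
  show "(\<lambda>n. Lp_norm ?M p (\<lambda>x. v n x - u x)) \<longlonglongrightarrow> 0" "(\<lambda>n. Lp_norm ?M p (\<lambda>x. H n x - G x)) \<longlonglongrightarrow> 0"
    using V H by blast+
  show "v n \<in> Lp_space ?M p" using Lp_space_add[OF _ V[THEN conjunct2, rule_format, of n] u] p by simp
  show "H n \<in> Lp_space ?M p" using Lp_space_add[OF _ H[THEN conjunct2, rule_format, of n] G] p by simp
qed

section \<open>Traces on the boundary of the tree\<close>

text \<open>The estimates below use only the bounds \<open>S\<close> on the closed tubes and their
  weighted sums, not a gradient, so they cover both the representative of a Sobolev function and the
  constant 1.\<close>

locale tree_function =
  fixes V :: "real^3 \<Rightarrow> real" and S :: "nat \<times> nat \<times> nat \<Rightarrow> real"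
  assumes V: "\<And>w. w \<in> levels \<Longrightarrow> continuous_on (closure (tb w)) V"
    and S: "\<And>w x. w \<in> levels \<Longrightarrow> x \<in> closure (tb w) \<Longrightarrow> \<bar>V x\<bar> \<le> S w"
    and S0: "\<And>w. w \<in> levels \<Longrightarrow> 0 \<le> S w"
    and sm: "summable (\<lambda>k. ht k ^ 8 * (\<Sum>w\<in>level k. S w ^ 9))"
begin

lemma V_continuous_tree: "continuous_on tree V"
  unfolding tree_def
  by (rule continuous_on_open_UN) (auto intro: open_tb continuous_on_subset[OF V closure_subset])

lemma tree_measurable: "tree \<in> sets lebesgue"
  using open_tree by simp

lemma V_measurable_tree: "V \<in> borel_measurable (lebesgue_on tree)"
  by (rule continuous_imp_measurable_on_sets_lebesgue[OF V_continuous_tree tree_measurable])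

text \<open>On a tube of level \<open>k\<close> the height exceeds h = \<open>ht k\<close> and the
  volume is at most h^17, so its contribution is at most (S / h)^9 h^17 = h^8 S^9.\<close>

lemma hardy: "integrable (lebesgue_on tree) (\<lambda>x. (\<bar>V x\<bar> / x $ 3) powr 9)"
proof (rule integrableI_bounded)
  let ?M = "lebesgue_on tree"
  have z: "(\<lambda>x. x $ 3) \<in> borel_measurable ?M"
    by (rule continuous_imp_measurable_on_sets_lebesgue[OF _ tree_measurable]) (intro continuous_intros)
  show "(\<lambda>x. (\<bar>V x\<bar> / x $ 3) powr 9) \<in> borel_measurable ?M"
    using V_measurable_tree z by measurable
  have "(\<integral>\<^sup>+x. ennreal (norm ((\<bar>V x\<bar> / x $ 3) powr 9)) \<partial>?M)
      \<le> (\<Sum>k. \<Sum>w\<in>level k. ennreal ((S w / ht (fst w)) ^ 9) * emeasure ?M (tb w))"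
  proof (rule nn_integral_levels)
    show "tb w \<in> sets ?M" if "w \<in> levels" for w
      using that tree_measurable open_tb[of w] tb_subset_tree by (simp add: sets_restrict_space_iff)
    show "ennreal (norm ((\<bar>V x\<bar> / x $ 3) powr 9)) \<le> ennreal ((S w / ht (fst w)) ^ 9)"
      if w: "w \<in> levels" "x \<in> tb w" for w x
    proof (rule ennreal_leI)
      have h: "ht (fst w) < x $ 3" using w by (cases w) (auto simp: tb_def tube_def)
      have "\<bar>V x\<bar> / x $ 3 \<le> S w / ht (fst w)"
        using S[OF w(1), of x] w(2) closure_subset[of "tb w"] h ht_pos[of "fst w"] S0[OF w(1)]
        by (intro frac_le) auto
      moreover have nn: "0 \<le> \<bar>V x\<bar> / x $ 3" using h ht_pos[of "fst w"] by simp
      ultimately have "(\<bar>V x\<bar> / x $ 3) ^ 9 \<le> (S w / ht (fst w)) ^ 9" by (rule power_mono)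
      then show "norm ((\<bar>V x\<bar> / x $ 3) powr 9) \<le> (S w / ht (fst w)) ^ 9" using nn by simp
    qed
    show "\<exists>w\<in>levels. x \<in> tb w" if "x \<in> space ?M" for x using that by (auto simp: tree_def)
  qed
  also have "\<dots> < \<infinity>"
  proof (rule suminf_levels_finite[OF S0 sm, of 1])
    fix w assume w: "w \<in> levels"
    obtain k i j where eq: "w = (k, i, j)" by (metis prod_cases3)
    have "emeasure ?M (tb w) = emeasure lebesgue (tb w)"
      using tree_measurable tb_subset_tree[OF w] by (intro emeasure_restrict_space) auto
    also have "\<dots> = emeasure lborel (tube k i j)"
      using open_tube[of k i j] by (simp add: eq tb_def)
    also have "\<dots> \<le> ennreal (ht k ^ 17)" by (rule emeasure_tube)
    finally have "ennreal ((S w / ht (fst w)) ^ 9) * emeasure ?M (tb w) \<le> ennreal ((S w / ht k) ^ 9) * ennreal (ht k ^ 17)"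
      by (intro mult_mono) (auto simp: eq)
    also have "\<dots> = ennreal ((S w / ht k) ^ 9 * ht k ^ 17)"
      using S0[OF w] ht_pos[of k] by (intro ennreal_mult[symmetric]) auto
    also have "(S w / ht k) ^ 9 * ht k ^ 17 = 1 * (ht (fst w) ^ 8 * S w ^ 9)"
      using ht_pos[of k] by (simp add: eq power_divide power_numeral_reduce)
    finally show "ennreal ((S w / ht (fst w)) ^ 9) * emeasure ?M (tb w) \<le> ennreal (1 * (ht (fst w) ^ 8 * S w ^ 9))" .
  qed auto
  finally show "(\<integral>\<^sup>+x. ennreal (norm ((\<bar>V x\<bar> / x $ 3) powr 9)) \<partial>?M) < \<infinity>" .
qed

text \<open>Above height 1/n only finitely many closed tubes occur, and \<open>V\<close> is
  continuous on their union; up to that height the product is 0. The two closed pieces cover the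
  closure of the tree.\<close>

lemma cutoff_V_continuous: "continuous_on (closure tree) (\<lambda>x. cutoff n x * V x)"
proof (cases "n = 0")
  case True
  then show ?thesis by (simp add: cutoff_zero)
next
  case False
  define z0 where "z0 = 1 / real n"
  have z0: "0 < z0" using False by (simp add: z0_def)
  obtain N where N: "\<And>k i j v. v \<in> ctube k i j \<Longrightarrow> z0 < v $ 3 \<Longrightarrow> k < N"
    using tubes_above_finite[OF z0] by metis
  define W where "W = (\<Union>k<N. level k)"
  have W: "finite W" "W \<subseteq> levels" using level_subset_levels by (auto simp: W_def finite_level)
  let ?F = "\<Union>w\<in>W. closure (tb w)"
  let ?L = "{x :: real^3. x $ 3 \<le> z0}"
  have F: "closed ?F" "continuous_on ?F V"
    using W V by (auto intro!: closed_UN continuous_on_closed_Union)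
  have L: "closed ?L" by (intro closed_Collect_le continuous_intros)
  have zero: "cutoff n x * V x = 0" if "x \<in> ?L" for x
  proof -
    have "real n * x $ 3 \<le> real n * z0" using that by (intro mult_left_mono) auto
    also have "\<dots> = 1" using False by (simp add: z0_def)
    finally show ?thesis by (simp add: cutoff_zero)
  qed
  have "continuous_on ?L (\<lambda>x. cutoff n x * V x) \<longleftrightarrow> continuous_on ?L (\<lambda>x. 0 :: real)"
    by (rule continuous_on_cong) (use zero in auto)
  then have "continuous_on (?F \<union> ?L) (\<lambda>x. cutoff n x * V x)"
    by (intro continuous_on_closed_Un[OF F(1) L continuous_on_mult[OF cutoff_continuous F(2)]]) auto
  moreover have "tree \<subseteq> ?F \<union> ?L"
  proof
    fix x assume "x \<in> tree"
    then obtain k i j where w: "(k, i, j) \<in> levels" "x \<in> tube k i j" by (auto simp: tree_def tb_def)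
    show "x \<in> ?F \<union> ?L"
    proof (cases "x \<in> ?L")
      case False
      then have "k < N" using N[of x k i j] w tube_subset_ctube by auto
      then have "(k, i, j) \<in> W" using w by (auto simp: W_def level_def levels_def)
      then show ?thesis
        by (intro UnI1, rule UN_I) (use w closure_subset[of "tube k i j"] in \<open>auto simp: tb_def\<close>)
    qed simp
  qed
  then have "closure tree \<subseteq> ?F \<union> ?L" using F L by (intro closure_minimal closed_Un)
  ultimately show ?thesis by (rule continuous_on_subset)
qed

end

section \<open>The boundary measure of the tree and the limit of the boundary values\<close>

abbreviation bdry :: "(real^3) measure" where "bdry \<equiv> boundary_measure tree"

lemma frontier_tree_sets: "frontier tree \<in> sets (hausdorff_measure 2)"
  by (simp add: borel_closed frontier_closed)

lemma space_boundary: "space bdry = frontier tree"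
  by (simp add: boundary_measure_def space_restrict_space)

lemma sets_boundary: "A \<subseteq> frontier tree \<Longrightarrow> A \<in> sets borel \<Longrightarrow> A \<in> sets bdry"
  using frontier_tree_sets by (simp add: boundary_measure_def sets_restrict_space_iff)

lemma emeasure_boundary: "A \<subseteq> frontier tree \<Longrightarrow> A \<in> sets borel \<Longrightarrow> emeasure bdry A = hausdorff_outer 2 A"
  using frontier_tree_sets
  by (simp add: boundary_measure_def emeasure_restrict_space emeasure_hausdorff_measure)

lemma boundary_measurable_continuous:
  assumes "continuous_on (frontier tree) f"
  shows "f \<in> borel_measurable bdry"
proof -
  have "sets (restrict_space borel (frontier tree)) = sets bdry"
    unfolding boundary_measure_def by (intro sets_restrict_space_cong) simp
  then show ?thesis
    using borel_measurable_continuous_on_restrict[OF assms] measurable_cong_sets by blast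
qed

lemma finite_boundary: "finite_measure bdry"
proof
  have "emeasure bdry (space bdry) = hausdorff_outer 2 (frontier tree)"
    unfolding space_boundary by (rule emeasure_boundary) (auto simp: borel_closed frontier_closed)
  then show "emeasure bdry (space bdry) \<noteq> \<infinity>" using hausdorff_outer_frontier_tree by simp
qed

context tree_function
begin

lemma cutoff_V_measurable_boundary: "(\<lambda>x. cutoff n x * V x) \<in> borel_measurable bdry"
  by (rule boundary_measurable_continuous, rule continuous_on_subset[OF cutoff_V_continuous])
    (simp add: frontier_def)

lemma cutoff_V_tendsto: "(\<lambda>n. cutoff n x * V x) \<longlonglongrightarrow> (if 0 < x $ 3 then V x else 0)"
proof (cases "0 < x $ 3")
  case True
  then have "(\<lambda>n. cutoff n x * V x) \<longlonglongrightarrow> 1 * V x" by (intro tendsto_mult cutoff_tendsto tendsto_const)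
  then show ?thesis using True by simp
next
  case False
  then have "real n * x $ 3 \<le> 0" for n by (intro mult_nonneg_nonpos) auto
  then have "real n * x $ 3 \<le> 1" for n by (rule order_trans) simp
  then show ?thesis using False by (simp add: cutoff_zero)
qed

text \<open>The value 0 on the floor is forced, since every cut-off vanishes there whatever
  \<open>V\<close> does in the tubes accumulating at it. For the constant 1 it differs from the
  boundary value of the constant itself.\<close>

definition bd_trace :: "real^3 \<Rightarrow> real" where
  "bd_trace x = (if 0 < x $ 3 then V x else 0)"

lemma trace_measurable: "bd_trace \<in> borel_measurable bdry"
proof (rule borel_measurable_LIMSEQ_real)
  show "(\<lambda>n. cutoff n x * V x) \<longlonglongrightarrow> bd_trace x" for x
    unfolding bd_trace_def by (rule cutoff_V_tendsto)
qed (rule cutoff_V_measurable_boundary)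

text \<open>A frontier point at positive height lies on the frontier of some tube, whose area is at
  most 72 pi h^9; since h <= 1, this is at most 72 pi times the weight h^8.\<close>

lemma trace_integrable: "integrable bdry (\<lambda>x. norm (bd_trace x) powr 9)"
proof (rule integrableI_bounded)
  show "(\<lambda>x. norm (bd_trace x) powr 9) \<in> borel_measurable bdry" using trace_measurable by measurable
  let ?E = "\<lambda>w. frontier (tb w) \<inter> frontier tree"
  have Eb: "?E w \<in> sets borel" for w
    by (intro borel_closed closed_Int frontier_closed)
  have "(\<integral>\<^sup>+x. ennreal (norm (norm (bd_trace x) powr 9)) \<partial>bdry)
      \<le> (\<Sum>k. \<Sum>w\<in>level k. ennreal (S w ^ 9) * emeasure bdry (?E w))"
  proof (rule nn_integral_levels)
    show "?E w \<in> sets bdry" for w by (intro sets_boundary Eb) auto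
    show "ennreal (norm (norm (bd_trace x) powr 9)) \<le> ennreal (S w ^ 9)" if w: "w \<in> levels" "x \<in> ?E w" for w x
    proof (rule ennreal_leI)
      have "\<bar>bd_trace x\<bar> \<le> S w" using S[OF w(1), of x] w(2) S0[OF w(1)] by (auto simp: bd_trace_def frontier_def)
      then have "\<bar>bd_trace x\<bar> ^ 9 \<le> S w ^ 9" by (rule power_mono) simp
      then show "norm (norm (bd_trace x) powr 9) \<le> S w ^ 9" by simp
    qed
    show "\<exists>w\<in>levels. x \<in> ?E w" if "x \<in> space bdry" "ennreal (norm (norm (bd_trace x) powr 9)) \<noteq> 0" for x
      using that frontier_tree by (auto simp: space_boundary bd_trace_def split: if_splits)
  qed
  also have "\<dots> < \<infinity>"
  proof (rule suminf_levels_finite[OF S0 sm, of "72 * pi"])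
    fix w assume w: "w \<in> levels"
    obtain k i j where eq: "w = (k, i, j)" by (metis prod_cases3)
    have "emeasure bdry (?E w) = hausdorff_outer 2 (?E w)" by (intro emeasure_boundary Eb) auto
    also have "\<dots> \<le> hausdorff_outer 2 (frontier (tube k i j))"
      by (intro hausdorff_outer_mono) (auto simp: eq tb_def)
    also have "\<dots> \<le> ennreal (72 * pi * ht k ^ 9)" by (rule hausdorff_outer_frontier_tube)
    also have "\<dots> \<le> ennreal (72 * pi * ht k ^ 8)"
      using ht_pos[of k] ht_le_1[of k] by (intro ennreal_leI mult_left_mono power_decreasing) auto
    finally have "ennreal (S w ^ 9) * emeasure bdry (?E w) \<le> ennreal (S w ^ 9) * ennreal (72 * pi * ht k ^ 8)"
      by (intro mult_left_mono) auto
    also have "\<dots> = ennreal (S w ^ 9 * (72 * pi * ht k ^ 8))"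
      using S0[OF w] ht_pos[of k] by (intro ennreal_mult[symmetric]) auto
    also have "S w ^ 9 * (72 * pi * ht k ^ 8) = 72 * pi * (ht (fst w) ^ 8 * S w ^ 9)" by (simp add: eq)
    finally show "ennreal (S w ^ 9) * emeasure bdry (?E w) \<le> ennreal (72 * pi * (ht (fst w) ^ 8 * S w ^ 9))" .
  qed auto
  finally show "(\<integral>\<^sup>+x. ennreal (norm (norm (bd_trace x) powr 9)) \<partial>bdry) < \<infinity>" .
qed

text \<open>The cut-offs lie between 0 and 1, so the error is dominated by \<open>bd_trace\<close>
  itself.\<close>

lemma boundary_convergence:
  "(\<lambda>n. Lp_norm bdry 9 (\<lambda>x. cutoff n x * V x - bd_trace x)) \<longlonglongrightarrow> 0"
  "(\<lambda>x. cutoff n x * V x) \<in> Lp_space bdry 9"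
proof -
  have le: "\<bar>cutoff n x * V x - bd_trace x\<bar> \<le> \<bar>bd_trace x\<bar>" for n x
  proof (cases "0 < x $ 3")
    case True
    have "cutoff n x * V x - V x = (cutoff n x - 1) * V x" by (simp add: algebra_simps)
    moreover have "\<bar>(cutoff n x - 1) * V x\<bar> \<le> \<bar>V x\<bar>"
      using cutoff_bounds[of n x] by (simp add: abs_mult mult_left_le_one_le)
    ultimately show ?thesis using True by (simp add: bd_trace_def)
  next
    case False
    then have "real n * x $ 3 \<le> 0" by (intro mult_nonneg_nonpos) auto
    then show ?thesis using False by (simp add: bd_trace_def cutoff_zero)
  qed
  have *: "(\<lambda>n. Lp_norm bdry 9 (\<lambda>x. cutoff n x * V x - bd_trace x)) \<longlonglongrightarrow> 0 \<and>
    (\<forall>n. (\<lambda>x. cutoff n x * V x - bd_trace x) \<in> Lp_space bdry 9)"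
  proof (rule Lp_norm_tendsto_zero[OF _ trace_integrable])
    show "(\<lambda>x. cutoff n x * V x - bd_trace x) \<in> borel_measurable bdry" for n
      by (intro borel_measurable_diff cutoff_V_measurable_boundary trace_measurable)
    show "norm (cutoff n x * V x - bd_trace x) powr 9 \<le> norm (bd_trace x) powr 9" for n x
      using le[of n x] by (intro powr_mono2) auto
    have "(\<lambda>n. norm (cutoff n x * V x - bd_trace x)) \<longlonglongrightarrow> norm (bd_trace x - bd_trace x)" for x
      unfolding bd_trace_def by (intro tendsto_intros cutoff_V_tendsto)
    then show "(\<lambda>n. norm (cutoff n x * V x - bd_trace x)) \<longlonglongrightarrow> 0" for x by simp
  qed simp
  then show "(\<lambda>n. Lp_norm bdry 9 (\<lambda>x. cutoff n x * V x - bd_trace x)) \<longlonglongrightarrow> 0" by blast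
  have "bd_trace \<in> Lp_space bdry 9" using trace_measurable trace_integrable by (simp add: Lp_space_def)
  from Lp_space_add[OF _ *[THEN conjunct2, rule_format] this] show "(\<lambda>x. cutoff n x * V x) \<in> Lp_space bdry 9" by simp
qed

end

text \<open>The approximants are cut-offs of the representative \<open>V\<close>, not of
  \<open>u\<close>: the values of \<open>u\<close> off the open tree are arbitrary, whereas
  \<open>V\<close> is continuous on the closed tubes. As \<open>u\<close> and \<open>V\<close> agree
  almost everywhere on the tree, the Sobolev norms do not see the exchange.\<close>

lemma every_function_has_trace:
  assumes u: "u \<in> sobolev tree 9"
  shows "\<exists>\<phi>. approximative_trace tree 9 (L_q 9) u \<phi>"
proof -
  let ?M = "lebesgue_on tree"
  have tm: "tree \<in> sets lebesgue" using open_tree by simp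
  obtain G where w: "weak_gradient tree u G" and GL: "G \<in> Lp_space ?M 9" and uL: "u \<in> Lp_space ?M 9"
    using u by (auto simp: sobolev_def)
  have G9: "set_integrable lebesgue tree (\<lambda>x. norm (G x) powr 9)"
    using GL tm by (simp add: Lp_space_def integrable_restrict_space set_integrable_def)
  obtain V where V: "\<And>w. w \<in> levels \<Longrightarrow> continuous_on (closure (tb w)) V"
    and ae: "AE x in lebesgue. x \<in> tree \<longrightarrow> u x = V x"
    and osc: "\<And>w x y. w \<in> levels \<Longrightarrow> x \<in> closure (tb w) \<Longrightarrow> y \<in> closure (tb w) \<Longrightarrow>
      \<bar>V x - V y\<bar> ^ 9 \<le> osc_const * (LINT x:tb w|lebesgue. norm (G x) powr 9) / ht (fst w) ^ 8"
    by (rule tree_representative[OF w G9]) (rule that)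
  have oc: "0 \<le> osc_const" by (simp add: osc_const_def kernel_const_def rise_bounds)
  obtain S where S: "\<And>w x. w \<in> levels \<Longrightarrow> x \<in> closure (tb w) \<Longrightarrow> \<bar>V x\<bar> \<le> S w"
    "\<And>w. w \<in> levels \<Longrightarrow> 0 \<le> S w" "summable (\<lambda>k. ht k ^ 8 * (\<Sum>w\<in>level k. S w ^ 9))"
    by (rule maximal_values_summable[OF V G9 _ osc oc]) (auto intro: that)
  interpret tree_function V S by unfold_locales (use V S in auto)
  have wV: "weak_gradient tree V G" by (rule weak_gradient_cong_AE[OF w tm ae])
  have aeM: "AE x in ?M. u x = V x" using ae tm by (subst AE_restrict_space_iff) auto
  have VL: "V \<in> Lp_space ?M 9"
  proof -
    have "integrable ?M (\<lambda>x. norm (V x) powr 9)"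
    proof (rule integrable_cong_AE_imp)
      show "integrable ?M (\<lambda>x. norm (u x) powr 9)" using uL by (simp add: Lp_space_def)
      show "(\<lambda>x. norm (V x) powr 9) \<in> borel_measurable ?M" using V_measurable_tree by measurable
      show "AE x in ?M. norm (u x) powr 9 = norm (V x) powr 9" using aeM by eventually_elim simp
    qed
    then show ?thesis using V_measurable_tree by (simp add: Lp_space_def)
  qed
  define v where "v n x = cutoff n x * V x" for n x
  define H where "H n x = cutoff n x *\<^sub>R G x + V x *\<^sub>R cutoff_grad n x" for n x
  note cc = cutoff_converges[OF open_tree tree_third_pos _ wV VL GL hardy, folded v_def H_def]
  have vs: "v n \<in> sobolev tree 9" for n
    using cc(1-3)[of n] by (auto simp: sobolev_def v_def[abs_def] H_def[abs_def])
  have norm_eq: "Lp_norm ?M 9 (\<lambda>x. v n x - u x) = Lp_norm ?M 9 (\<lambda>x. v n x - V x)" for n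
  proof -
    have [measurable]: "u \<in> borel_measurable ?M" "V \<in> borel_measurable ?M" "v n \<in> borel_measurable ?M"
      using uL VL vs[of n] by (auto simp: Lp_space_def sobolev_def)
    have "(\<integral>x. norm (v n x - u x) powr 9 \<partial>?M) = (\<integral>x. norm (v n x - V x) powr 9 \<partial>?M)"
      by (rule integral_cong_AE) (use aeM in auto)
    then show ?thesis by (simp add: Lp_norm_def)
  qed
  have "sobolev_tendsto tree 9 v u"
    unfolding sobolev_tendsto_def
  proof (intro conjI allI exI[of _ H] exI[of _ G])
    show "weak_gradient tree (v n) (H n)" "H n \<in> Lp_space ?M 9" for n
      using cc(1,3)[of n] by (auto simp: v_def[abs_def] H_def[abs_def])
    show "(\<lambda>n. Lp_norm ?M 9 (\<lambda>x. v n x - u x)) \<longlonglongrightarrow> 0"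
      using cc(4) by (simp add: norm_eq)
    show "(\<lambda>n. Lp_norm ?M 9 (\<lambda>x. H n x - G x)) \<longlonglongrightarrow> 0" using cc(5) by simp
  qed (use vs u w GL in auto)
  moreover have "bd_trace \<in> Lp_space bdry 9" using trace_measurable trace_integrable by (simp add: Lp_space_def)
  ultimately have "approximative_trace tree 9 (L_q 9) u bd_trace"
    unfolding approximative_trace_def
    using u vs cutoff_V_continuous boundary_convergence
    by (auto simp: v_def[abs_def] intro!: exI[of _ v])
  then show ?thesis by blast
qed

text \<open>The 4^k tubes of level \<open>k\<close>, weighted by 256^-k, give a geometric series of
  ratio 1/64.\<close>

lemma tree_function_one: "tree_function (\<lambda>_. 1) (\<lambda>_. 1)"
proof
  have "ht k ^ 8 * (\<Sum>w\<in>level k. 1 ^ 9) = (1 / 64) ^ k" for k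
  proof -
    have "ht k ^ 8 = (1 / 256) ^ k" by (simp add: ht_def power_mult[symmetric] mult.commute[of k] power_mult power_divide)
    then show ?thesis by (simp add: card_level power_mult_distrib[symmetric])
  qed
  then show "summable (\<lambda>k. ht k ^ 8 * (\<Sum>w\<in>level k. 1 ^ 9))"
    by (simp only:) (intro summable_geometric, simp)
qed auto

text \<open>The functions 1 - \<open>cutoff n\<close> are continuous on all of space, tend to 0 in
  the Sobolev space and equal 1 on the floor, a part of the frontier of positive area.\<close>

lemma not_unique: "approximative_trace_not_unique tree 9"
proof -
  let ?M = "lebesgue_on tree"
  interpret tree_function "\<lambda>_. 1" "\<lambda>_. 1" by (rule tree_function_one)
  interpret fm: finite_measure bdry by (rule finite_boundary)
  have tm: "tree \<in> sets lebesgue" using open_tree by simp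
  have "bounded tree"
  proof (rule boundedI)
    fix v assume v: "v \<in> tree"
    then obtain k i j where "v \<in> tube k i j" by (auto simp: tree_def tb_def)
    then have "\<bar>v $ 3\<bar> \<le> 3" using rad_le[of k] ht_le_1[of k] ht_pos[of k] by (auto simp: tube_def)
    then show "norm v \<le> 11" using norm_le_sum_3[of v] tree_component_bounds[OF v] by linarith
  qed
  then have "emeasure lebesgue tree < \<infinity>"
    using emeasure_bounded_finite[of tree] open_tree by simp
  then have "integrable lebesgue (indicator tree :: real^3 \<Rightarrow> real)"
    using tm by (intro integrable_real_indicator) auto
  then have one: "(\<lambda>_. 1 :: real) \<in> Lp_space ?M 9"
    using tm by (simp add: Lp_space_def integrable_restrict_space)
  have zero: "(\<lambda>_. 0) \<in> Lp_space ?M 9" by (simp add: Lp_space_def)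
  \<comment> \<open>For u = 1 and gradient 0 the gradients of the products are those of the
    cut-offs, so these tend to 0 in the norm.\<close>
  note cc = cutoff_converges[OF open_tree tree_third_pos _ weak_gradient_const one zero hardy, simplified]
  have cL: "cutoff n \<in> Lp_space ?M 9" "cutoff_grad n \<in> Lp_space ?M 9" for n using cc(2,3)[of n] by auto
  define v where "v n x = 1 - cutoff n x" for n x
  have vw: "weak_gradient tree (v n) (\<lambda>x. - cutoff_grad n x)" for n
  proof -
    have t: "tcd k (\<lambda>x. 1 + (- 1) * cutoff n x)" for k by (intro tcd_add tcd_mult tcd_const cutoff_tcd)
    have d: "((\<lambda>x. 1 + (- 1) * cutoff n x) has_derivative (\<lambda>h. (- cutoff_grad n x) \<bullet> h)) (at x)" for x
      by (rule derivative_eq_intros cutoff_has_derivative refl | simp)+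
    have "weak_gradient tree (\<lambda>x. (1 + (- 1) * cutoff n x) * 1) (\<lambda>x. (1 + (- 1) * cutoff n x) *\<^sub>R 0 + 1 *\<^sub>R (- cutoff_grad n x))"
      by (rule weak_gradient_mult[OF weak_gradient_const t _ d]) (intro continuous_intros cutoff_grad_continuous)
    then show ?thesis by (simp add: v_def[abs_def])
  qed
  have neg: "(\<lambda>x. - f x) \<in> Lp_space ?M 9" if "f \<in> Lp_space ?M 9" for f :: "real^3 \<Rightarrow> 'b::euclidean_space"
    using that by (auto simp: Lp_space_def)
  have vL: "v n \<in> Lp_space ?M 9" for n
    using Lp_space_add[OF _ one neg[OF cL(1)[of n]]] by (simp add: v_def[abs_def])
  have vs: "v n \<in> sobolev tree 9" for n
    using vL vw neg[OF cL(2)[of n]] by (auto simp: sobolev_def)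
  have w0: "weak_gradient tree (\<lambda>_. 0) (\<lambda>_. 0)"
    by (intro weak_gradientI locally_integrable_continuous) auto
  have zs: "(\<lambda>_. 0) \<in> sobolev tree 9" using w0 by (auto simp: sobolev_def Lp_space_def)
  have st: "sobolev_tendsto tree 9 v (\<lambda>_. 0)"
    unfolding sobolev_tendsto_def
  proof (intro conjI allI exI[of _ "\<lambda>n x. - cutoff_grad n x"] exI[of _ "\<lambda>_. 0"])
    show "(\<lambda>x. - cutoff_grad n x) \<in> Lp_space ?M 9" for n by (rule neg[OF cL(2)])
    show "(\<lambda>n. Lp_norm ?M 9 (\<lambda>x. v n x - 0)) \<longlonglongrightarrow> 0"
      using cc(4) by (simp add: Lp_norm_def v_def abs_minus_commute)
    show "(\<lambda>n. Lp_norm ?M 9 (\<lambda>x. - cutoff_grad n x - 0)) \<longlonglongrightarrow> 0"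
      using cc(5) by (simp add: Lp_norm_def)
  qed (use vs zs vw w0 zero in auto)
  define \<phi> :: "real^3 \<Rightarrow> real" where "\<phi> x = 1 - bd_trace x" for x
  have \<phi>m: "\<phi> \<in> borel_measurable bdry" unfolding \<phi>_def[abs_def] using trace_measurable by measurable
  have vm: "v n \<in> borel_measurable bdry" for n
    unfolding v_def[abs_def] using cutoff_V_measurable_boundary[of n] by simp
  have bd: "set_integrable bdry K f" if "compact K" "K \<subseteq> frontier tree" "f \<in> borel_measurable bdry" "\<And>x. \<bar>f x\<bar> \<le> 1" for K and f :: "real^3 \<Rightarrow> real"
  proof -
    have "integrable bdry f"
      by (rule fm.integrable_const_bound[where B = 1]) (use that in auto)
    moreover have "K \<in> sets bdry" using that by (intro sets_boundary) (auto simp: borel_compact)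
    ultimately show ?thesis unfolding set_integrable_def by (intro integrable_mult_indicator)
  qed
  have b1: "\<bar>\<phi> x\<bar> \<le> 1" "\<bar>v n x\<bar> \<le> 1" "\<bar>v n x - \<phi> x\<bar> \<le> 1" for n x
    using cutoff_bounds[of n x] by (auto simp: \<phi>_def bd_trace_def v_def)
  have lim: "(\<lambda>n. v n x) \<longlonglongrightarrow> \<phi> x" for x
    using tendsto_diff[OF tendsto_const[of 1] cutoff_V_tendsto[of x]] by (simp add: v_def \<phi>_def bd_trace_def)
  have bt: "boundary_tendsto tree L1_loc v \<phi>"
    unfolding boundary_tendsto.simps
  proof (intro allI impI)
    fix K assume K: "compact K \<and> K \<subseteq> frontier tree"
    have Ks: "K \<in> sets bdry" using K by (intro sets_boundary) (auto simp: borel_compact)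
    have "(\<lambda>n. \<integral>x. indicator K x *\<^sub>R \<bar>v n x - \<phi> x\<bar> \<partial>bdry) \<longlonglongrightarrow> (\<integral>x. 0 \<partial>bdry)"
    proof (rule integral_dominated_convergence[where w = "\<lambda>_. 1"])
      show "(\<lambda>x. indicator K x *\<^sub>R \<bar>v n x - \<phi> x\<bar>) \<in> borel_measurable bdry" for n
        using Ks vm[of n] \<phi>m by measurable
      show "AE x in bdry. (\<lambda>n. indicator K x *\<^sub>R \<bar>v n x - \<phi> x\<bar>) \<longlonglongrightarrow> 0"
      proof (intro AE_I2)
        fix x
        have "(\<lambda>n. indicator K x *\<^sub>R \<bar>v n x - \<phi> x\<bar>) \<longlonglongrightarrow> indicator K x *\<^sub>R \<bar>\<phi> x - \<phi> x\<bar>"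
          by (intro tendsto_intros lim)
        then show "(\<lambda>n. indicator K x *\<^sub>R \<bar>v n x - \<phi> x\<bar>) \<longlonglongrightarrow> 0" by simp
      qed
      show "AE x in bdry. norm (indicator K x *\<^sub>R \<bar>v n x - \<phi> x\<bar>) \<le> 1" for n
        using b1(3)[of n] by (intro AE_I2) (auto simp: indicator_def)
    qed auto
    then show "(\<lambda>n. LINT x:K|bdry. \<bar>v n x - \<phi> x\<bar>) \<longlonglongrightarrow> 0" by (simp add: set_lebesgue_integral_def)
  qed
  have "approximative_trace tree 9 L1_loc (\<lambda>_. 0) \<phi>"
    unfolding approximative_trace_def
  proof (intro conjI exI[of _ v] allI)
    show "\<phi> \<in> boundary_space tree L1_loc" using \<phi>m bd b1 by auto
    show "v n \<in> boundary_space tree L1_loc" for n using vm bd b1 by auto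
    show "continuous_on (closure tree) (v n)" for n
      unfolding v_def[abs_def] by (intro continuous_intros cutoff_continuous)
  qed (use zs vs st bt in auto)
  moreover have "\<not> (AE x in bdry. \<phi> x = 0)"
  proof
    assume "AE x in bdry. \<phi> x = 0"
    \<comment> \<open>At height 0 \<open>bd_trace\<close> is 0, so \<phi> is 1 there.\<close>
    then have "AE x in bdry. x \<notin> floor_square"
      by eventually_elim (auto simp: \<phi>_def bd_trace_def floor_square_def)
    moreover have fb: "floor_square \<in> sets borel"
      unfolding floor_square_def atLeastAtMost_iff
      by (intro borel_closed closed_Collect_conj closed_Collect_le closed_Collect_eq continuous_intros)
    ultimately have "floor_square \<in> null_sets bdry"
      using floor_square_in_frontier sets_boundary by (subst AE_iff_null_sets) auto
    then show False
      using emeasure_boundary[OF floor_square_in_frontier fb] hausdorff_outer_floor_square by auto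
  qed
  ultimately show ?thesis unfolding approximative_trace_not_unique_def by blast
qed

theorem mainTheorem5:
  shows "\<exists>\<Omega> :: (real^3) set.
    \<Omega> \<noteq> {} \<and> open \<Omega> \<and> connected \<Omega> \<and>
    emeasure (hausdorff_measure 2) (frontier \<Omega>) < \<infinity> \<and>
    approximative_trace_not_unique \<Omega> 9 \<and>
    (\<forall>u \<in> sobolev \<Omega> 9. \<exists>\<phi>. approximative_trace \<Omega> 9 (L_q 9) u \<phi>)"
proof (intro exI[of _ tree] conjI ballI)
  show "emeasure (hausdorff_measure 2) (frontier tree) < \<infinity>"
    using hausdorff_outer_frontier_tree by (simp add: emeasure_hausdorff_measure borel_closed frontier_closed)
qed (use tree_nonempty open_tree connected_tree not_unique every_function_has_trace in auto)

end
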